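(* Let $\mathbb{F}\in\{\mathbb{R},\mathbb{C}\}$, let $C\in\mathcal{C}$ be an $\mathbb{F}$-valued correlation matrix indexed by $\mathbb{N}$, and let $(\eta_n)_{n\in\mathbb{N}}$ be a sequence of unit vectors in a Hilbert space $\mathcal{H}$ over $\mathbb{F}$ such that $C_{nm}=\langle\eta_n|\eta_m\rangle$ for all $n,m\in\mathbb{N}$. Denote $\mathcal{K}=\overline{\mathrm{lin}_{\mathbb{F}}\{\eta_n\mid n\in\mathbb{N}\}}$ (norm closure in $\mathcal{H}$) and $$\mathcal{S}=\mathrm{lin}_{\mathbb{R}}\{|\eta_n\rangle\langle\eta_n| \mid n\in\mathbb{N}\}\subseteq\mathcal{T}_s(\mathcal{K}).$$ Then $C$ is an extreme point of the convex set $\mathcal{C}$ if and only if $\mathcal{S}$ is dense in $\mathcal{T}_s(\mathcal{K})$ with respect to the trace norm.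
   Context: $\mathbb{N}=\{1,2,3,\dots\}$. $\mathcal{C}$ denotes the set of correlation matrices: infinite matrices $C=(C_{nm})_{n,m\in\mathbb{N}}$ with entries in $\mathbb{F}$ that are Hermitian ($C_{mn}=\overline{C_{nm}}$; symmetric if $\mathbb{F}=\mathbb{R}$), have unit diagonal ($C_{nn}=1$ for all $n$), and are positive semidefinite, meaning $\sum_{n,m}\overline{c_n}C_{nm}c_m\ge 0$ for every $\mathbb{F}$-valued sequence $(c_n)_{n\in\mathbb{N}}$ with only finitely many nonzero terms. $\mathcal{C}$ is a convex subset of the real vector space of Hermitian $\mathbb{F}$-valued matrices indexed by $\mathbb{N}$ (entrywise operations). Inner products are linear in the second argument. $\mathrm{lin}_{\mathbb{F}}$ and $\mathrm{lin}_{\mathbb{R}}$ denote the algebraic linear span over $\mathbb{F}$ and over $\mathbb{R}$. For $\varphi\in\mathcal{K}$, $|\varphi\rangle\langle\varphi|$ is the bounded operator $\psi\mapsto\langle\varphi|\psi\rangle\varphi$ on $\mathcal{K}$. $\mathcal{T}_s(\mathcal{K})$ is the real Banach space of selfadjoint trace class operators on $\mathcal{K}$ with the trace norm. *)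

theory Defs
  imports "HOL-Analysis.Analysis" "HOL-Library.Function_Algebras"
begin

text \<open>
  The scalar field. A type of this class is, through \<open>to_complex\<close>, an isometric copy of
  \<open>\<real>\<close> or of \<open>\<complex>\<close>, with \<open>conjg\<close> the complex conjugation (the identity in the real case).
\<close>

class real_or_complex = real_normed_field +
  fixes to_complex :: "'a \<Rightarrow> complex"
    and conjg :: "'a \<Rightarrow> 'a"
  assumes to_complex_add: "to_complex (x + y) = to_complex x + to_complex y"
    and to_complex_mult: "to_complex (x * y) = to_complex x * to_complex y"
    and to_complex_scaleR: "to_complex (r *\<^sub>R x) = r *\<^sub>R to_complex x"
    and norm_to_complex: "cmod (to_complex x) = norm x"
    and to_complex_conjg: "to_complex (conjg x) = cnj (to_complex x)"
    and range_to_complex: "range to_complex = \<real> \<or> range to_complex = UNIV"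

instantiation real :: real_or_complex
begin
definition to_complex_real :: "real \<Rightarrow> complex" where "to_complex_real = complex_of_real"
definition conjg_real :: "real \<Rightarrow> real" where "conjg_real x = x"
instance
  by standard (auto simp: to_complex_real_def conjg_real_def Reals_def scaleR_conv_of_real)
end

instantiation complex :: real_or_complex
begin
definition to_complex_complex :: "complex \<Rightarrow> complex" where "to_complex_complex z = z"
definition conjg_complex :: "complex \<Rightarrow> complex" where "conjg_complex = cnj"
instance
  by standard (auto simp: to_complex_complex_def conjg_complex_def)
end

text \<open>Entrywise real scalar multiplication, for matrices \<open>nat \<Rightarrow> nat \<Rightarrow> 'f\<close> and for operators.\<close>

instantiation "fun" :: (type, real_vector) real_vector
begin
definition scaleR_fun :: "real \<Rightarrow> ('a \<Rightarrow> 'b) \<Rightarrow> 'a \<Rightarrow> 'b"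
  where "scaleR_fun r f = (\<lambda>x. r *\<^sub>R f x)"
instance
  by standard (auto simp: scaleR_fun_def fun_eq_iff algebra_simps)
end

text \<open>The type \<open>nat\<close> serves as the index set, i.e. indices are shifted by one.\<close>

definition correlation_matrices :: "(nat \<Rightarrow> nat \<Rightarrow> 'f::real_or_complex) set" where
  "correlation_matrices = {C.
     (\<forall>n m. C m n = conjg (C n m)) \<and>
     (\<forall>n. C n n = 1) \<and>
     (\<forall>c :: nat \<Rightarrow> 'f. finite {n. c n \<noteq> 0} \<longrightarrow>
        (\<Sum>n | c n \<noteq> 0. \<Sum>m | c m \<noteq> 0. conjg (c n) * C n m * c m) \<in> \<real>\<^sub>\<ge>\<^sub>0)}"

text \<open>
  A Hilbert space over the scalar field. The type \<open>'h\<close> carries the norm, the topology and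
  the underlying real Hilbert space structure. The axioms imply, by polarization, that the
  real inner product \<open>x \<bullet> y\<close> is the real part of \<open>ip x y\<close>.
\<close>

locale hilbert_space = vector_space scale
  for scale :: "'f::real_or_complex \<Rightarrow> 'h::{real_inner,complete_space} \<Rightarrow> 'h" +
  fixes ip :: "'h \<Rightarrow> 'h \<Rightarrow> 'f"
  assumes scale_of_real: "scale (of_real r) x = r *\<^sub>R x"
    and ip_add_right: "ip x (y + z) = ip x y + ip x z"
    and ip_scale_right: "ip x (scale a y) = a * ip x y"
    and ip_conjg: "ip y x = conjg (ip x y)"
    and ip_self: "ip x x = of_real ((norm x)\<^sup>2)"
begin

text \<open>
  An operator on a closed subspace \<open>K\<close> is represented by a function that vanishes outside
  \<open>K\<close>, so that equality and the pointwise vector space operations are those of operators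
  on \<open>K\<close>.
\<close>

definition bounded_op :: "'h set \<Rightarrow> ('h \<Rightarrow> 'h) \<Rightarrow> bool" where
  "bounded_op K T \<longleftrightarrow>
     (\<forall>x\<in>K. T x \<in> K) \<and> (\<forall>x. x \<notin> K \<longrightarrow> T x = 0) \<and>
     (\<forall>x\<in>K. \<forall>y\<in>K. T (x + y) = T x + T y) \<and>
     (\<forall>a. \<forall>x\<in>K. T (scale a x) = scale a (T x)) \<and>
     (\<exists>B. \<forall>x\<in>K. norm (T x) \<le> B * norm x)"

definition selfadjoint_op :: "'h set \<Rightarrow> ('h \<Rightarrow> 'h) \<Rightarrow> bool" where
  "selfadjoint_op K T \<longleftrightarrow> bounded_op K T \<and> (\<forall>x\<in>K. \<forall>y\<in>K. ip x (T y) = ip (T x) y)"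

definition positive_op :: "'h set \<Rightarrow> ('h \<Rightarrow> 'h) \<Rightarrow> bool" where
  "positive_op K P \<longleftrightarrow> selfadjoint_op K P \<and> (\<forall>x\<in>K. ip x (P x) \<in> \<real>\<^sub>\<ge>\<^sub>0)"

text \<open>
  \<open>P\<close> is the absolute value of \<open>T\<close>, i.e. the positive square root of \<open>T\<^sup>* T\<close>. The equation
  \<open>P\<^sup>2 = T\<^sup>* T\<close> is written without the adjoint, using \<open>\<langle>x|T\<^sup>* T y\<rangle> = \<langle>T x|T y\<rangle>\<close>.
\<close>

definition is_abs_op :: "'h set \<Rightarrow> ('h \<Rightarrow> 'h) \<Rightarrow> ('h \<Rightarrow> 'h) \<Rightarrow> bool" where
  "is_abs_op K T P \<longleftrightarrow>
     positive_op K P \<and> (\<forall>x\<in>K. \<forall>y\<in>K. ip x (P (P y)) = ip (T x) (T y))"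

definition orthonormal_basis :: "'h set \<Rightarrow> 'h set \<Rightarrow> bool" where
  "orthonormal_basis K E \<longleftrightarrow>
     E \<subseteq> K \<and> (\<forall>e\<in>E. \<forall>f\<in>E. ip e f = (if e = f then 1 else 0)) \<and> closure (span E) = K"

text \<open>
  \<open>T\<close> is trace class if the nonnegative diagonal sum of its absolute value converges in an
  orthonormal basis; neither convergence nor the value of the sum depends on the basis.
\<close>

definition trace_class :: "'h set \<Rightarrow> ('h \<Rightarrow> 'h) \<Rightarrow> bool" where
  "trace_class K T \<longleftrightarrow> bounded_op K T \<and>
     (\<exists>P E. is_abs_op K T P \<and> orthonormal_basis K E \<and>
        (\<lambda>e. Re (to_complex (ip e (P e)))) summable_on E)"

definition trace_norm :: "'h set \<Rightarrow> ('h \<Rightarrow> 'h) \<Rightarrow> real" where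
  "trace_norm K T =
     (\<Sum>\<^sub>\<infinity>e\<in>(SOME E. orthonormal_basis K E).
        Re (to_complex (ip e ((THE P. is_abs_op K T P) e))))"

definition selfadjoint_trace_class :: "'h set \<Rightarrow> ('h \<Rightarrow> 'h) set" where
  "selfadjoint_trace_class K = {T. selfadjoint_op K T \<and> trace_class K T}"

definition trace_norm_dense :: "'h set \<Rightarrow> ('h \<Rightarrow> 'h) set \<Rightarrow> bool" where
  "trace_norm_dense K S \<longleftrightarrow>
     S \<subseteq> selfadjoint_trace_class K \<and>
     (\<forall>T \<in> selfadjoint_trace_class K. \<forall>\<epsilon>>0. \<exists>A\<in>S. trace_norm K (T - A) < \<epsilon>)"

definition ket_bra :: "'h set \<Rightarrow> 'h \<Rightarrow> 'h \<Rightarrow> 'h" where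
  "ket_bra K \<phi> = (\<lambda>\<psi>. if \<psi> \<in> K then scale (ip \<phi> \<psi>) \<phi> else 0)"

end

lemma hilbert_space_real:
  "hilbert_space (scaleR :: real \<Rightarrow> 'h::{real_inner,complete_space} \<Rightarrow> 'h) inner"
  by unfold_locales
    (auto simp: conjg_real_def inner_commute inner_add_right power2_norm_eq_inner algebra_simps)

lemma hilbert_space_complex: "hilbert_space ((*) :: complex \<Rightarrow> _) (\<lambda>x y. cnj x * y)"
  by unfold_locales
    (auto simp: conjg_complex_def scaleR_conv_of_real algebra_simps complex_norm_square
      simp flip: of_real_power)

end

theory Submission
  imports Defs
begin

text \<open>
  Both properties say that a functional vanishing on all \<open>|\<eta>\<^sub>n\<rangle>\<langle>\<eta>\<^sub>n|\<close> is zero. If \<open>S\<close> is not dense,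
  Hahn--Banach gives a bounded real functional \<open>\<phi>\<close> that vanishes on \<open>S\<close>; polarizing
  \<open>x \<mapsto> \<phi>(|x\<rangle>\<langle>x|)\<close> yields a matrix \<open>D\<close> with zero diagonal for which \<open>C + D\<close> and \<open>C - D\<close> are
  correlation matrices, so \<open>D = 0\<close> and then \<open>\<phi> = 0\<close> by density of the finite rank operators.
  Conversely, if \<open>C\<close> is a proper convex combination of \<open>A\<close> and \<open>B\<close>, then \<open>A - B\<close> is the Gram matrix
  of a bounded Hermitian form on the span of the \<open>\<eta>\<^sub>n\<close>. Paired with finite rank operators, this form is
  continuous in the trace norm and vanishes on \<open>S\<close>; density makes it vanish.

  The trace norm is handled through the spectral theorem for compact selfadjoint operators, which
  shows that it is the supremum of \<open>\<Sum>f\<in>F. \<bar>\<langle>f|T f\<rangle>\<bar>\<close> over finite orthonormal sets \<open>F\<close>.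
\<close>

section \<open>Scalars\<close>

text \<open>\<open>trace_norm\<close> rests on a chosen basis and a definite description, so even
  its triangle inequality is hidden. \<open>diag_bound\<close> avoids both choices and is plainly
  subadditive. Each link between the two passes through an eigenbasis, so compactness has to come
  first, by an argument free of spectral theory: trace class implies Hilbert-Schmidt. The operators
  form a set in a function type, which is why Hahn-Banach is proved for a seminorm on a subspace. C
  + D and C - D stay positive because a functional bounded by the trace norm is at most (norm x)^2
  in modulus at |x><x|, and (norm x)^2 is the value of the form of C at coefficients of x.
  Conversely, C = (1 - u) A + u B with 0 < u < 1 puts A and B below a multiple of C; hence their
  forms vanish on the null vectors of C and descend to the algebraic span \<open>L\<close>. They are
  never extended to K: density is applied only to |z><z| with z in \<open>L\<close>, where all
  operators that occur have finite rank and range in \<open>L\<close>.\<close>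

definition re :: "'a::real_or_complex \<Rightarrow> real" where
  "re x = Re (to_complex x)"

lemma to_complex_eq_iff [simp]: "to_complex x = to_complex y \<longleftrightarrow> x = y"
proof
  assume eq: "to_complex x = to_complex y"
  have "to_complex (x - y) + to_complex y = to_complex x"
    by (simp flip: to_complex_add)
  then have "norm (x - y) = 0"
    using eq norm_to_complex[of "x - y"] by simp
  then show "x = y" by simp
qed simp

lemma to_complex_0 [simp]: "to_complex 0 = 0"
  using norm_to_complex[of 0] by simp

lemma to_complex_uminus: "to_complex (- x) = - to_complex x"
  using to_complex_add[of x "-x"] by (simp add: add_eq_0_iff)

lemma to_complex_diff: "to_complex (x - y) = to_complex x - to_complex y"
  using to_complex_add[of x "-y"] by (simp add: to_complex_uminus)

lemma to_complex_1 [simp]: "to_complex 1 = 1"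
proof -
  have "to_complex (1::'a) * to_complex (1::'a) = to_complex (1::'a)"
    using to_complex_mult[of "1::'a" 1] by simp
  moreover have "to_complex (1::'a) \<noteq> 0"
    using norm_to_complex[of "1::'a"] by auto
  ultimately show ?thesis by (metis mult_cancel_right1)
qed

lemma to_complex_of_real [simp]: "to_complex (of_real r) = complex_of_real r"
  by (simp add: of_real_def to_complex_scaleR)

lemma conjg_add: "conjg (x + y) = conjg x + conjg y"
  by (subst to_complex_eq_iff[symmetric]) (simp add: to_complex_conjg to_complex_add)

lemma conjg_mult: "conjg (x * y) = conjg x * conjg y"
  by (subst to_complex_eq_iff[symmetric]) (simp add: to_complex_conjg to_complex_mult)

lemma conjg_diff: "conjg (x - y) = conjg x - conjg y"
  by (subst to_complex_eq_iff[symmetric]) (simp add: to_complex_conjg to_complex_diff)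

lemma conjg_of_real [simp]: "conjg (of_real r) = of_real r"
  by (subst to_complex_eq_iff[symmetric]) (simp add: to_complex_conjg)

lemma conjg_0 [simp]: "conjg 0 = 0"
  using conjg_of_real[of 0] by (simp del: conjg_of_real)

lemma conjg_conjg [simp]: "conjg (conjg x) = x"
  by (subst to_complex_eq_iff[symmetric]) (simp add: to_complex_conjg)

lemma norm_conjg [simp]: "norm (conjg x) = norm x"
  using norm_to_complex[of x] norm_to_complex[of "conjg x"] by (simp add: to_complex_conjg)

lemma conjg_mult_self: "conjg x * x = of_real ((norm x)\<^sup>2)"
  by (subst to_complex_eq_iff[symmetric])
    (use complex_norm_square[of "to_complex x"] in
      \<open>simp add: to_complex_conjg to_complex_mult mult.commute norm_to_complex del: of_real_power\<close>)

lemma conjg_sum: "conjg (sum f A) = (\<Sum>i\<in>A. conjg (f i))"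
  by (induction A rule: infinite_finite_induct) (simp_all add: conjg_add)

lemma re_add: "re (x + y) = re x + re y"
  by (simp add: re_def to_complex_add)

lemma re_diff: "re (x - y) = re x - re y"
  by (simp add: re_def to_complex_diff)

lemma re_of_real [simp]: "re (of_real r) = r"
  by (simp add: re_def)

lemma re_0 [simp]: "re 0 = 0"
  by (simp add: re_def)

lemma re_of_real_mult [simp]: "re (of_real r * x) = r * re x"
  by (simp add: re_def to_complex_mult)

lemma re_scaleR: "re (r *\<^sub>R x) = r * re x"
  by (simp add: re_def to_complex_scaleR)

lemma re_conjg [simp]: "re (conjg x) = re x"
  by (simp add: re_def to_complex_conjg)

lemma abs_re_le: "\<bar>re x\<bar> \<le> norm x"
  using abs_Re_le_cmod[of "to_complex x"] by (simp add: re_def norm_to_complex)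

lemma re_sum: "re (sum f A) = (\<Sum>i\<in>A. re (f i))"
  by (induction A rule: infinite_finite_induct) (simp_all add: re_add)

lemma conjg_eq_self_imp_real:
  assumes "conjg x = x"
  shows "x = of_real (re x)"
proof (subst to_complex_eq_iff[symmetric])
  have "cnj (to_complex x) = to_complex x"
    using assms by (simp flip: to_complex_conjg)
  then show "to_complex x = to_complex (of_real (re x) :: 'a)"
    by (simp add: re_def complex_eq_iff)
qed

lemma nonneg_Reals_iff_re:
  fixes x :: "'a::real_or_complex"
  shows "x \<in> \<real>\<^sub>\<ge>\<^sub>0 \<longleftrightarrow> conjg x = x \<and> re x \<ge> 0"
proof
  assume "conjg x = x \<and> re x \<ge> 0"
  then have "x = of_real (re x)" and "of_real (re x) \<in> (\<real>\<^sub>\<ge>\<^sub>0 :: 'a set)"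
    by (auto simp only: nonneg_Reals_of_real_iff intro!: conjg_eq_self_imp_real)
  then show "x \<in> \<real>\<^sub>\<ge>\<^sub>0" by (rule ssubst)
qed (auto simp: nonneg_Reals_def)

text \<open>Rotating by a phase turns a bound on real parts into a bound on moduli. Cauchy-Schwarz
  and polarization use this to avoid a case distinction on the field.\<close>

lemma conjg_phase:
  obtains u :: "'a::real_or_complex" where "norm u = 1" "u * a = of_real (norm a)"
proof (cases "a = 0")
  case False
  have "norm (conjg a / of_real (norm a)) = 1"
    using False by (simp add: norm_divide)
  moreover have "conjg a / of_real (norm a) * a = of_real (norm a)"
    using False by (simp add: conjg_mult_self power2_eq_square)
  ultimately show ?thesis by (rule that)
qed (use that[of 1] in simp)

text \<open>The real and the complex case are treated alike by taking \<open>j = 0\<close> when the field is real.\<close>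

lemma imaginary_unit:
  obtains j :: "'a::real_or_complex" where
    "conjg j = - j" "j = 0 \<or> j * j = - 1"
    "\<And>a. \<exists>r s. a = of_real r + of_real s * j \<and> \<bar>r\<bar> \<le> norm a \<and> \<bar>s\<bar> \<le> norm a"
proof (cases "range (to_complex :: 'a \<Rightarrow> complex) = UNIV")
  case True
  then obtain j :: 'a where j: "to_complex j = \<i>"
    by (metis surjD)
  show ?thesis
  proof (rule that[of j])
    show "conjg j = - j"
      by (subst to_complex_eq_iff[symmetric]) (simp add: to_complex_conjg to_complex_uminus j)
    have "j * j = - 1"
      by (subst to_complex_eq_iff[symmetric]) (simp add: to_complex_mult to_complex_uminus j)
    then show "j = 0 \<or> j * j = - 1" ..
    fix a :: 'a
    have "a = of_real (Re (to_complex a)) + of_real (Im (to_complex a)) * j"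
      by (subst to_complex_eq_iff[symmetric])
        (simp add: to_complex_mult to_complex_add j complex_eq_iff)
    then show "\<exists>r s. a = of_real r + of_real s * j \<and> \<bar>r\<bar> \<le> norm a \<and> \<bar>s\<bar> \<le> norm a"
      by (metis abs_Re_le_cmod abs_Im_le_cmod norm_to_complex)
  qed
next
  case False
  then have *: "to_complex a \<in> \<real>" for a :: 'a
    using range_to_complex[where 'a='a] by auto
  show ?thesis
  proof (rule that[of 0])
    fix a :: 'a
    have "a = of_real (re a)"
      by (subst to_complex_eq_iff[symmetric]) (use *[of a] in \<open>simp add: re_def\<close>)
    then show "\<exists>r s. a = of_real r + of_real s * 0 \<and> \<bar>r\<bar> \<le> norm a \<and> \<bar>s\<bar> \<le> norm a"
      using abs_re_le[of a] by (intro exI[of _ "re a"] exI[of _ 0]) auto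
  qed simp_all
qed

text \<open>The ball is a closed subset of the continuous image of a square of real coordinates.
  This is the source of compactness for operators of finite rank.\<close>

lemma compact_scalar_cball: "compact (cball (0::'a::real_or_complex) r)"
proof -
  obtain j :: 'a where
    "\<And>a. \<exists>r s. a = of_real r + of_real s * j \<and> \<bar>r\<bar> \<le> norm a \<and> \<bar>s\<bar> \<le> norm a"
    using imaginary_unit by metis
  then have "a \<in> (\<lambda>(u, v). of_real u + of_real v * j) ` ({-r..r} \<times> {-r..r})"
    if "a \<in> cball 0 r" for a
    using that by (force simp: abs_le_iff)
  moreover have "compact ((\<lambda>(u, v). of_real u + of_real v * j) ` ({-r..r} \<times> {-r..r}))"
    by (intro compact_continuous_image compact_Times compact_Icc)
      (auto simp: case_prod_unfold intro!: continuous_intros)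
  ultimately show ?thesis
    by (metis closed_Int_compact closed_cball inf.absorb1 subsetI)
qed

section \<open>Geometry of the Hilbert space\<close>

context hilbert_space
begin

lemma ip_0_right [simp]: "ip x 0 = 0"
  using ip_add_right[of x 0 0] by simp

lemma ip_add_left: "ip (x + y) z = ip x z + ip y z"
  by (metis ip_conjg ip_add_right conjg_add)

lemma ip_scale_left: "ip (scale a x) y = conjg a * ip x y"
  by (metis ip_conjg ip_scale_right conjg_mult)

lemma ip_0_left [simp]: "ip 0 x = 0"
  using ip_add_left[of 0 0 x] by simp

lemma ip_scaleR_right: "ip x (r *\<^sub>R y) = r *\<^sub>R ip x y"
  by (simp add: ip_scale_right scaleR_conv_of_real flip: scale_of_real)

lemma ip_scaleR_left: "ip (r *\<^sub>R x) y = r *\<^sub>R ip x y"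
  by (simp add: ip_scale_left scaleR_conv_of_real flip: scale_of_real)

lemma norm_scale: "norm (scale a x) = norm a * norm x"
proof -
  have "of_real ((norm (scale a x))\<^sup>2) = (of_real ((norm a * norm x)\<^sup>2) :: 'f)"
  proof -
    have "of_real ((norm (scale a x))\<^sup>2) = conjg a * a * ip x x"
      by (simp only: ip_scale_left ip_scale_right mult.assoc flip: ip_self)
        (simp only: mult.left_commute)
    then show ?thesis
      by (simp only: conjg_mult_self ip_self power_mult_distrib of_real_mult)
  qed
  then show ?thesis
    by (simp only: of_real_eq_iff) (simp add: power2_eq_iff_nonneg)
qed

lemma re_ip: "re (ip x y) = x \<bullet> y"
proof -
  have "re (ip y x) = re (ip x y)"
    by (metis ip_conjg re_conjg)
  moreover have "re (ip (x + y) (x + y)) = re (ip x x) + re (ip x y) + re (ip y x) + re (ip y y)"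
    by (simp only: ip_add_left ip_add_right re_add)
  ultimately have "(norm (x + y))\<^sup>2 = (norm x)\<^sup>2 + 2 * re (ip x y) + (norm y)\<^sup>2"
    by (simp only: ip_self re_of_real)
  then show ?thesis
    by (simp add: power2_norm_eq_inner inner_add_left inner_add_right inner_commute)
qed

lemma norm_ip_le: "norm (ip x y) \<le> norm x * norm y"
proof -
  obtain u where u: "norm u = 1" "u * ip x y = of_real (norm (ip x y))"
    by (rule conjg_phase)
  then have "norm (ip x y) = x \<bullet> scale u y"
    by (simp add: ip_scale_right flip: re_ip)
  also have "\<dots> \<le> norm x * norm (scale u y)"
    by (rule norm_cauchy_schwarz)
  finally show ?thesis
    by (simp add: norm_scale u)
qed

lemma bounded_bilinear_ip: "bounded_bilinear ip"
  by (rule bounded_bilinear.intro)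
    (auto simp: ip_add_left ip_add_right ip_scaleR_left ip_scaleR_right norm_ip_le
      intro!: exI[of _ 1])

lemma scaleR_scale: "r *\<^sub>R scale a x = scale (r *\<^sub>R a) x"
  by (simp add: scaleR_conv_of_real flip: scale_of_real)

lemma scale_scaleR: "scale a (r *\<^sub>R x) = r *\<^sub>R scale a x"
  by (simp add: mult.commute flip: scale_of_real)

lemma bounded_bilinear_scale: "bounded_bilinear scale"
  by (rule bounded_bilinear.intro)
    (auto simp: scale_left_distrib scale_right_distrib scaleR_scale scale_scaleR norm_scale
      intro!: exI[of _ 1])

sublocale ip: bounded_bilinear ip
  by (rule bounded_bilinear_ip)

sublocale scale: bounded_bilinear scale
  by (rule bounded_bilinear_scale)

lemma ip_sum_scale_right: "ip x (\<Sum>i\<in>A. scale (a i) (f i)) = (\<Sum>i\<in>A. a i * ip x (f i))"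
  by (simp add: ip.sum_right ip_scale_right)

lemma ip_eq_0_commute: "ip x y = 0 \<longleftrightarrow> ip y x = 0"
  by (metis conjg_0 ip_conjg)

lemma ip_self_eq_0 [simp]: "ip x x = 0 \<longleftrightarrow> x = 0"
  by (simp add: ip_self)

lemma norm_add_orthogonal:
  assumes "ip x y = 0"
  shows "(norm (x + y))\<^sup>2 = (norm x)\<^sup>2 + (norm y)\<^sup>2"
  using re_ip[of x y] assms
  by (simp add: power2_norm_eq_inner inner_add_left inner_add_right inner_commute)

lemma norm_ip_commute: "norm (ip x y) = norm (ip y x)"
  by (metis ip_conjg norm_conjg)

end

section \<open>The Hahn--Banach theorem\<close>

definition sublinear :: "('a::real_vector \<Rightarrow> real) \<Rightarrow> bool" where
  "sublinear p \<longleftrightarrow> (\<forall>x y. p (x + y) \<le> p x + p y) \<and> (\<forall>x. \<forall>t\<ge>0. p (t *\<^sub>R x) = t * p x)"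

text \<open>One inequality suffices for homogeneity: applied with inverse t to t x, it gives the
  other one.\<close>

lemma sublinearI:
  assumes "\<And>x y. p (x + y) \<le> p x + p y" "p 0 = 0" "\<And>x t. t > 0 \<Longrightarrow> p (t *\<^sub>R x) \<le> t * p x"
  shows "sublinear p"
  unfolding sublinear_def
proof (intro conjI allI impI)
  fix x :: 'a and t :: real
  assume "0 \<le> t"
  show "p (t *\<^sub>R x) = t * p x"
  proof (cases "t = 0")
    case False
    then have t: "t > 0" using \<open>0 \<le> t\<close> by simp
    then have "p (inverse t *\<^sub>R t *\<^sub>R x) \<le> inverse t * p (t *\<^sub>R x)"
      by (intro assms) simp
    then have "t * p x \<le> p (t *\<^sub>R x)"
      using t by (simp add: field_simps)
    then show ?thesis using assms(3)[OF t, of x] by simp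
  qed (simp add: assms)
qed (rule assms)

lemma sublinear_add: "sublinear p \<Longrightarrow> p (x + y) \<le> p x + p y"
  and sublinear_scaleR: "sublinear p \<Longrightarrow> 0 \<le> t \<Longrightarrow> p (t *\<^sub>R x) = t * p x"
  by (simp_all add: sublinear_def)

lemma sublinear_0: "sublinear p \<Longrightarrow> p 0 = 0"
  using sublinear_scaleR[of p 0 0] by simp

lemma sublinear_minus: "sublinear p \<Longrightarrow> - p (- x) \<le> p x"
  using sublinear_add[of p x "-x"] by (simp add: sublinear_0)

text \<open>The infimum of p (x + t y) - t p y over t >= 0 does it: t = 0 gives q <= p, and t = 1
  gives the value at - y. Besides making minimal functionals linear, this later forces the
  separating functional to be large at a prescribed point.\<close>

lemma sublinear_decrease_along:
  assumes p: "sublinear p"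
  obtains q where "sublinear q" "q \<le> p" "q (- y) \<le> - p y"
proof -
  define v where "v x t = p (x + t *\<^sub>R y) - t * p y" for x t
  define q where "q x = (INF t\<in>{0..}. v x t)" for x
  have lower: "- p (- x) \<le> v x t" if "t \<ge> 0" for x t
    using sublinear_add[OF p, of "x + t *\<^sub>R y" "- x"] sublinear_scaleR[OF p that, of y]
    by (simp add: v_def)
  then have bdd: "bdd_below (v x ` {0..})" for x
    by (intro bdd_belowI[of _ "- p (- x)"]) auto
  have q_le: "q x \<le> v x t" if "t \<ge> 0" for x t
    unfolding q_def using bdd that by (intro cINF_lower) auto
  have q_greatest: "c \<le> q x" if "\<And>t. t \<ge> 0 \<Longrightarrow> c \<le> v x t" for c x
    unfolding q_def using that by (intro cINF_greatest) auto
  show ?thesis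
  proof (rule that)
    show "q \<le> p"
      using q_le[of 0] by (auto simp: le_fun_def v_def)
    show "q (- y) \<le> - p y"
      using q_le[of 1 "- y"] by (simp add: v_def sublinear_0[OF p])
    show "sublinear q"
    proof (rule sublinearI)
      fix x z :: 'a
      have "q (x + z) - v z s \<le> v x t" if "t \<ge> 0" "s \<ge> 0" for s t
      proof -
        have "q (x + z) \<le> v (x + z) (t + s)"
          using that by (intro q_le) auto
        also have "\<dots> \<le> v x t + v z s"
          using sublinear_add[OF p, of "x + t *\<^sub>R y" "z + s *\<^sub>R y"]
          by (simp add: v_def algebra_simps)
        finally show ?thesis by simp
      qed
      then have "q (x + z) - q x \<le> v z s" if "s \<ge> 0" for s
        using q_greatest[of "q (x + z) - v z s" x] that by force
      then show "q (x + z) \<le> q x + q z"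
        using q_greatest[of "q (x + z) - q x" z] by force
    next
      have "q 0 \<ge> 0"
        using lower[where x=0] sublinear_0[OF p] by (intro q_greatest) force
      then show "q 0 = 0"
        using q_le[of 0 0] sublinear_0[OF p] by (simp add: v_def)
    next
      fix x :: 'a and t :: real
      assume t: "t > 0"
      have "q (t *\<^sub>R x) / t \<le> v x s" if "s \<ge> 0" for s
      proof -
        have "q (t *\<^sub>R x) \<le> v (t *\<^sub>R x) (t * s)"
          using that t by (intro q_le) auto
        also have "\<dots> = t * v x s"
          using sublinear_scaleR[OF p, of t "x + s *\<^sub>R y"] t
          by (simp add: v_def algebra_simps)
        finally show ?thesis using t by (simp add: field_simps)
      qed
      then have "q (t *\<^sub>R x) / t \<le> q x" by (rule q_greatest)
      then show "q (t *\<^sub>R x) \<le> t * q x"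
        using t by (simp add: field_simps)
    qed
  qed
qed

text \<open>Zorn's lemma for the reversed pointwise order. The infimum of a chain is finite because
  every sublinear q <= p satisfies - p (- x) <= q x.\<close>

lemma minimal_sublinear:
  assumes p: "sublinear p"
  obtains q where "sublinear q" "q \<le> p" "\<And>r. sublinear r \<Longrightarrow> r \<le> q \<Longrightarrow> r = q"
proof -
  define A where "A = {q. sublinear q \<and> q \<le> p}"
  have "\<exists>m\<in>A. \<forall>a\<in>A. a \<le> m \<longrightarrow> a = m"
  proof (rule predicate_Zorn)
    show "partial_order_on A (relation_of (\<lambda>x y. y \<le> x) A)"
      by (rule partial_order_on_relation_ofI) auto
    fix C
    assume C: "C \<in> Chains (relation_of (\<lambda>x y. y \<le> x) A)"
    then have CA: "C \<subseteq> A"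
      by (auto simp: Chains_def relation_of_def)
    show "\<exists>u\<in>A. \<forall>a\<in>C. u \<le> a"
    proof (cases "C = {}")
      case True
      then show ?thesis using p by (auto simp: A_def)
    next
      case False
      define u where "u x = (INF q\<in>C. q x)" for x
      have sl: "sublinear q" "q \<le> p" if "q \<in> C" for q
        using CA that by (auto simp: A_def)
      have lower: "- p (- x) \<le> q x" if "q \<in> C" for q x
        using sublinear_minus[OF sl(1)[OF that], of x] sl(2)[OF that]
        by (metis le_fun_def neg_le_iff_le order.trans)
      have u_le: "u x \<le> q x" if "q \<in> C" for q x
        unfolding u_def using lower that by (intro cINF_lower bdd_belowI[of _ "- p (- x)"]) auto
      have u_greatest: "c \<le> u x" if "\<And>q. q \<in> C \<Longrightarrow> c \<le> q x" for c x
        unfolding u_def using that False by (intro cINF_greatest) auto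
      have "sublinear u"
      proof (rule sublinearI)
        fix x y
        have "u (x + y) \<le> q x + r y" if qr: "q \<in> C" "r \<in> C" for q r
        proof -
          \<comment> \<open>Subadditivity of the infimum needs the chain property: the smaller of q
            and r is below both, and is itself subadditive.\<close>
          have "q \<le> r \<or> r \<le> q"
            using C that by (auto simp: Chains_def relation_of_def)
          then obtain s where "s \<in> C" "s \<le> q" "s \<le> r"
            using qr by auto
          then show ?thesis
            using u_le[OF \<open>s \<in> C\<close>, of "x + y"] sublinear_add[OF sl(1)[OF \<open>s \<in> C\<close>], of x y]
            by (fastforce simp: le_fun_def intro: order.trans add_mono)
        qed
        then have "u (x + y) - r y \<le> u x" if "r \<in> C" for r
          using that by (intro u_greatest) (simp add: diff_le_eq)
        then have "u (x + y) - u x \<le> u y"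
          by (intro u_greatest) (force simp: diff_le_eq add.commute)
        then show "u (x + y) \<le> u x + u y" by simp
      next
        obtain q where "q \<in> C" using False by auto
        then have "u 0 \<le> 0"
          using u_le[of q 0] sublinear_0[OF sl(1)] by force
        moreover have "u 0 \<ge> 0"
          by (intro u_greatest) (simp add: sublinear_0[OF sl(1)])
        ultimately show "u 0 = 0" by simp
      next
        fix x and t :: real
        assume t: "t > 0"
        have "u (t *\<^sub>R x) / t \<le> u x"
        proof (rule u_greatest)
          fix q assume "q \<in> C"
          then show "u (t *\<^sub>R x) / t \<le> q x"
            using u_le[of q "t *\<^sub>R x"] sublinear_scaleR[OF sl(1), of q t x] t
            by (simp add: field_simps)
        qed
        then show "u (t *\<^sub>R x) \<le> t * u x"
          using t by (simp add: field_simps)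
      qed
      moreover have "u \<le> p"
        using False u_le sl(2) by (fastforce simp: le_fun_def intro: order.trans)
      ultimately show ?thesis
        using u_le by (intro bexI[of _ u]) (auto simp: A_def le_fun_def)
    qed
  qed
  then obtain m where m: "m \<in> A" "\<And>a. a \<in> A \<Longrightarrow> a \<le> m \<Longrightarrow> a = m" by blast
  show ?thesis
  proof (rule that[of m])
    fix r assume "sublinear r" "r \<le> m"
    then show "r = m" using m by (auto simp: A_def intro: order.trans)
  qed (use m in \<open>auto simp: A_def\<close>)
qed

text \<open>A minimal sublinear functional is linear, because it cannot decrease along any direction.\<close>

lemma linear_below_sublinear:
  assumes "sublinear p"
  obtains f where "linear f" "f \<le> p"
proof -
  obtain q where q: "sublinear q" "q \<le> p" "\<And>r. sublinear r \<Longrightarrow> r \<le> q \<Longrightarrow> r = q"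
    using minimal_sublinear[OF assms] by metis
  have minus: "q (- y) = - q y" for y
  proof -
    obtain r where "sublinear r" "r \<le> q" "r (- y) \<le> - q y"
      using sublinear_decrease_along[OF q(1)] by metis
    then show ?thesis
      using q(3) sublinear_minus[OF q(1), of y] by force
  qed
  have "linear q"
  proof (rule linearI)
    show "q (x + y) = q x + q y" for x y
      using sublinear_add[OF q(1), of x y] sublinear_add[OF q(1), of "- x" "- y"]
        minus[of "x + y"] minus[of x] minus[of y] by simp
    show "q (t *\<^sub>R x) = t *\<^sub>R q x" for t x
    proof (cases "t \<ge> 0")
      case False
      then show ?thesis
        using sublinear_scaleR[OF q(1), of "- t" x] minus[of "t *\<^sub>R x"] by simp
    qed (simp add: sublinear_scaleR[OF q(1)])
  qed
  then show ?thesis using q(2) by (rule that)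
qed

text \<open>The seminorm distance to S is sublinear, at most p, and at most 0 on S; a linear
  functional below it is therefore bounded by p and vanishes on S.\<close>

lemma hahn_banach_separation:
  fixes p :: "'a::real_vector \<Rightarrow> real"
  assumes V: "subspace V" and S: "subspace S" "S \<subseteq> V"
    and nonneg: "\<And>x. x \<in> V \<Longrightarrow> 0 \<le> p x"
    and add: "\<And>x y. x \<in> V \<Longrightarrow> y \<in> V \<Longrightarrow> p (x + y) \<le> p x + p y"
    and scale: "\<And>x r. x \<in> V \<Longrightarrow> p (r *\<^sub>R x) = \<bar>r\<bar> * p x"
    and x0: "x0 \<in> V" "\<And>a. a \<in> S \<Longrightarrow> e \<le> p (x0 - a)"
  obtains f where "linear f" "\<And>x. x \<in> V \<Longrightarrow> \<bar>f x\<bar> \<le> p x" "\<And>a. a \<in> S \<Longrightarrow> f a = 0" "e \<le> f x0"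
proof -
  \<comment> \<open>A linear projection onto V: p is controlled only on V, while sublinear
    functionals live on the whole type.\<close>
  obtain \<pi> :: "'a \<Rightarrow> 'a" where \<pi>: "range \<pi> \<subseteq> V" "linear \<pi>" "\<And>v. v \<in> V \<Longrightarrow> \<pi> v = v"
    using real_vector.linear_exists_left_inverse_on[OF linear_ident V] by auto
  note lin = linear_add[OF \<pi>(2)] linear_scale[OF \<pi>(2)]
  have V': "\<pi> x - a \<in> V" if "a \<in> S" for x a
    using \<pi>(1) S that V by (auto intro: subspace_diff)
  define q where "q x = (INF a\<in>S. p (\<pi> x - a))" for x
  have q_le: "q x \<le> p (\<pi> x - a)" if "a \<in> S" for x a
    unfolding q_def using nonneg V' that by (intro cINF_lower bdd_belowI[of _ 0]) auto
  have "S \<noteq> {}" using S(1) by (auto dest: subspace_0)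
  then have q_greatest: "c \<le> q x" if "\<And>a. a \<in> S \<Longrightarrow> c \<le> p (\<pi> x - a)" for c x
    unfolding q_def using that by (intro cINF_greatest) auto
  have p0: "p 0 = 0"
    using scale[of 0 0] subspace_0[OF V] by simp
  have qS: "q a \<le> 0" if "a \<in> S" for a
  proof -
    have "\<pi> a = a"
      using \<pi>(3) that S by auto
    then show ?thesis
      using q_le[OF that, of a] p0 by simp
  qed
  have "sublinear q"
  proof (rule sublinearI)
    fix x y
    have "q (x + y) \<le> p (\<pi> x - a) + p (\<pi> y - b)" if "a \<in> S" "b \<in> S" for a b
    proof -
      have "q (x + y) \<le> p (\<pi> (x + y) - (a + b))"
        using that S by (intro q_le subspace_add)
      also have "\<dots> \<le> p (\<pi> x - a) + p (\<pi> y - b)"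
        using add[OF V'[OF that(1), of x] V'[OF that(2), of y]] by (simp add: lin algebra_simps)
      finally show ?thesis .
    qed
    then have "q (x + y) - p (\<pi> y - b) \<le> q x" if "b \<in> S" for b
      using that by (intro q_greatest) (simp add: diff_le_eq)
    then have "q (x + y) - q x \<le> q y"
      by (intro q_greatest) (force simp: diff_le_eq add.commute)
    then show "q (x + y) \<le> q x + q y" by simp
  next
    have "q 0 \<ge> 0" using nonneg V' by (intro q_greatest) auto
    then show "q 0 = 0" using qS[of 0] S subspace_0 by fastforce
  next
    fix x and t :: real
    assume t: "t > 0"
    have "q (t *\<^sub>R x) / t \<le> q x"
    proof (rule q_greatest)
      fix a assume a: "a \<in> S"
      then have "q (t *\<^sub>R x) \<le> p (\<pi> (t *\<^sub>R x) - t *\<^sub>R a)"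
        using S by (intro q_le subspace_scale)
      also have "\<dots> = t * p (\<pi> x - a)"
        using scale[OF V'[OF a, of x], of t] t by (simp add: lin scaleR_diff_right)
      finally show "q (t *\<^sub>R x) / t \<le> p (\<pi> x - a)"
        using t by (simp add: field_simps)
    qed
    then show "q (t *\<^sub>R x) \<le> t * q x"
      using t by (simp add: field_simps)
  qed
  \<comment> \<open>Decreasing q along x0 before passing to a linear f <= r yields f x0 = - f (- x0)
    >= - r (- x0) >= q x0.\<close>
  then obtain r where r: "sublinear r" "r \<le> q" "r (- x0) \<le> - q x0"
    using sublinear_decrease_along by metis
  obtain f where f: "linear f" "f \<le> r"
    using linear_below_sublinear[OF r(1)] .
  have fq: "f x \<le> q x" for x
    using f(2) r(2) by (meson le_funD order.trans)
  have fp: "f x \<le> p x" if "x \<in> V" for x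
    using fq[of x] q_le[of 0 x] subspace_0[OF S(1)] \<pi>(3)[OF that] by simp
  show ?thesis
  proof (rule that)
    show "linear f" by fact
    show "\<bar>f x\<bar> \<le> p x" if "x \<in> V" for x
      using fp[OF that] fp[OF subspace_neg[OF V that]] scale[OF that, of "-1"]
      by (simp add: linear_neg[OF f(1)])
    show "f a = 0" if "a \<in> S" for a
      using fq[of a] fq[of "- a"] qS[OF that] qS[OF subspace_neg[OF S(1) that]]
      by (simp add: linear_neg[OF f(1)])
    have "e \<le> q x0"
      using x0 \<pi>(3) by (intro q_greatest) auto
    also have "q x0 \<le> - r (- x0)"
      using r(3) by simp
    also have "\<dots> \<le> f x0"
      using le_funD[OF f(2), of "- x0"] by (simp add: linear_neg[OF f(1)])
    finally show "e \<le> f x0" .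
  qed
qed

section \<open>Orthonormal sets\<close>

context hilbert_space
begin

definition orthonormal :: "'h set \<Rightarrow> bool" where
  "orthonormal E \<longleftrightarrow> (\<forall>e\<in>E. \<forall>f\<in>E. ip e f = (if e = f then 1 else 0))"

lemma orthonormalD:
  "orthonormal E \<Longrightarrow> e \<in> E \<Longrightarrow> f \<in> E \<Longrightarrow> ip e f = (if e = f then 1 else 0)"
  by (simp add: orthonormal_def)

lemma orthonormal_subset: "orthonormal E \<Longrightarrow> F \<subseteq> E \<Longrightarrow> orthonormal F"
  by (simp add: orthonormal_def subset_iff)

lemma orthonormal_norm:
  assumes "orthonormal E" "e \<in> E"
  shows "norm e = 1"
proof -
  have "(of_real ((norm e)\<^sup>2) :: 'f) = of_real 1"
    using orthonormalD[OF assms(1,2,2)] by (simp only: ip_self of_real_1) simp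
  then have "(norm e)\<^sup>2 = 1"
    by (simp only: of_real_eq_iff)
  then show ?thesis
    by (simp add: power2_eq_1_iff) (use norm_ge_zero[of e] in linarith)
qed

lemma ip_orthonormal_sum:
  assumes "orthonormal E" "finite F" "F \<subseteq> E" "e \<in> E"
  shows "ip e (\<Sum>f\<in>F. scale (a f) f) = (if e \<in> F then a e else 0)"
proof -
  have "ip e (\<Sum>f\<in>F. scale (a f) f) = (\<Sum>f\<in>F. if e = f then a f else 0)"
    unfolding ip_sum_scale_right
    by (rule sum.cong) (use assms in \<open>auto simp: orthonormalD subset_iff\<close>)
  then show ?thesis using assms by simp
qed

lemma norm_orthonormal_sum:
  assumes "orthonormal F" "finite F"
  shows "(norm (\<Sum>f\<in>F. scale (a f) f))\<^sup>2 = (\<Sum>f\<in>F. (norm (a f))\<^sup>2)"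
  using assms(2,1)
proof (induction rule: finite_induct)
  case (insert e F)
  have "ip e (\<Sum>f\<in>F. scale (a f) f) = 0"
    using ip_orthonormal_sum[of "insert e F" F e a] insert by auto
  then have "ip (scale (a e) e) (\<Sum>f\<in>F. scale (a f) f) = 0"
    by (simp add: ip_scale_left)
  moreover have "norm e = 1"
    using insert.prems by (rule orthonormal_norm) simp
  ultimately show ?case
    using insert orthonormal_subset[OF insert.prems, of F]
    by (simp add: norm_add_orthogonal norm_scale subset_insertI)
qed simp

lemma bessel_residual:
  assumes "orthonormal F" "finite F"
  shows "(norm x)\<^sup>2 = (norm (x - (\<Sum>e\<in>F. scale (ip e x) e)))\<^sup>2 + (\<Sum>e\<in>F. (norm (ip e x))\<^sup>2)"
proof -
  let ?y = "\<Sum>e\<in>F. scale (ip e x) e"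
  have "ip e (x - ?y) = 0" if "e \<in> F" for e
    using ip_orthonormal_sum[OF assms(1,2) subset_refl that, of "\<lambda>e. ip e x"] that
    by (simp add: ip.diff_right)
  then have "ip (x - ?y) e = 0" if "e \<in> F" for e
    using that by (simp add: ip_eq_0_commute[of "x - ?y" e])
  then have "ip (x - ?y) ?y = 0"
    by (subst ip_sum_scale_right) simp
  then have "(norm ((x - ?y) + ?y))\<^sup>2 = (norm (x - ?y))\<^sup>2 + (norm ?y)\<^sup>2"
    by (rule norm_add_orthogonal)
  then show ?thesis
    by (simp add: norm_orthonormal_sum[OF assms])
qed

lemma bessel:
  assumes "orthonormal F" "finite F"
  shows "(\<Sum>e\<in>F. (norm (ip e x))\<^sup>2) \<le> (norm x)\<^sup>2"
  using bessel_residual[OF assms, of x] by simp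

text \<open>x and \<open>?z\<close> differ by a vector in the span of F, so they have the same
  residual, and a residual is never longer than its vector.\<close>

lemma best_approximation:
  assumes E: "orthonormal F" "finite F"
  shows "norm (x - (\<Sum>e\<in>F. scale (ip e x) e)) \<le> norm (x - (\<Sum>e\<in>F. scale (a e) e))"
proof -
  let ?z = "x - (\<Sum>e\<in>F. scale (a e) e)"
  have "ip e ?z = ip e x - a e" if "e \<in> F" for e
    using ip_orthonormal_sum[OF E subset_refl that, of a] that by (simp add: ip.diff_right)
  then have "(\<Sum>e\<in>F. scale (ip e ?z) e) = (\<Sum>e\<in>F. scale (ip e x) e) - (\<Sum>e\<in>F. scale (a e) e)"
    by (simp add: scale.diff_left sum_subtractf)
  then have "(norm (x - (\<Sum>e\<in>F. scale (ip e x) e)))\<^sup>2 \<le> (norm ?z)\<^sup>2"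
    using bessel_residual[OF E, of ?z] by (simp add: sum_nonneg)
  then show ?thesis
    by (rule power2_le_imp_le) simp
qed

lemma has_sum_orthonormal_expansion:
  assumes E: "orthonormal E" and x: "x \<in> closure (span E)"
  shows "((\<lambda>e. scale (ip e x) e) has_sum x) E"
  unfolding has_sum_def
proof (rule tendstoI)
  fix \<epsilon> :: real assume "\<epsilon> > 0"
  then obtain y where y: "y \<in> span E" "dist y x < \<epsilon>"
    using x by (auto simp: closure_approachable)
  then obtain F a where F: "finite F" "F \<subseteq> E" "y = (\<Sum>e\<in>F. scale (a e) e)"
    by (auto simp: span_explicit)
  have "dist (\<Sum>e\<in>G. scale (ip e x) e) x < \<epsilon>" if G: "finite G" "F \<subseteq> G" "G \<subseteq> E" for G
  proof -
    \<comment> \<open>The coefficients of y are extended by 0 from F to G, so the one vector y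
      competes with the best approximation for every larger G.\<close>
    have "norm (x - (\<Sum>e\<in>G. scale (ip e x) e))
        \<le> norm (x - (\<Sum>e\<in>G. scale (if e \<in> F then a e else 0) e))"
      using G E by (intro best_approximation) (auto intro: orthonormal_subset)
    also have "(\<Sum>e\<in>G. scale (if e \<in> F then a e else 0) e) = y"
      unfolding F(3) using G by (intro sum.mono_neutral_cong_right) auto
    finally show ?thesis
      using y by (simp add: dist_norm norm_minus_commute)
  qed
  then show "\<forall>\<^sub>F G in finite_subsets_at_top E. dist (\<Sum>e\<in>G. scale (ip e x) e) x < \<epsilon>"
    using F by (auto simp: eventually_finite_subsets_at_top)
qed

lemma has_sum_parseval:
  assumes "orthonormal E" "y \<in> closure (span E)"
  shows "((\<lambda>e. ip x e * ip e y) has_sum ip x y) E"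
  using has_sum_bounded_linear[OF ip.bounded_linear_right has_sum_orthonormal_expansion[OF assms],
      of x]
  by (simp add: ip_scale_right mult.commute)

lemma ip_mult_ip: "ip x e * ip e x = of_real ((norm (ip e x))\<^sup>2)"
  by (metis conjg_mult_self ip_conjg)

lemma bounded_linear_re: "bounded_linear re"
  by (rule bounded_linear_intro[where K=1]) (simp_all add: re_add re_scaleR abs_re_le)

lemma has_sum_parseval_norm:
  assumes "orthonormal E" "x \<in> closure (span E)"
  shows "((\<lambda>e. (norm (ip e x))\<^sup>2) has_sum (norm x)\<^sup>2) E"
  using has_sum_bounded_linear[OF bounded_linear_re has_sum_parseval[OF assms, of x]]
  by (simp only: ip_mult_ip ip_self re_of_real)

text \<open>By Pythagoras the squared distance of two nested partial sums is a difference of partial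
  sums of squares, so the net of finite partial sums is Cauchy. Filters replace sequences because E
  may be uncountable.\<close>

lemma summable_orthonormal:
  assumes E: "orthonormal E" and a: "(\<lambda>e. (norm (a e))\<^sup>2) summable_on E"
  shows "(\<lambda>e. scale (a e) e) summable_on E"
proof -
  let ?f = "\<lambda>F. \<Sum>e\<in>F. scale (a e) e"
  let ?s = "\<Sum>\<^sub>\<infinity>e\<in>E. (norm (a e))\<^sup>2"
  have "\<exists>P. eventually P (finite_subsets_at_top E) \<and> (\<forall>F G. P F \<and> P G \<longrightarrow> dist (?f F) (?f G) < \<epsilon>)"
    if "\<epsilon> > 0" for \<epsilon> :: real
  proof -
    define d where "d = (\<epsilon> / 2)\<^sup>2"
    then have "d > 0" using that by simp
    then obtain F0 where F0: "finite F0" "F0 \<subseteq> E"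
      "dist (\<Sum>e\<in>F0. (norm (a e))\<^sup>2) ?s \<le> d / 2"
      using has_sum_finite_approximation[OF has_sum_infsum[OF a], of "d / 2"] by auto
    have close: "dist (?f F) (?f F0) < \<epsilon> / 2" if F: "finite F" "F0 \<subseteq> F" "F \<subseteq> E" for F
    proof -
      have "?f F - ?f F0 = ?f (F - F0)"
        using F by (simp add: sum_diff)
      then have "(dist (?f F) (?f F0))\<^sup>2 = (\<Sum>e\<in>F - F0. (norm (a e))\<^sup>2)"
        using norm_orthonormal_sum[of "F - F0" a] F E
        by (simp add: dist_norm orthonormal_subset subset_iff)
      also have "\<dots> = (\<Sum>e\<in>F. (norm (a e))\<^sup>2) - (\<Sum>e\<in>F0. (norm (a e))\<^sup>2)"
        using F by (simp add: sum_diff)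
      also have "\<dots> \<le> ?s - (\<Sum>e\<in>F0. (norm (a e))\<^sup>2)"
        using finite_sum_le_infsum[OF a F(1,3)] by simp
      also have "\<dots> \<le> dist (\<Sum>e\<in>F0. (norm (a e))\<^sup>2) ?s"
        by (simp add: dist_real_def)
      also have "\<dots> < d"
        using F0(3) \<open>d > 0\<close> by simp
      finally have "(dist (?f F) (?f F0))\<^sup>2 < (\<epsilon> / 2)\<^sup>2"
        unfolding d_def .
      then show ?thesis
        by (rule power2_less_imp_less) (use \<open>\<epsilon> > 0\<close> in simp)
    qed
    have "\<forall>\<^sub>F F in finite_subsets_at_top E. finite F \<and> F0 \<subseteq> F \<and> F \<subseteq> E"
      using F0 by (auto simp: eventually_finite_subsets_at_top)
    moreover have "dist (?f F) (?f G) < \<epsilon>"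
      if "finite F \<and> F0 \<subseteq> F \<and> F \<subseteq> E" "finite G \<and> F0 \<subseteq> G \<and> G \<subseteq> E" for F G
      using close[of F] close[of G] that dist_triangle_half_l[of "?f F" "?f F0" \<epsilon> "?f G"] by auto
    ultimately show ?thesis
      by (intro exI[of _ "\<lambda>F. finite F \<and> F0 \<subseteq> F \<and> F \<subseteq> E"]) blast
  qed
  then have "cauchy_filter (filtermap ?f (finite_subsets_at_top E))"
    by (simp add: cauchy_filter_metric_filtermap)
  then have "\<exists>x. filtermap ?f (finite_subsets_at_top E) \<le> nhds x"
    using complete_UNIV[where 'a='h]
    by (auto simp: complete_uniform filtermap_bot_iff finite_subsets_at_top_neq_bot)
  then show ?thesis
    by (simp add: summable_on_def has_sum_def filterlim_def)
qed

lemma bessel_summable: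
  assumes "orthonormal E"
  shows "(\<lambda>e. (norm (ip e x))\<^sup>2) summable_on E"
  using assms
  by (intro nonneg_bdd_above_summable_on bdd_aboveI[of _ "(norm x)\<^sup>2"])
    (auto intro!: bessel intro: orthonormal_subset)

lemma has_sum_in_closed_subspace:
  assumes W: "subspace W" "closed W" and f: "(f has_sum s) A" "\<And>x. x \<in> A \<Longrightarrow> f x \<in> W"
  shows "s \<in> W"
proof (rule Lim_in_closed_set[OF W(2)])
  show "(sum f \<longlongrightarrow> s) (finite_subsets_at_top A)"
    using f(1) by (simp add: has_sum_def)
  show "\<forall>\<^sub>F F in finite_subsets_at_top A. sum f F \<in> W"
    using f(2) W(1) by (intro eventually_finite_subsets_at_top_weakI subspace_sum) auto
qed simp

text \<open>The Fourier series of x converges to some y in K, and x - y is orthogonal to E, hence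
  0.\<close>

lemma orthonormal_orthogonal_eq_0_imp_dense:
  assumes K: "subspace K" "closed K" and E: "orthonormal E" "E \<subseteq> K"
    and max: "\<And>x. x \<in> K \<Longrightarrow> (\<And>e. e \<in> E \<Longrightarrow> ip e x = 0) \<Longrightarrow> x = 0"
  shows "closure (span E) = K"
proof
  show "closure (span E) \<subseteq> K"
    using K E by (intro closure_minimal span_minimal)
  show "K \<subseteq> closure (span E)"
  proof
    fix x assume x: "x \<in> K"
    let ?f = "\<lambda>e. scale (ip e x) e"
    obtain y where y: "(?f has_sum y) E"
      using summable_orthonormal[OF E(1) bessel_summable[OF E(1), of x]] summable_on_def by blast
    then have yK: "y \<in> K"
      using K E by (intro has_sum_in_closed_subspace[OF K y]) (auto intro: subspace_scale)
    have "ip e (x - y) = 0" if e: "e \<in> E" for e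
    proof -
      have "((\<lambda>f. ip e (?f f)) has_sum ip e y) E"
        by (rule has_sum_bounded_linear[OF ip.bounded_linear_right y])
      moreover have "((\<lambda>f. ip e (?f f)) has_sum ip e x) E"
        using e orthonormalD[OF E(1) e]
        by (intro has_sum_finite_neutralI[of "{e}"]) (auto simp: ip_scale_right)
      ultimately have "ip e y = ip e x"
        by (rule has_sum_unique)
      then show ?thesis by (simp add: ip.diff_right)
    qed
    then have "x - y = 0"
      using x yK K by (intro max subspace_diff)
    moreover have "y \<in> closure (span E)"
    proof (rule Lim_in_closed_set)
      show "(sum ?f \<longlongrightarrow> y) (finite_subsets_at_top E)"
        using y by (simp add: has_sum_def)
      have "sum ?f F \<in> span E" if "F \<subseteq> E" for F
        using that by (intro span_sum span_scale span_base) auto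
      then show "\<forall>\<^sub>F F in finite_subsets_at_top E. sum ?f F \<in> closure (span E)"
        using closure_subset by (intro eventually_finite_subsets_at_top_weakI) blast
    qed simp_all
    ultimately show "x \<in> closure (span E)" by simp
  qed
qed

end

section \<open>The spectral theorem for compact symmetric operators\<close>

lemma norm_diff_scaleR_squared:
  "(norm (x - c *\<^sub>R y))\<^sup>2 = (norm x)\<^sup>2 - 2 * c * (x \<bullet> y) + c\<^sup>2 * (norm y)\<^sup>2"
  for x y :: "'a::real_inner"
  unfolding power2_norm_eq_inner
  by (simp add: inner_diff_left inner_diff_right inner_commute power2_eq_square)

context hilbert_space
begin

lemma subspace_scaleR: "subspace W \<Longrightarrow> x \<in> W \<Longrightarrow> r *\<^sub>R x \<in> W"
  by (metis scale_of_real subspace_scale)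

text \<open>Only the values on W enter, so the same function can be restricted to invariant
  subspaces without changing it.\<close>

definition symmetric_on :: "'h set \<Rightarrow> ('h \<Rightarrow> 'h) \<Rightarrow> bool" where
  "symmetric_on W T \<longleftrightarrow>
     (\<forall>x\<in>W. T x \<in> W) \<and> (\<forall>x\<in>W. \<forall>y\<in>W. T (x + y) = T x + T y) \<and>
     (\<forall>a. \<forall>x\<in>W. T (scale a x) = scale a (T x)) \<and> (\<forall>x\<in>W. \<forall>y\<in>W. ip x (T y) = ip (T x) y)"

definition compact_on :: "'h set \<Rightarrow> ('h \<Rightarrow> 'h) \<Rightarrow> bool" where
  "compact_on W T \<longleftrightarrow> (\<exists>Z. compact Z \<and> T ` (W \<inter> cball 0 1) \<subseteq> Z)"

lemma symmetric_onD:
  assumes "symmetric_on W T"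
  shows "x \<in> W \<Longrightarrow> T x \<in> W" "x \<in> W \<Longrightarrow> y \<in> W \<Longrightarrow> T (x + y) = T x + T y"
    "x \<in> W \<Longrightarrow> T (scale a x) = scale a (T x)"
    "x \<in> W \<Longrightarrow> y \<in> W \<Longrightarrow> ip x (T y) = ip (T x) y"
  using assms by (auto simp: symmetric_on_def)

lemma symmetric_on_scaleR:
  assumes "symmetric_on W T" "x \<in> W"
  shows "T (r *\<^sub>R x) = r *\<^sub>R T x"
  using symmetric_onD(3)[OF assms, of "of_real r"] by (simp add: scale_of_real)

lemma symmetric_on_diff:
  assumes "symmetric_on W T" "subspace W" "x \<in> W" "y \<in> W"
  shows "T (x - y) = T x - T y"
proof -
  have "T (x + (-1) *\<^sub>R y) = T x + (-1) *\<^sub>R T y"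
    using assms subspace_scaleR[of W y "-1"]
    by (simp only: symmetric_onD(2)[OF assms(1)] symmetric_on_scaleR[OF assms(1)])
  then show ?thesis by simp
qed

lemma symmetric_on_subset:
  assumes "symmetric_on W T" "V \<subseteq> W" "\<And>x. x \<in> V \<Longrightarrow> T x \<in> V"
  shows "symmetric_on V T"
  using assms unfolding symmetric_on_def subset_iff by blast

lemma compact_on_subset: "compact_on W T \<Longrightarrow> V \<subseteq> W \<Longrightarrow> compact_on V T"
  unfolding compact_on_def by blast

lemma unit_vector:
  assumes "subspace W" "x \<in> W" "x \<noteq> 0"
  shows "inverse (norm x) *\<^sub>R x \<in> W" "norm (inverse (norm x) *\<^sub>R x) = 1"
  using assms by (simp_all add: subspace_scaleR)

text \<open>
  A maximizing sequence for \<open>norm (T x)\<close> on the unit sphere clusters at an eigenvector of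
  \<open>T\<^sup>2\<close> for the eigenvalue \<open>M\<^sup>2\<close>, with \<open>M\<close> the norm of \<open>T\<close>; the factorization
  \<open>T\<^sup>2 - M\<^sup>2 = (T + M) (T - M)\<close> then yields an eigenvector of \<open>T\<close>.
\<close>

lemma compact_symmetric_eigenvector:
  assumes W: "subspace W" "closed W" and T: "symmetric_on W T" "compact_on W T"
    and nontriv: "w \<in> W" "w \<noteq> 0"
  obtains e r where "e \<in> W" "norm e = 1" "T e = r *\<^sub>R e"
proof -
  note TW = symmetric_onD(1)[OF T(1)] and TR = symmetric_on_scaleR[OF T(1)]
    and Tdiff = symmetric_on_diff[OF T(1) W(1)]
  obtain Z where Z: "compact Z" "T ` (W \<inter> cball 0 1) \<subseteq> Z"
    using T(2) by (auto simp: compact_on_def)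
  define U where "U = {x \<in> W. norm x = 1}"
  define M where "M = (SUP x\<in>U. norm (T x))"
  have "U \<noteq> {}"
    using unit_vector[OF W(1) nontriv] by (auto simp: U_def)
  obtain B where "\<And>z. z \<in> Z \<Longrightarrow> norm z \<le> B"
    using compact_imp_bounded[OF Z(1)] by (auto simp: bounded_iff)
  then have "norm (T x) \<le> B" if "x \<in> U" for x
    using Z(2) that by (auto simp: U_def image_subset_iff)
  then have bdd: "bdd_above ((\<lambda>x. norm (T x)) ` U)"
    by (intro bdd_aboveI[of _ B]) auto
  have M_unit: "norm (T x) \<le> M" if "x \<in> U" for x
    unfolding M_def using bdd that by (intro cSUP_upper)
  have M_nonneg: "M \<ge> 0"
    using \<open>U \<noteq> {}\<close> order.trans[OF norm_ge_zero M_unit] by blast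
  have M: "norm (T x) \<le> M * norm x" if "x \<in> W" for x
  proof (cases "x = 0")
    case True
    then show ?thesis using TR[OF that, of 0] by simp
  next
    case False
    then have "norm (T (inverse (norm x) *\<^sub>R x)) \<le> M"
      using unit_vector[OF W(1) that] by (intro M_unit) (auto simp: U_def)
    then show ?thesis
      using False by (simp add: TR[OF that] field_simps)
  qed
  show ?thesis
  proof (cases "M = 0")
    case True
    obtain e where e: "e \<in> W" "norm e = 1"
      using \<open>U \<noteq> {}\<close> by (auto simp: U_def)
    then show ?thesis
      using M[OF e(1)] True by (intro that[of e 0]) auto
  next
    case False
    then have "M > 0" using M_nonneg by simp
    have "\<exists>x\<in>U. M - 1 / real (Suc n) < norm (T x)" for n
      using less_cSUP_iff[OF \<open>U \<noteq> {}\<close> bdd, of "M - 1 / real (Suc n)"] by (simp add: M_def)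
    then obtain u where u: "\<And>n. u n \<in> U" "\<And>n. M - 1 / real (Suc n) < norm (T (u n))"
      by metis
    then have uW: "u n \<in> W" and u1: "norm (u n) = 1" for n
      by (auto simp: U_def)
    have lim_M: "(\<lambda>n. norm (T (u n))) \<longlonglongrightarrow> M"
    proof (rule real_tendsto_sandwich)
      show "(\<lambda>n. M - 1 / real (Suc n)) \<longlonglongrightarrow> M"
        using tendsto_diff[OF tendsto_const LIMSEQ_Suc[OF lim_1_over_n], of M] by simp
      show "\<forall>\<^sub>F n in sequentially. M - 1 / real (Suc n) \<le> norm (T (u n))"
        using less_imp_le[OF u(2)] by (rule always_eventually[OF allI])
    qed (use M_unit u in auto)
    \<comment> \<open>In the expanded square the mixed term is - 2 M^2 (norm (T u))^2, by symmetry,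
      and (norm (T (T u)))^2 is at most M^2 (norm (T u))^2; the remainder tends to 0 along a
      maximizing sequence.\<close>
    have T2: "(norm (T (T (u n)) - M\<^sup>2 *\<^sub>R u n))\<^sup>2 \<le> M\<^sup>2 * (M\<^sup>2 - (norm (T (u n)))\<^sup>2)" for n
    proof -
      have "T (T (u n)) \<bullet> u n = re (ip (T (u n)) (T (u n)))"
        using symmetric_onD(4)[OF T(1) TW[OF uW] uW] by (simp flip: re_ip)
      also have "\<dots> = (norm (T (u n)))\<^sup>2"
        by (simp only: ip_self re_of_real)
      finally have "(norm (T (T (u n)) - M\<^sup>2 *\<^sub>R u n))\<^sup>2
          = (norm (T (T (u n))))\<^sup>2 - 2 * M\<^sup>2 * (norm (T (u n)))\<^sup>2 + M\<^sup>2 * M\<^sup>2"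
        by (simp only: norm_diff_scaleR_squared u1) (simp add: power2_eq_square)
      also have "(norm (T (T (u n))))\<^sup>2 \<le> (M * norm (T (u n)))\<^sup>2"
        by (intro power_mono M TW uW norm_ge_zero)
      finally show ?thesis
        by (simp add: power_mult_distrib algebra_simps)
    qed
    have "(\<lambda>n. M\<^sup>2 * (M\<^sup>2 - (norm (T (u n)))\<^sup>2)) \<longlonglongrightarrow> M\<^sup>2 * (M\<^sup>2 - M\<^sup>2)"
      by (intro tendsto_intros lim_M)
    then have "(\<lambda>n. M\<^sup>2 * (M\<^sup>2 - (norm (T (u n)))\<^sup>2)) \<longlonglongrightarrow> 0"
      by (simp only: diff_self mult_zero_right)
    then have "(\<lambda>n. (norm (T (T (u n)) - M\<^sup>2 *\<^sub>R u n))\<^sup>2) \<longlonglongrightarrow> 0"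
      by (rule tendsto_sandwich[OF always_eventually always_eventually tendsto_const, rotated 2])
        (intro allI zero_le_power2 T2)+
    then have "(\<lambda>n. sqrt ((norm (T (T (u n)) - M\<^sup>2 *\<^sub>R u n))\<^sup>2)) \<longlonglongrightarrow> sqrt 0"
      by (rule tendsto_real_sqrt)
    then have null: "(\<lambda>n. T (T (u n)) - M\<^sup>2 *\<^sub>R u n) \<longlonglongrightarrow> 0"
      by (simp add: tendsto_norm_zero_iff)
    have "T (u n) \<in> Z" for n
      using Z(2) uW u1 by auto
    then obtain y \<sigma> where \<sigma>: "strict_mono \<sigma>" "((\<lambda>n. T (u n)) \<circ> \<sigma>) \<longlonglongrightarrow> y"
      using Z(1) unfolding compact_def by metis
    then have lim_y: "(\<lambda>n. T (u (\<sigma> n))) \<longlonglongrightarrow> y"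
      by (simp add: o_def)
    have yW: "y \<in> W"
      using closed_sequentially[OF W(2) _ lim_y] TW uW by auto
    have T_lim: "(\<lambda>n. T (v n)) \<longlonglongrightarrow> T z"
      if "\<And>n. v n \<in> W" "z \<in> W" "v \<longlonglongrightarrow> z" for v z
    proof -
      have "(\<lambda>n. M * norm (v n - z)) \<longlonglongrightarrow> M * 0"
        using that(3) by (intro tendsto_mult_left tendsto_norm_zero) (simp add: LIM_zero)
      then have "(\<lambda>n. M * norm (v n - z)) \<longlonglongrightarrow> 0"
        by simp
      moreover have "norm (T (v n) - T z) \<le> M * norm (v n - z)" for n
        unfolding Tdiff[OF that(1,2), symmetric] by (intro M subspace_diff W that)
      ultimately have "(\<lambda>n. T (v n) - T z) \<longlonglongrightarrow> 0"
        by (rule Lim_null_comparison[OF always_eventually[OF allI], rotated])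
      then show ?thesis by (rule LIM_zero_cancel)
    qed
    \<comment> \<open>T (T u) tends to T y along the subsequence and T (T u) - M^2 u tends to 0, so
      u itself must converge to this x.\<close>
    define x where "x = inverse (M\<^sup>2) *\<^sub>R T y"
    have "(\<lambda>n. inverse (M\<^sup>2) *\<^sub>R
        (T (T (u (\<sigma> n))) - (T (T (u (\<sigma> n))) - M\<^sup>2 *\<^sub>R u (\<sigma> n)))) \<longlonglongrightarrow> inverse (M\<^sup>2) *\<^sub>R (T y - 0)"
      using LIMSEQ_subseq_LIMSEQ[OF null \<sigma>(1)] T_lim[OF TW[OF uW] yW lim_y]
      by (intro tendsto_intros) (auto simp: o_def)
    then have lim_x: "(\<lambda>n. u (\<sigma> n)) \<longlonglongrightarrow> x"
      using \<open>M > 0\<close> by (simp add: x_def)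
    have xW: "x \<in> W"
      using closed_sequentially[OF W(2) _ lim_x] uW by auto
    have "(\<lambda>n. norm (u (\<sigma> n))) \<longlonglongrightarrow> norm x"
      by (intro tendsto_norm lim_x)
    then have x1: "norm x = 1"
      using LIMSEQ_unique[OF _ tendsto_const] by (simp add: u1)
    have "y = T x"
      using LIMSEQ_unique[OF lim_y T_lim[OF uW xW lim_x]] .
    then have TTx: "T (T x) = M\<^sup>2 *\<^sub>R x"
      using \<open>M > 0\<close> by (simp add: x_def)
    \<comment> \<open>(T + M) v = 0. Either v = 0 and x is an eigenvector for M, or v, normalized,
      is one for - M.\<close>
    define v where "v = T x - M *\<^sub>R x"
    have vW: "v \<in> W"
      unfolding v_def using W xW TW by (intro subspace_diff subspace_scaleR)
    have Tv: "T v = (- M) *\<^sub>R v"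
      unfolding v_def using xW W TW
      by (simp add: Tdiff subspace_scaleR TR TTx scaleR_diff_right power2_eq_square)
    show ?thesis
    proof (cases "v = 0")
      case True
      then show ?thesis using that[OF xW x1, of M] by (simp add: v_def)
    next
      case False
      show ?thesis
      proof (rule that)
        show "T (inverse (norm v) *\<^sub>R v) = (- M) *\<^sub>R inverse (norm v) *\<^sub>R v"
          by (simp add: TR[OF vW] Tv)
      qed (fact unit_vector[OF W(1) vW False])+
    qed
  qed
qed

lemma orthonormal_basis_iff:
  "orthonormal_basis K E \<longleftrightarrow> E \<subseteq> K \<and> orthonormal E \<and> closure (span E) = K"
  by (simp add: orthonormal_basis_def orthonormal_def)

text \<open>The orthogonal complement of a maximal orthonormal set of eigenvectors is closed and
  invariant by symmetry. If it were nonzero, it would contain a further unit eigenvector, against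
  maximality.\<close>

theorem compact_symmetric_eigenbasis:
  assumes K: "subspace K" "closed K" and T: "symmetric_on K T" "compact_on K T"
  obtains E l where "orthonormal_basis K E" "\<And>e. e \<in> E \<Longrightarrow> T e = l e *\<^sub>R e"
proof -
  define A where "A = {E. E \<subseteq> K \<and> orthonormal E \<and> (\<forall>e\<in>E. \<exists>r. T e = r *\<^sub>R e)}"
  have "\<exists>E\<in>A. \<forall>F\<in>A. E \<subseteq> F \<longrightarrow> F = E"
  proof (rule subset_Zorn')
    fix C assume C: "subset.chain A C"
    then have CA: "C \<subseteq> A" by (simp add: subset.chain_def)
    have "orthonormal (\<Union>C)"
      unfolding orthonormal_def
    proof (intro ballI)
      fix e f assume "e \<in> \<Union>C" "f \<in> \<Union>C"
      then obtain E F where EF: "e \<in> E" "f \<in> F" "E \<in> C" "F \<in> C" by blast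
      then have "E \<subseteq> F \<or> F \<subseteq> E"
        using C by (auto simp: subset_chain_def)
      then obtain G where "e \<in> G" "f \<in> G" "G \<in> C" using EF by blast
      then show "ip e f = (if e = f then 1 else 0)"
        using CA by (intro orthonormalD[of G]) (auto simp: A_def)
    qed
    then show "\<Union>C \<in> A"
      using CA by (auto simp: A_def)
  qed
  then obtain E where E: "E \<in> A" "\<And>F. F \<in> A \<Longrightarrow> E \<subseteq> F \<Longrightarrow> F = E" by blast
  then have EK: "E \<subseteq> K" and on: "orthonormal E" and eig: "\<And>e. e \<in> E \<Longrightarrow> \<exists>r. T e = r *\<^sub>R e"
    by (auto simp: A_def)
  have "closure (span E) = K"
  proof (rule orthonormal_orthogonal_eq_0_imp_dense[OF K on EK], rule ccontr)
    fix w assume w: "w \<in> K" "\<And>e. e \<in> E \<Longrightarrow> ip e w = 0" "w \<noteq> 0"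
    define W where "W = {x \<in> K. \<forall>e\<in>E. ip e x = 0}"
    have WK: "W \<subseteq> K" by (auto simp: W_def)
    have "W = K \<inter> (\<Inter>e\<in>E. {x. ip e x = 0})" by (auto simp: W_def)
    moreover have "closed {x. ip e x = 0}" for e
      by (intro closed_Collect_eq continuous_intros ip.continuous_on)
    ultimately have "closed W" using K by auto
    moreover have "subspace W"
      using K by (auto simp: W_def subspace_def ip_add_right ip_scale_right)
    moreover have "symmetric_on W T"
    proof (rule symmetric_on_subset[OF T(1) WK])
      fix x assume x: "x \<in> W"
      have "ip e (T x) = 0" if e: "e \<in> E" for e
      proof -
        obtain r where "T e = r *\<^sub>R e" using eig[OF e] by blast
        then have "ip e (T x) = r *\<^sub>R ip e x"
          using symmetric_onD(4)[OF T(1), of e x] e EK x WK by (auto simp: ip_scaleR_left)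
        then show ?thesis using x e by (simp add: W_def)
      qed
      then show "T x \<in> W"
        using symmetric_onD(1)[OF T(1)] x by (auto simp: W_def)
    qed
    moreover have "compact_on W T"
      using compact_on_subset[OF T(2) WK] .
    moreover have "w \<in> W" using w by (simp add: W_def)
    ultimately obtain e r where e: "e \<in> W" "norm e = 1" "T e = r *\<^sub>R e"
      using compact_symmetric_eigenvector w(3) by metis
    then have "ip e e = 1" by (simp add: ip_self)
    then have "orthonormal (insert e E)"
      using on e(1) unfolding orthonormal_def W_def by (auto simp: ip_eq_0_commute)
    then have "insert e E = E"
      using E(1) e WK by (intro E(2)) (auto simp: A_def)
    then have "e \<in> E" by blast
    then have "ip e e = 0" using e(1) by (simp add: W_def del: ip_self_eq_0)
    then show False using \<open>ip e e = 1\<close> by simp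
  qed
  moreover obtain l where "\<And>e. e \<in> E \<Longrightarrow> T e = l e *\<^sub>R e"
    using eig by metis
  ultimately show ?thesis
    using that EK on by (auto simp: orthonormal_basis_iff)
qed

text \<open>A special case of the spectral theorem: an eigenbasis of the zero operator.\<close>

lemma orthonormal_basis_exists:
  assumes "subspace K" "closed K"
  obtains E where "orthonormal_basis K E"
proof -
  have "symmetric_on K (\<lambda>_. 0)" "compact_on K (\<lambda>_. 0)"
    using assms(1) by (auto simp: symmetric_on_def compact_on_def subspace_0 intro!: exI[of _ "{0}"])
  then show ?thesis
    using compact_symmetric_eigenbasis[OF assms] that by metis
qed

end

section \<open>Absolute values and the trace norm\<close>

lemma has_sum_finite_sum:
  fixes f :: "'i \<Rightarrow> 'a \<Rightarrow> real"
  assumes "\<And>i. i \<in> I \<Longrightarrow> (f i has_sum s i) A"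
  shows "((\<lambda>x. \<Sum>i\<in>I. f i x) has_sum (\<Sum>i\<in>I. s i)) A"
  using assms by (induction I rule: infinite_finite_induct) (auto intro: has_sum_add)

text \<open>Total boundedness passes from the approximating compact sets to S. Passing from the
  closure to S, from S to Z and from Z to a finite net costs three errors below a quarter of the
  tolerance.\<close>

lemma compact_closure_if_near_compact:
  fixes S :: "'a::complete_space set"
  assumes near: "\<And>\<epsilon>. \<epsilon> > 0 \<Longrightarrow> \<exists>Z. compact Z \<and> (\<forall>x\<in>S. \<exists>z\<in>Z. dist x z < \<epsilon>)"
  shows "compact (closure S)"
  unfolding compact_eq_totally_bounded
proof (intro conjI allI impI)
  show "complete (closure S)"
    by (simp add: complete_eq_closed)
  fix \<epsilon> :: real assume "\<epsilon> > 0"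
  then have pos: "\<epsilon> / 4 > 0" by simp
  obtain Z where Z: "compact Z" "\<And>x. x \<in> S \<Longrightarrow> \<exists>z\<in>Z. dist x z < \<epsilon> / 4"
    using near[OF pos] by blast
  obtain k where k: "finite k" "Z \<subseteq> (\<Union>x\<in>k. ball x (\<epsilon> / 4))"
    using Z(1) pos unfolding compact_eq_totally_bounded by blast
  have "closure S \<subseteq> (\<Union>x\<in>k. ball x \<epsilon>)"
  proof
    fix y assume "y \<in> closure S"
    then obtain x where x: "x \<in> S" "dist x y < \<epsilon> / 4"
      using pos unfolding closure_approachable by blast
    obtain z where z: "z \<in> Z" "dist x z < \<epsilon> / 4"
      using Z(2)[OF x(1)] by blast
    obtain w where w: "w \<in> k" "dist w z < \<epsilon> / 4"
      using k(2) z(1) by auto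
    have "dist w y \<le> dist w z + dist x z + dist x y"
      by (metis add.commute add_mono_thms_linordered_semiring(3) dist_commute dist_triangle dist_triangle_le)
    then have "dist w y < \<epsilon>"
      using w z x \<open>\<epsilon> > 0\<close> by linarith
    then show "y \<in> (\<Union>x\<in>k. ball x \<epsilon>)" using w(1) by auto
  qed
  then show "\<exists>k. finite k \<and> closure S \<subseteq> (\<Union>x\<in>k. ball x \<epsilon>)"
    using k(1) by blast
qed

locale closed_subspace = hilbert_space scale ip
  for scale :: "'f::real_or_complex \<Rightarrow> 'h::{real_inner,complete_space} \<Rightarrow> 'h"
    and ip :: "'h \<Rightarrow> 'h \<Rightarrow> 'f" +
  fixes K :: "'h set"
  assumes subspace_K: "subspace K" and closed_K: "closed K"
begin

lemma selfadjoint_imp_symmetric: "selfadjoint_op K T \<Longrightarrow> symmetric_on K T"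
  by (auto simp: selfadjoint_op_def bounded_op_def symmetric_on_def)

lemma selfadjoint_outside: "selfadjoint_op K T \<Longrightarrow> x \<notin> K \<Longrightarrow> T x = 0"
  by (simp add: selfadjoint_op_def bounded_op_def)

lemma selfadjoint_bound:
  assumes "selfadjoint_op K T"
  shows "\<exists>B>0. \<forall>x\<in>K. norm (T x) \<le> B * norm x"
proof -
  obtain B where B: "\<forall>x\<in>K. norm (T x) \<le> B * norm x"
    using assms unfolding selfadjoint_op_def bounded_op_def by blast
  have "norm (T x) \<le> max 1 B * norm x" if "x \<in> K" for x
    using bspec[OF B that] mult_right_mono[of B "max 1 B" "norm x"] by simp
  then show ?thesis by (intro exI[of _ "max 1 B"]) auto
qed

lemma selfadjointI:
  assumes "symmetric_on K T" "\<And>x. x \<notin> K \<Longrightarrow> T x = 0" "\<And>x. x \<in> K \<Longrightarrow> norm (T x) \<le> B * norm x"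
  shows "selfadjoint_op K T"
  using assms unfolding selfadjoint_op_def bounded_op_def symmetric_on_def by auto

lemma basis_closure:
  assumes "orthonormal_basis K E" "x \<in> K"
  shows "x \<in> closure (span E)"
  using assms by (simp add: orthonormal_basis_iff)

lemma basis_orthonormal: "orthonormal_basis K E \<Longrightarrow> orthonormal E"
  and basis_subset: "orthonormal_basis K E \<Longrightarrow> E \<subseteq> K"
  by (simp_all add: orthonormal_basis_iff)

lemma basis_expansion:
  assumes "orthonormal_basis K E" "x \<in> K"
  shows "((\<lambda>e. scale (ip e x) e) has_sum x) E"
    and "((\<lambda>e. ip y e * ip e x) has_sum ip y x) E"
    and "((\<lambda>e. (norm (ip e x))\<^sup>2) has_sum (norm x)\<^sup>2) E"
  using basis_closure[OF assms] basis_orthonormal[OF assms(1)]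
  by (auto intro: has_sum_orthonormal_expansion has_sum_parseval has_sum_parseval_norm)

lemma eq_by_coefficients:
  assumes "orthonormal_basis K E" "x \<in> K" "y \<in> K" "\<And>e. e \<in> E \<Longrightarrow> ip e x = ip e y"
  shows "x = y"
proof (rule has_sum_unique[OF basis_expansion(1)[OF assms(1,2)]])
  show "((\<lambda>e. scale (ip e x) e) has_sum y) E"
    using basis_expansion(1)[OF assms(1,3)] assms(4) by (subst has_sum_cong) auto
qed

lemma ip_has_sum_orthonormal:
  assumes "orthonormal E" "((\<lambda>e. scale (a e) e) has_sum y) E" "f \<in> E"
  shows "ip f y = a f"
proof (rule has_sum_unique)
  show "((\<lambda>e. ip f (scale (a e) e)) has_sum ip f y) E"
    by (rule has_sum_bounded_linear[OF ip.bounded_linear_right assms(2)])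
  show "((\<lambda>e. ip f (scale (a e) e)) has_sum a f) E"
    using assms(3) orthonormalD[OF assms(1,3)]
    by (intro has_sum_finite_neutralI[of "{f}"]) (auto simp: ip_scale_right)
qed

section \<open>Absolute values of operators with an eigenbasis\<close>

definition eigenbasis :: "('h \<Rightarrow> 'h) \<Rightarrow> 'h set \<Rightarrow> ('h \<Rightarrow> real) \<Rightarrow> bool" where
  "eigenbasis T E l \<longleftrightarrow> orthonormal_basis K E \<and> (\<forall>e\<in>E. T e = l e *\<^sub>R e)"

lemma eigenbasis_exists:
  assumes "selfadjoint_op K T" "compact_on K T"
  obtains E l where "eigenbasis T E l"
  using compact_symmetric_eigenbasis[OF subspace_K closed_K selfadjoint_imp_symmetric[OF assms(1)]
      assms(2)] that unfolding eigenbasis_def by metis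

lemma eigenbasis_ip:
  assumes T: "selfadjoint_op K T" "eigenbasis T E l" and "e \<in> E" "x \<in> K"
  shows "ip e (T x) = l e *\<^sub>R ip e x"
  using symmetric_onD(4)[OF selfadjoint_imp_symmetric[OF T(1)], of e x] assms
  by (auto simp: eigenbasis_def orthonormal_basis_iff ip_scaleR_left)

lemma eigenbasis_quadratic:
  assumes T: "selfadjoint_op K T" "eigenbasis T E l" and "x \<in> K"
  shows "((\<lambda>e. l e * (norm (ip e x))\<^sup>2) has_sum re (ip x (T x))) E"
proof -
  have "((\<lambda>e. ip x e * ip e (T x)) has_sum ip x (T x)) E"
    using assms by (intro basis_expansion)
      (auto simp: eigenbasis_def intro: symmetric_onD selfadjoint_imp_symmetric)
  then have "((\<lambda>e. re (ip x e * ip e (T x))) has_sum re (ip x (T x))) E"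
    by (rule has_sum_bounded_linear[OF bounded_linear_re])
  moreover have "re (ip x e * ip e (T x)) = l e * (norm (ip e x))\<^sup>2" if "e \<in> E" for e
    by (simp only: eigenbasis_ip[OF T that assms(3)] mult_scaleR_right ip_mult_ip re_scaleR re_of_real)
  ultimately show ?thesis
    by (subst has_sum_cong) auto
qed

text \<open>From P (P e) = r^2 e, the vector v = P e - |r| e satisfies P v = - |r| v. For r nonzero,
  positivity of P forces v = 0; for r = 0, the norm of P e is 0 by symmetry.\<close>

lemma abs_op_on_eigenvector:
  assumes T: "selfadjoint_op K T" and P: "is_abs_op K T P" and e: "e \<in> K" "T e = r *\<^sub>R e"
  shows "P e = \<bar>r\<bar> *\<^sub>R e"
proof -
  have Psa: "selfadjoint_op K P" and PP: "\<And>x y. x \<in> K \<Longrightarrow> y \<in> K \<Longrightarrow> ip x (P (P y)) = ip (T x) (T y)"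
    and Ppos: "\<And>x. x \<in> K \<Longrightarrow> re (ip x (P x)) \<ge> 0"
    using P by (auto simp: is_abs_op_def positive_op_def nonneg_Reals_iff_re)
  note symT = selfadjoint_imp_symmetric[OF T] and symP = selfadjoint_imp_symmetric[OF Psa]
  have PK: "P x \<in> K" if "x \<in> K" for x using symmetric_onD(1)[OF symP that] .
  have PPe: "P (P e) = (r * r) *\<^sub>R e"
  proof -
    let ?d = "P (P e) - (r * r) *\<^sub>R e"
    have d: "?d \<in> K"
      by (intro subspace_diff subspace_scaleR PK e subspace_K)
    have "ip ?d (P (P e)) = ip ?d (T (T e))"
      using PP[OF d e(1)] symmetric_onD(4)[OF symT d symmetric_onD(1)[OF symT e(1)]] by simp
    also have "T (T e) = (r * r) *\<^sub>R e"
      using symmetric_on_scaleR[OF symT e(1)] e(2) by simp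
    finally have "ip ?d ?d = 0"
      by (simp add: ip.diff_right)
    then show ?thesis by simp
  qed
  define v where "v = P e - \<bar>r\<bar> *\<^sub>R e"
  have v: "v \<in> K"
    unfolding v_def by (intro subspace_diff subspace_scaleR PK e subspace_K)
  have "P v = P (P e) - \<bar>r\<bar> *\<^sub>R P e"
    unfolding v_def using PK e subspace_K
    by (simp add: symmetric_on_diff[OF symP] symmetric_on_scaleR[OF symP] subspace_scaleR)
  also have "\<dots> = (- \<bar>r\<bar>) *\<^sub>R v"
    by (simp add: PPe v_def scaleR_diff_right flip: abs_mult)
  finally have Pv: "P v = (- \<bar>r\<bar>) *\<^sub>R v" .
  have "v = 0"
  proof (cases "r = 0")
    case True
    have "ip (P e) (P e) = ip e (P (P e))"
      using symmetric_onD(4)[OF symP e(1) PK[OF e(1)]] by simp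
    then show ?thesis using PPe True by (simp add: v_def)
  next
    case False
    have "re (ip v (P v)) = - \<bar>r\<bar> * (norm v)\<^sup>2"
      by (simp only: Pv ip_scaleR_right re_scaleR ip_self re_of_real)
    then have "\<bar>r\<bar> * (norm v)\<^sup>2 \<le> 0"
      using Ppos[OF v] by simp
    then show ?thesis
      using False by (simp add: mult_le_0_iff)
  qed
  then show ?thesis by (simp add: v_def)
qed

text \<open>Justifies the definite description in \<open>trace_norm\<close>: the values on an
  eigenbasis of T are forced, and they determine the operator.\<close>

lemma abs_op_unique:
  assumes T: "selfadjoint_op K T" "eigenbasis T E l" and P: "is_abs_op K T P" "is_abs_op K T Q"
  shows "P = Q"
proof
  fix x
  have sa: "selfadjoint_op K P" "selfadjoint_op K Q"
    using P by (auto simp: is_abs_op_def positive_op_def)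
  have E: "orthonormal_basis K E" and "E \<subseteq> K" and eig: "\<And>e. e \<in> E \<Longrightarrow> T e = l e *\<^sub>R e"
    using T(2) by (auto simp: eigenbasis_def orthonormal_basis_iff)
  then have "eigenbasis P E (\<lambda>e. \<bar>l e\<bar>)" "eigenbasis Q E (\<lambda>e. \<bar>l e\<bar>)"
    using abs_op_on_eigenvector[OF T(1)] P unfolding eigenbasis_def by (meson subsetD)+
  then have "ip e (P x) = ip e (Q x)" if "x \<in> K" "e \<in> E" for e
    using eigenbasis_ip sa that by metis
  then have coeff: "ip e (P x) = ip e (Q x)" if "x \<in> K" "e \<in> E" for e
    using that by blast
  show "P x = Q x"
  proof (cases "x \<in> K")
    case True
    then show ?thesis
      using sa[THEN selfadjoint_imp_symmetric, THEN symmetric_onD(1)] coeff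
      by (intro eq_by_coefficients[OF E])
  qed (use sa[THEN selfadjoint_outside] in simp)
qed

lemma abs_op_exists:
  assumes T: "selfadjoint_op K T" "eigenbasis T E l"
  obtains P where "is_abs_op K T P"
proof -
  note symT = selfadjoint_imp_symmetric[OF T(1)]
  have E: "orthonormal_basis K E" and on: "orthonormal E" and EK: "E \<subseteq> K"
    using T(2) by (auto simp: eigenbasis_def orthonormal_basis_iff)
  have TK: "T x \<in> K" if "x \<in> K" for x using symmetric_onD(1)[OF symT that] .
  define a where "a x e = \<bar>l e\<bar> *\<^sub>R ip e x" for x e
  define P where "P x = (if x \<in> K then \<Sum>\<^sub>\<infinity>e\<in>E. scale (a x e) e else 0)" for x
  \<comment> \<open>The coefficients have the moduli of those of T x, so Parseval for T x gives
    square summability, and later the bound of T carries over to P.\<close>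
  have norm_a: "norm (a x e) = norm (ip e (T x))" if "x \<in> K" "e \<in> E" for x e
    using eigenbasis_ip[OF T that(2,1)] by (simp add: a_def)
  have P_sum: "((\<lambda>e. scale (a x e) e) has_sum P x) E" if "x \<in> K" for x
  proof -
    have "(\<lambda>e. (norm (ip e (T x)))\<^sup>2) summable_on E"
      using basis_expansion(3)[OF E TK[OF that]] by (rule has_sum_imp_summable)
    then have "(\<lambda>e. (norm (a x e))\<^sup>2) summable_on E"
      using that by (subst summable_on_cong) (auto simp: norm_a)
    then show ?thesis
      using summable_orthonormal[OF on] that by (simp add: P_def)
  qed
  have PK: "P x \<in> K" if "x \<in> K" for x
    using has_sum_in_closed_subspace[OF subspace_K closed_K P_sum[OF that]] EK subspace_K
    by (auto intro: subspace_scale)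
  have ipP: "ip e (P x) = \<bar>l e\<bar> *\<^sub>R ip e x" if "x \<in> K" "e \<in> E" for x e
    using ip_has_sum_orthonormal[OF on P_sum[OF that(1)] that(2)] by (simp add: a_def)
  have ipP': "ip (P x) e = \<bar>l e\<bar> *\<^sub>R ip x e" if "x \<in> K" "e \<in> E" for x e
    using ipP[OF that] by (metis ip_conjg ip_scaleR_left ip_scaleR_right)
  have ipT': "ip (T x) e = l e *\<^sub>R ip x e" if "x \<in> K" "e \<in> E" for x e
    using eigenbasis_ip[OF T that(2,1)] by (metis ip_conjg ip_scaleR_left ip_scaleR_right)
  have sym: "ip x (P y) = ip (P x) y" if "x \<in> K" "y \<in> K" for x y
  proof (rule has_sum_unique)
    show "((\<lambda>e. ip x e * ip e (P y)) has_sum ip x (P y)) E"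
      using that PK by (intro basis_expansion[OF E])
    show "((\<lambda>e. ip x e * ip e (P y)) has_sum ip (P x) y) E"
      using basis_expansion(2)[OF E that(2), of "P x"] that
      by (subst has_sum_cong[where g="\<lambda>e. ip (P x) e * ip e y"]) (auto simp: ipP ipP')
  qed
  have PP: "ip (P x) (P y) = ip (T x) (T y)" if "x \<in> K" "y \<in> K" for x y
  proof (rule has_sum_unique)
    show "((\<lambda>e. ip (P x) e * ip e (P y)) has_sum ip (P x) (P y)) E"
      using that PK by (intro basis_expansion[OF E])
    show "((\<lambda>e. ip (P x) e * ip e (P y)) has_sum ip (T x) (T y)) E"
      using basis_expansion(2)[OF E TK[OF that(2)], of "T x"] that
      by (subst has_sum_cong[where g="\<lambda>e. ip (T x) e * ip e (T y)"])
        (auto simp: ipP ipP' ipT' eigenbasis_ip[OF T] simp flip: abs_mult)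
  qed
  have normP: "norm (P x) = norm (T x)" if "x \<in> K" for x
  proof -
    have "(of_real ((norm (P x))\<^sup>2) :: 'f) = of_real ((norm (T x))\<^sup>2)"
      using PP[OF that that] by (simp only: ip_self)
    then have "(norm (P x))\<^sup>2 = (norm (T x))\<^sup>2"
      by (simp only: of_real_eq_iff)
    then show ?thesis by (simp add: power2_eq_iff_nonneg)
  qed
  have "symmetric_on K P"
    unfolding symmetric_on_def
  proof (intro conjI ballI allI)
    fix x y assume xy: "x \<in> K" "y \<in> K"
    then show "P (x + y) = P x + P y"
      using subspace_K PK
      by (intro eq_by_coefficients[OF E]) (auto simp: subspace_add ipP ip_add_right scaleR_add_right)
  next
    fix c x assume "x \<in> K"
    then show "P (scale c x) = scale c (P x)"
      using subspace_K PK
      by (intro eq_by_coefficients[OF E]) (auto simp: subspace_scale ipP ip_scale_right)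
  qed (use sym PK in auto)
  moreover obtain B where "\<And>x. x \<in> K \<Longrightarrow> norm (T x) \<le> B * norm x"
    using selfadjoint_bound[OF T(1)] by blast
  ultimately have sa: "selfadjoint_op K P"
    by (intro selfadjointI[of P B]) (simp_all add: normP, simp add: P_def)
  have "ip x (P x) \<in> \<real>\<^sub>\<ge>\<^sub>0" if "x \<in> K" for x
  proof -
    have "conjg (ip x (P x)) = ip x (P x)"
      using sym[OF that that] by (metis ip_conjg)
    moreover have "((\<lambda>e. re (ip x e * ip e (P x))) has_sum re (ip x (P x))) E"
      using that PK by (intro has_sum_bounded_linear[OF bounded_linear_re] basis_expansion[OF E])
    then have "re (ip x (P x)) \<ge> 0"
    proof (rule has_sum_nonneg)
      fix e assume "e \<in> E"
      have "re (ip x e * ip e (P x)) = \<bar>l e\<bar> * (norm (ip e x))\<^sup>2"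
        by (simp only: ipP[OF that \<open>e \<in> E\<close>] mult_scaleR_right ip_mult_ip re_scaleR re_of_real)
      then show "re (ip x e * ip e (P x)) \<ge> 0" by simp
    qed
    ultimately show ?thesis by (simp add: nonneg_Reals_iff_re)
  qed
  then have "is_abs_op K T P"
    using sa PP PK sym by (simp add: is_abs_op_def positive_op_def)
  then show ?thesis by (rule that)
qed

text \<open>
  For selfadjoint trace class operators, the trace norm is the least such bound.
\<close>

definition diag_bound :: "('h \<Rightarrow> 'h) \<Rightarrow> real \<Rightarrow> bool" where
  "diag_bound T M \<longleftrightarrow>
     (\<forall>F. finite F \<longrightarrow> F \<subseteq> K \<longrightarrow> orthonormal F \<longrightarrow> (\<Sum>f\<in>F. \<bar>re (ip f (T f))\<bar>) \<le> M)"

lemma diag_boundD: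
  "diag_bound T M \<Longrightarrow> finite F \<Longrightarrow> F \<subseteq> K \<Longrightarrow> orthonormal F \<Longrightarrow> (\<Sum>f\<in>F. \<bar>re (ip f (T f))\<bar>) \<le> M"
  by (simp add: diag_bound_def)

lemma diag_bound_nonneg: "diag_bound T M \<Longrightarrow> M \<ge> 0"
  using diag_boundD[of T M "{}"] by (simp add: orthonormal_def)

section \<open>Diagonal bounds, eigenvalues and the trace norm\<close>

lemma diag_bound_eigenvalues:
  assumes T: "selfadjoint_op K T" "eigenbasis T E l" and "diag_bound T M"
    and G: "finite G" "G \<subseteq> E"
  shows "(\<Sum>e\<in>G. \<bar>l e\<bar>) \<le> M"
proof -
  have E: "orthonormal E" "E \<subseteq> K" "\<And>e. e \<in> E \<Longrightarrow> T e = l e *\<^sub>R e"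
    using T(2) by (auto simp: eigenbasis_def orthonormal_basis_iff)
  have "re (ip e (T e)) = l e" if "e \<in> E" for e
    using orthonormalD[OF E(1) that that] E(3)[OF that] by (simp add: ip_scaleR_right re_scaleR)
      (metis re_of_real of_real_1)
  then have "(\<Sum>e\<in>G. \<bar>l e\<bar>) = (\<Sum>e\<in>G. \<bar>re (ip e (T e))\<bar>)"
    using G by (intro sum.cong) auto
  also have "\<dots> \<le> M"
    using assms(3) G E by (intro diag_boundD) (auto intro: orthonormal_subset)
  finally show ?thesis .
qed

text \<open>Expanding each <f|T f> in the eigenbasis and exchanging the sums gives e the weight sum
  of |<f|e>|^2 over F, at most 1 by Bessel. The signs \<open>s f\<close> replace the absolute values
  by a linear combination, to which convergence of the expansions applies.\<close>

lemma diag_bound_if_eigenvalues: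
  assumes T: "selfadjoint_op K T" "eigenbasis T E l"
    and G: "\<And>G. finite G \<Longrightarrow> G \<subseteq> E \<Longrightarrow> (\<Sum>e\<in>G. \<bar>l e\<bar>) \<le> M"
  shows "diag_bound T M"
  unfolding diag_bound_def
proof (intro allI impI)
  fix F assume F: "finite F" "F \<subseteq> K" "orthonormal F"
  have E: "orthonormal E" "E \<subseteq> K"
    using T(2) by (auto simp: eigenbasis_def orthonormal_basis_iff)
  define s where "s f = sgn (re (ip f (T f)))" for f
  have "((\<lambda>e. \<Sum>f\<in>F. s f * (l e * (norm (ip e f))\<^sup>2)) has_sum (\<Sum>f\<in>F. s f * re (ip f (T f)))) E"
    using F(2) by (intro has_sum_finite_sum has_sum_cmult_right eigenbasis_quadratic[OF T]) auto
  then have "((\<lambda>e. \<Sum>f\<in>F. s f * (l e * (norm (ip e f))\<^sup>2)) has_sum (\<Sum>f\<in>F. \<bar>re (ip f (T f))\<bar>)) E"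
    by (simp add: s_def abs_sgn mult.commute)
  then show "(\<Sum>f\<in>F. \<bar>re (ip f (T f))\<bar>) \<le> M"
  proof (rule has_sum_le_finite_sums)
    fix H assume H: "finite H" "H \<subseteq> E"
    have "(\<Sum>f\<in>F. s f * (l e * (norm (ip e f))\<^sup>2)) \<le> \<bar>l e\<bar>" if "e \<in> H" for e
    proof -
      have "(\<Sum>f\<in>F. s f * (l e * (norm (ip e f))\<^sup>2)) \<le> (\<Sum>f\<in>F. \<bar>l e\<bar> * (norm (ip f e))\<^sup>2)"
      proof (rule sum_mono)
        fix f
        have "s f * l e \<le> \<bar>l e\<bar>"
          by (auto simp: s_def sgn_if)
        then have "s f * l e * (norm (ip e f))\<^sup>2 \<le> \<bar>l e\<bar> * (norm (ip e f))\<^sup>2"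
          by (rule mult_right_mono) simp
        then show "s f * (l e * (norm (ip e f))\<^sup>2) \<le> \<bar>l e\<bar> * (norm (ip f e))\<^sup>2"
          by (simp add: norm_ip_commute[of e f] mult.assoc)
      qed
      also have "\<dots> \<le> \<bar>l e\<bar> * (norm e)\<^sup>2"
        unfolding sum_distrib_left[symmetric] using bessel[OF F(3,1)] by (intro mult_left_mono) auto
      also have "norm e = 1"
        using orthonormal_norm[OF E(1)] that H by auto
      finally show ?thesis by simp
    qed
    then have "(\<Sum>e\<in>H. \<Sum>f\<in>F. s f * (l e * (norm (ip e f))\<^sup>2)) \<le> (\<Sum>e\<in>H. \<bar>l e\<bar>)"
      by (rule sum_mono)
    also have "\<dots> \<le> M" by (rule G[OF H])
    finally show "(\<Sum>e\<in>H. \<Sum>f\<in>F. s f * (l e * (norm (ip e f))\<^sup>2)) \<le> M" .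
  qed
qed

text \<open>The part of basis independence of the trace that is needed. Expand the norms of the
  eigenvectors in G by Parseval in E'; since P has nonnegative eigenvalues, cutting its quadratic
  form down to G only lowers it.\<close>

lemma eigenvalues_le_trace:
  assumes P: "selfadjoint_op K P" "eigenbasis P E l" "\<And>e. e \<in> E \<Longrightarrow> l e \<ge> 0"
    and E': "orthonormal_basis K E'" "((\<lambda>e. re (ip e (P e))) has_sum s) E'"
    and G: "finite G" "G \<subseteq> E"
  shows "(\<Sum>e\<in>G. l e) \<le> s"
proof (rule has_sum_mono)
  have E: "orthonormal E" "E \<subseteq> K"
    using P(2) by (auto simp: eigenbasis_def orthonormal_basis_iff)
  have "((\<lambda>e'. \<Sum>e\<in>G. l e * (norm (ip e' e))\<^sup>2) has_sum (\<Sum>e\<in>G. l e * (norm e)\<^sup>2)) E'"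
    using G E by (intro has_sum_finite_sum has_sum_cmult_right basis_expansion[OF E'(1)]) auto
  also have "(\<Sum>e\<in>G. l e * (norm e)\<^sup>2) = (\<Sum>e\<in>G. l e)"
    using G orthonormal_norm[OF E(1)] by (intro sum.cong) auto
  finally show "((\<lambda>e'. \<Sum>e\<in>G. l e * (norm (ip e' e))\<^sup>2) has_sum (\<Sum>e\<in>G. l e)) E'" .
  show "((\<lambda>e. re (ip e (P e))) has_sum s) E'" by fact
  fix e' assume "e' \<in> E'"
  then have "e' \<in> K" using basis_subset[OF E'(1)] by auto
  then have "(\<Sum>e\<in>G. l e * (norm (ip e e'))\<^sup>2) \<le> re (ip e' (P e'))"
    using P(3) G by (intro finite_sum_le_has_sum[OF eigenbasis_quadratic[OF P(1,2)]]) auto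
  then show "(\<Sum>e\<in>G. l e * (norm (ip e' e))\<^sup>2) \<le> re (ip e' (P e'))"
    by (simp add: norm_ip_commute[of e'])
qed

lemma abs_op_eigenbasis:
  assumes "selfadjoint_op K T" "eigenbasis T E l" "is_abs_op K T P"
  shows "eigenbasis P E (\<lambda>e. \<bar>l e\<bar>)"
  using assms abs_op_on_eigenvector[OF assms(1,3)]
  unfolding eigenbasis_def orthonormal_basis_iff by blast

lemma the_abs_op:
  assumes "selfadjoint_op K T" "eigenbasis T E l" "is_abs_op K T P"
  shows "(THE P. is_abs_op K T P) = P"
  using assms abs_op_unique[OF assms(1,2)] by (intro the_equality) auto

lemma some_basis: "orthonormal_basis K (SOME E. orthonormal_basis K E)"
  using orthonormal_basis_exists[OF subspace_K closed_K] by (metis someI)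

lemma diag_sum_nonneg:
  assumes "is_abs_op K T P" "e \<in> K"
  shows "re (ip e (P e)) \<ge> 0"
  using assms by (auto simp: is_abs_op_def positive_op_def nonneg_Reals_iff_re)

text \<open>T and its absolute value P share an eigenbasis and the moduli of their eigenvalues, so M
  bounds the diagonal sums of P too, in particular in the basis chosen by
  \<open>trace_norm\<close>.\<close>

lemma trace_class_if_diag_bound:
  assumes T: "selfadjoint_op K T" "compact_on K T" and M: "diag_bound T M"
  shows "T \<in> selfadjoint_trace_class K" "trace_norm K T \<le> M"
proof -
  obtain E l where E: "eigenbasis T E l"
    using eigenbasis_exists[OF T] .
  obtain P where P: "is_abs_op K T P"
    using abs_op_exists[OF T(1) E] .
  then have Psa: "selfadjoint_op K P" by (simp add: is_abs_op_def positive_op_def)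
  let ?E = "SOME E. orthonormal_basis K E"
  have E': "orthonormal ?E" "?E \<subseteq> K"
    using some_basis by (auto simp: orthonormal_basis_iff)
  have PM: "diag_bound P M"
    using diag_bound_eigenvalues[OF T(1) E M]
    by (intro diag_bound_if_eigenvalues[OF Psa abs_op_eigenbasis[OF T(1) E P]]) auto
  have le_M: "(\<Sum>e\<in>F. re (ip e (P e))) \<le> M" if "finite F" "F \<subseteq> ?E" for F
  proof -
    have "(\<Sum>e\<in>F. re (ip e (P e))) \<le> (\<Sum>e\<in>F. \<bar>re (ip e (P e))\<bar>)"
      by (intro sum_mono) simp
    also have "\<dots> \<le> M"
      using that E' by (intro diag_boundD[OF PM]) (auto intro: orthonormal_subset)
    finally show ?thesis .
  qed
  then have summ: "(\<lambda>e. re (ip e (P e))) summable_on ?E"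
    using diag_sum_nonneg[OF P] E'(2)
    by (intro nonneg_bdd_above_summable_on bdd_aboveI[of _ M]) auto
  then show "T \<in> selfadjoint_trace_class K"
    using T(1) P some_basis
    by (auto simp: selfadjoint_trace_class_def trace_class_def selfadjoint_op_def re_def)
  show "trace_norm K T \<le> M"
    unfolding trace_norm_def the_abs_op[OF T(1) E P] re_def[symmetric]
    using summ le_M by (rule infsum_le_finite_sums)
qed

section \<open>Compactness of Hilbert-Schmidt and of trace class operators\<close>

lemma compact_finite_combinations:
  assumes "finite F"
  shows "\<exists>Z. compact Z \<and> (\<forall>a. (\<forall>e\<in>F. norm (a e) \<le> B) \<longrightarrow> (\<Sum>e\<in>F. scale (a e) (v e)) \<in> Z)"
  using assms
proof (induction rule: finite_induct)
  case empty
  show ?case by (intro exI[of _ "{0}"]) simp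
next
  case (insert e F)
  then obtain Z where Z: "compact Z" "\<And>a. \<forall>e\<in>F. norm (a e) \<le> B \<Longrightarrow> (\<Sum>e\<in>F. scale (a e) (v e)) \<in> Z"
    by blast
  let ?L = "(\<lambda>c. scale c (v e)) ` cball 0 B"
  have "compact ?L"
    by (intro compact_continuous_image compact_scalar_cball linear_continuous_on
        scale.bounded_linear_left)
  then have "compact {x + y | x y. x \<in> ?L \<and> y \<in> Z}"
    using Z(1) by (rule compact_sums)
  moreover have "(\<Sum>e\<in>insert e F. scale (a e) (v e)) \<in> {x + y | x y. x \<in> ?L \<and> y \<in> Z}"
    if "\<forall>e\<in>insert e F. norm (a e) \<le> B" for a
    using that insert Z(2)[of a] by force
  ultimately show ?case by blast
qed

text \<open>On the unit ball |<e|T x>| = |<T e|x>| <= norm (T e), so projecting T x onto finitely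
  many basis vectors leaves an error bounded, uniformly in x, by a tail of the Hilbert-Schmidt
  sum.\<close>

lemma hilbert_schmidt_imp_compact:
  assumes T: "selfadjoint_op K T" and E: "orthonormal_basis K E"
    and hs: "(\<lambda>e. (norm (T e))\<^sup>2) summable_on E"
  shows "compact_on K T"
proof -
  note symT = selfadjoint_imp_symmetric[OF T]
  have on: "orthonormal E" and EK: "E \<subseteq> K" using E by (auto simp: orthonormal_basis_iff)
  let ?s = "\<Sum>\<^sub>\<infinity>e\<in>E. (norm (T e))\<^sup>2"
  obtain B where B: "B > 0" "\<And>x. x \<in> K \<Longrightarrow> norm (T x) \<le> B * norm x"
    using selfadjoint_bound[OF T] by blast
  have "compact (closure (T ` (K \<inter> cball 0 1)))"
  proof (rule compact_closure_if_near_compact)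
    fix \<epsilon> :: real assume "\<epsilon> > 0"
    define d where "d = \<epsilon>\<^sup>2"
    have "d > 0" using \<open>\<epsilon> > 0\<close> by (simp add: d_def)
    then obtain F where F: "finite F" "F \<subseteq> E" "dist (\<Sum>e\<in>F. (norm (T e))\<^sup>2) ?s \<le> d / 2"
      using has_sum_finite_approximation[OF has_sum_infsum[OF hs], of "d / 2"] by auto
    have "?s - (\<Sum>e\<in>F. (norm (T e))\<^sup>2) \<le> dist (\<Sum>e\<in>F. (norm (T e))\<^sup>2) ?s"
      by (simp add: dist_real_def)
    then have tail: "?s - (\<Sum>e\<in>F. (norm (T e))\<^sup>2) < d"
      using F(3) \<open>d > 0\<close> by simp
    have onF: "orthonormal F" using on F(2) by (rule orthonormal_subset)
    obtain Z where Z: "compact Z" "\<And>a. \<forall>e\<in>F. norm (a e) \<le> B \<Longrightarrow> (\<Sum>e\<in>F. scale (a e) e) \<in> Z"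
      using compact_finite_combinations[OF F(1), of B "\<lambda>e. e"] by blast
    have "\<exists>z\<in>Z. dist (T x) z < \<epsilon>" if x: "x \<in> K" "norm x \<le> 1" for x
    proof -
      let ?z = "\<Sum>e\<in>F. scale (ip e (T x)) e"
      have Tx: "T x \<in> K" using symmetric_onD(1)[OF symT x(1)] .
      have coeff: "norm (ip e (T x)) \<le> norm (T e)" if "e \<in> E" for e
      proof -
        have "norm (ip e (T x)) = norm (ip (T e) x)"
          using symmetric_onD(4)[OF symT _ x(1)] that EK by auto
        also have "\<dots> \<le> norm (T e) * norm x" by (rule norm_ip_le)
        also have "\<dots> \<le> norm (T e) * 1" using x(2) by (intro mult_left_mono) auto
        finally show ?thesis by simp
      qed
      have "norm (ip e (T x)) \<le> B" if "e \<in> F" for e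
        using coeff[of e] B(2)[of e] that F(2) EK orthonormal_norm[OF on, of e] by force
      then have "?z \<in> Z" using Z(2)[of "\<lambda>e. ip e (T x)"] by blast
      moreover have "(norm (T x - ?z))\<^sup>2 \<le> ?s - (\<Sum>e\<in>F. (norm (T e))\<^sup>2)"
      proof (rule has_sum_mono)
        have "((\<lambda>e. (norm (ip e (T x)))\<^sup>2) has_sum
            ((norm (T x))\<^sup>2 - (\<Sum>e\<in>F. (norm (ip e (T x)))\<^sup>2))) (E - F)"
          using F by (intro has_sum_Diff basis_expansion[OF E Tx] has_sum_finiteI) auto
        then show "((\<lambda>e. (norm (ip e (T x)))\<^sup>2) has_sum (norm (T x - ?z))\<^sup>2) (E - F)"
          using bessel_residual[OF onF F(1), of "T x"] by simp
        show "((\<lambda>e. (norm (T e))\<^sup>2) has_sum (?s - (\<Sum>e\<in>F. (norm (T e))\<^sup>2))) (E - F)"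
          using F by (intro has_sum_Diff has_sum_infsum[OF hs] has_sum_finiteI) auto
      qed (auto intro!: power_mono coeff)
      then have "(dist (T x) ?z)\<^sup>2 < \<epsilon>\<^sup>2"
        using tail by (simp add: d_def dist_norm)
      then have "dist (T x) ?z < \<epsilon>"
        by (rule power2_less_imp_less) (use \<open>\<epsilon> > 0\<close> in simp)
      ultimately show ?thesis by blast
    qed
    then show "\<exists>Z. compact Z \<and> (\<forall>y\<in>T ` (K \<inter> cball 0 1). \<exists>z\<in>Z. dist y z < \<epsilon>)"
      using Z(1) by auto
  qed
  then show ?thesis
    unfolding compact_on_def by (intro exI[of _ "closure (T ` (K \<inter> cball 0 1))"] conjI closure_subset)
qed

text \<open>This is the operator inequality P^2 <= B P, obtained by evaluating the form of P at x -
  t P x.\<close>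

lemma positive_op_norm_le:
  assumes P: "positive_op K P"
  obtains B where "\<And>x. x \<in> K \<Longrightarrow> (norm (P x))\<^sup>2 \<le> B * re (ip x (P x))"
proof -
  have Psa: "selfadjoint_op K P" and Ppos: "\<And>x. x \<in> K \<Longrightarrow> re (ip x (P x)) \<ge> 0"
    using P by (auto simp: positive_op_def nonneg_Reals_iff_re)
  note symP = selfadjoint_imp_symmetric[OF Psa]
  obtain B where B: "B > 0" "\<And>x. x \<in> K \<Longrightarrow> norm (P x) \<le> B * norm x"
    using selfadjoint_bound[OF Psa] by blast
  have "(norm (P x))\<^sup>2 \<le> B * re (ip x (P x))" if x: "x \<in> K" for x
  proof -
    \<comment> \<open>With t = 1 / B the quadratic term is at most t (norm (P x))^2 and cancels one
      of the two linear terms.\<close>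
    define t where "t = 1 / B"
    have Px: "P x \<in> K" using symmetric_onD(1)[OF symP x] .
    let ?y = "x - t *\<^sub>R P x"
    have "?y \<in> K" using x Px subspace_K by (intro subspace_diff subspace_scaleR)
    then have "0 \<le> re (ip ?y (P ?y))" by (rule Ppos)
    also have "P ?y = P x - t *\<^sub>R P (P x)"
      using x Px subspace_K
      by (simp add: symmetric_on_diff[OF symP] symmetric_on_scaleR[OF symP] subspace_scaleR)
    also have "re (ip ?y (P x - t *\<^sub>R P (P x)))
        = x \<bullet> P x - t * (x \<bullet> P (P x)) - t * (P x \<bullet> P x) + t * t * (P x \<bullet> P (P x))"
      by (simp only: re_ip) (simp add: inner_diff_left inner_diff_right algebra_simps)
    also have "x \<bullet> P (P x) = P x \<bullet> P x"
      using symmetric_onD(4)[OF symP x Px] by (simp flip: re_ip)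
    also have "P x \<bullet> P (P x) \<le> B * (P x \<bullet> P x)"
    proof -
      have "P x \<bullet> P (P x) \<le> norm (P x) * norm (P (P x))" by (rule norm_cauchy_schwarz)
      also have "\<dots> \<le> norm (P x) * (B * norm (P x))"
        using B(2)[OF Px] by (intro mult_left_mono) auto
      finally show "P x \<bullet> P (P x) \<le> B * (P x \<bullet> P x)"
        by (simp add: dot_square_norm power2_eq_square mult_ac)
    qed
    finally have "0 \<le> x \<bullet> P x - t * (P x \<bullet> P x) - t * (P x \<bullet> P x) + t * t * (B * (P x \<bullet> P x))"
      by (simp add: mult_left_mono)
    moreover have "t * t * (B * (P x \<bullet> P x)) = t * (P x \<bullet> P x)"
      using B(1) by (simp add: t_def)
    ultimately have "t * (P x \<bullet> P x) \<le> x \<bullet> P x"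
      by linarith
    then show ?thesis
      using B(1) by (simp add: t_def re_ip dot_square_norm field_simps)
  qed
  then show ?thesis by (rule that)
qed

text \<open>norm (T e) = norm (P e), and (norm (P e))^2 is at most B <e|P e>; thus the diagonal sum
  of P controls the Hilbert-Schmidt sum of T.\<close>

lemma trace_class_imp_compact:
  assumes "T \<in> selfadjoint_trace_class K"
  shows "selfadjoint_op K T" "compact_on K T"
proof -
  show T: "selfadjoint_op K T" using assms by (simp add: selfadjoint_trace_class_def)
  obtain P E where P: "is_abs_op K T P" and E: "orthonormal_basis K E"
    and summ: "(\<lambda>e. re (ip e (P e))) summable_on E"
    using assms by (auto simp: selfadjoint_trace_class_def trace_class_def re_def)
  have pos: "positive_op K P" using P by (simp add: is_abs_op_def)
  then obtain B where B: "\<And>x. x \<in> K \<Longrightarrow> (norm (P x))\<^sup>2 \<le> B * re (ip x (P x))"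
    using positive_op_norm_le by metis
  have "(norm (T x))\<^sup>2 \<le> B * re (ip x (P x))" if x: "x \<in> K" for x
  proof -
    have symP: "symmetric_on K P"
      using pos by (auto simp: positive_op_def intro: selfadjoint_imp_symmetric)
    have "ip (T x) (T x) = ip x (P (P x))"
      using P x by (simp add: is_abs_op_def)
    also have "\<dots> = ip (P x) (P x)"
      using symmetric_onD(4)[OF symP x symmetric_onD(1)[OF symP x]] .
    finally have "(norm (T x))\<^sup>2 = (norm (P x))\<^sup>2"
      by (simp only: ip_self of_real_eq_iff)
    then show ?thesis using B[OF x] by simp
  qed
  then have "(\<lambda>e. (norm (T e))\<^sup>2) summable_on E"
    using basis_subset[OF E]
    by (intro summable_on_comparison_test[OF summable_on_cmult_right[OF summ, of B]]) auto
  then show "compact_on K T"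
    by (rule hilbert_schmidt_imp_compact[OF T E])
qed

text \<open>The basis E1 that witnesses trace class need not be the one chosen by
  \<open>trace_norm\<close>. The eigenvalues mediate: the sum over E1 bounds them, which gives
  summability in the chosen basis, and the sum there bounds them again.\<close>

lemma diag_bound_trace_norm:
  assumes "T \<in> selfadjoint_trace_class K"
  shows "diag_bound T (trace_norm K T)"
proof -
  note T = trace_class_imp_compact[OF assms]
  obtain E l where E: "eigenbasis T E l"
    using eigenbasis_exists[OF T] .
  obtain P E1 where P: "is_abs_op K T P" and E1: "orthonormal_basis K E1"
    and summ: "(\<lambda>e. re (ip e (P e))) summable_on E1"
    using assms by (auto simp: selfadjoint_trace_class_def trace_class_def re_def)
  have Psa: "selfadjoint_op K P" using P by (simp add: is_abs_op_def positive_op_def)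
  note PE = abs_op_eigenbasis[OF T(1) E P]
  let ?E = "SOME E. orthonormal_basis K E"
  let ?s = "\<Sum>\<^sub>\<infinity>e\<in>E1. re (ip e (P e))"
  have "diag_bound P ?s"
    using eigenvalues_le_trace[OF Psa PE _ E1 has_sum_infsum[OF summ]]
    by (intro diag_bound_if_eigenvalues[OF Psa PE]) auto
  then have Ps: "(\<Sum>e\<in>F. \<bar>re (ip e (P e))\<bar>) \<le> ?s" if "finite F" "F \<subseteq> ?E" for F
    using some_basis that
    by (intro diag_boundD) (auto simp: orthonormal_basis_iff intro: orthonormal_subset)
  have "(\<Sum>e\<in>F. re (ip e (P e))) \<le> ?s" if "finite F" "F \<subseteq> ?E" for F
    by (rule order.trans[OF sum_mono Ps[OF that]]) simp
  then have "(\<lambda>e. re (ip e (P e))) summable_on ?E"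
    using diag_sum_nonneg[OF P] basis_subset[OF some_basis]
    by (intro nonneg_bdd_above_summable_on bdd_aboveI[of _ ?s]) auto
  then have "((\<lambda>e. re (ip e (P e))) has_sum trace_norm K T) ?E"
    unfolding trace_norm_def the_abs_op[OF T(1) E P] re_def[symmetric] by simp
  then have "(\<Sum>e\<in>G. \<bar>l e\<bar>) \<le> trace_norm K T" if "finite G" "G \<subseteq> E" for G
    using eigenvalues_le_trace[OF Psa PE _ some_basis _ that] by simp
  then show ?thesis
    by (rule diag_bound_if_eigenvalues[OF T(1) E])
qed

end

section \<open>The real normed space of selfadjoint trace class operators\<close>

lemma sum_fun_apply: "(\<Sum>i\<in>I. f i) x = (\<Sum>i\<in>I. f i x)"
  by (induction I rule: infinite_finite_induct) simp_all

context closed_subspace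
begin

text \<open>Each of the three conditions is visibly stable under sums and real multiples, unlike the
  condition on absolute values.\<close>

lemma selfadjoint_trace_class_iff:
  "T \<in> selfadjoint_trace_class K \<longleftrightarrow>
     selfadjoint_op K T \<and> compact_on K T \<and> (\<exists>M. diag_bound T M)"
  using trace_class_imp_compact diag_bound_trace_norm trace_class_if_diag_bound by blast

lemma trace_norm_le:
  "T \<in> selfadjoint_trace_class K \<Longrightarrow> diag_bound T M \<Longrightarrow> trace_norm K T \<le> M"
  using trace_class_imp_compact trace_class_if_diag_bound by blast

lemma trace_norm_nonneg: "T \<in> selfadjoint_trace_class K \<Longrightarrow> 0 \<le> trace_norm K T"
  using diag_bound_nonneg diag_bound_trace_norm by blast

lemma diag_bound_add:
  assumes "diag_bound S M" "diag_bound T N"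
  shows "diag_bound (S + T) (M + N)"
  unfolding diag_bound_def
proof (intro allI impI)
  fix F assume F: "finite F" "F \<subseteq> K" "orthonormal F"
  have "(\<Sum>f\<in>F. \<bar>re (ip f ((S + T) f))\<bar>) \<le> (\<Sum>f\<in>F. \<bar>re (ip f (S f))\<bar> + \<bar>re (ip f (T f))\<bar>)"
    by (intro sum_mono) (simp add: ip_add_right re_add)
  also have "\<dots> \<le> M + N"
    using diag_boundD[OF assms(1) F] diag_boundD[OF assms(2) F] by (simp add: sum.distrib)
  finally show "(\<Sum>f\<in>F. \<bar>re (ip f ((S + T) f))\<bar>) \<le> M + N" .
qed

lemma diag_bound_scaleR:
  assumes "diag_bound T M"
  shows "diag_bound (r *\<^sub>R T) (\<bar>r\<bar> * M)"
  unfolding diag_bound_def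
proof (intro allI impI)
  fix F assume F: "finite F" "F \<subseteq> K" "orthonormal F"
  have "(\<Sum>f\<in>F. \<bar>re (ip f ((r *\<^sub>R T) f))\<bar>) = \<bar>r\<bar> * (\<Sum>f\<in>F. \<bar>re (ip f (T f))\<bar>)"
    by (simp add: scaleR_fun_def ip_scaleR_right re_scaleR abs_mult sum_distrib_left)
  also have "\<dots> \<le> \<bar>r\<bar> * M"
    using diag_boundD[OF assms F] by (intro mult_left_mono) auto
  finally show "(\<Sum>f\<in>F. \<bar>re (ip f ((r *\<^sub>R T) f))\<bar>) \<le> \<bar>r\<bar> * M" .
qed

lemma selfadjoint_add:
  assumes "selfadjoint_op K S" "selfadjoint_op K T"
  shows "selfadjoint_op K (S + T)"
proof -
  note sym = assms[THEN selfadjoint_imp_symmetric]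
  obtain A B where A: "\<forall>x\<in>K. norm (S x) \<le> A * norm x" and B: "\<forall>x\<in>K. norm (T x) \<le> B * norm x"
    using assms[THEN selfadjoint_bound] by blast
  show ?thesis
  proof (rule selfadjointI)
    show "symmetric_on K (S + T)"
      using sym subspace_K unfolding symmetric_on_def
      by (simp add: subspace_add scale_right_distrib ip_add_left ip_add_right)
    show "norm ((S + T) x) \<le> (A + B) * norm x" if "x \<in> K" for x
      using norm_triangle_ineq[of "S x" "T x"] bspec[OF A that] bspec[OF B that]
      by (simp add: distrib_right)
  qed (simp add: assms[THEN selfadjoint_outside])
qed

lemma selfadjoint_scaleR:
  assumes "selfadjoint_op K T"
  shows "selfadjoint_op K (r *\<^sub>R T)"
proof -
  obtain B where B: "\<forall>x\<in>K. norm (T x) \<le> B * norm x"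
    using assms[THEN selfadjoint_bound] by blast
  show ?thesis
  proof (rule selfadjointI)
    show "symmetric_on K (r *\<^sub>R T)"
      using selfadjoint_imp_symmetric[OF assms] subspace_K
      unfolding symmetric_on_def scaleR_fun_def
      by (simp add: subspace_scaleR scale_scaleR scaleR_add_right ip_scaleR_left ip_scaleR_right)
    show "norm ((r *\<^sub>R T) x) \<le> (\<bar>r\<bar> * B) * norm x" if "x \<in> K" for x
      using mult_left_mono[OF bspec[OF B that], of "\<bar>r\<bar>"] by (simp add: scaleR_fun_def mult.assoc)
  qed (simp add: scaleR_fun_def selfadjoint_outside[OF assms])
qed

lemma compact_on_add:
  assumes "compact_on K S" "compact_on K T"
  shows "compact_on K (S + T)"
proof -
  obtain Y Z where "compact Y" "S ` (K \<inter> cball 0 1) \<subseteq> Y" "compact Z" "T ` (K \<inter> cball 0 1) \<subseteq> Z"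
    using assms unfolding compact_on_def by blast
  then show ?thesis
    unfolding compact_on_def
    by (intro exI[of _ "{y + z | y z. y \<in> Y \<and> z \<in> Z}"] conjI compact_sums) fastforce+
qed

lemma compact_on_scaleR:
  assumes "compact_on K T"
  shows "compact_on K (r *\<^sub>R T)"
proof -
  obtain Z where "compact Z" "T ` (K \<inter> cball 0 1) \<subseteq> Z"
    using assms unfolding compact_on_def by blast
  then show ?thesis
    unfolding compact_on_def
    by (intro exI[of _ "(\<lambda>z. r *\<^sub>R z) ` Z"] conjI compact_scaling) (auto simp: scaleR_fun_def)
qed

lemma trace_class_add:
  assumes "S \<in> selfadjoint_trace_class K" "T \<in> selfadjoint_trace_class K"
  shows "S + T \<in> selfadjoint_trace_class K"
  using assms unfolding selfadjoint_trace_class_iff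
  by (auto intro: selfadjoint_add compact_on_add diag_bound_add)

lemma trace_norm_triangle:
  assumes "S \<in> selfadjoint_trace_class K" "T \<in> selfadjoint_trace_class K"
  shows "trace_norm K (S + T) \<le> trace_norm K S + trace_norm K T"
  using assms by (intro trace_norm_le trace_class_add diag_bound_add diag_bound_trace_norm)

lemma trace_class_scaleR:
  assumes "T \<in> selfadjoint_trace_class K"
  shows "r *\<^sub>R T \<in> selfadjoint_trace_class K"
  using assms unfolding selfadjoint_trace_class_iff
  by (auto intro: selfadjoint_scaleR compact_on_scaleR diag_bound_scaleR)

lemma trace_norm_scaleR:
  assumes T: "T \<in> selfadjoint_trace_class K"
  shows "trace_norm K (r *\<^sub>R T) = \<bar>r\<bar> * trace_norm K T"
proof (rule antisym)
  have le: "trace_norm K (t *\<^sub>R U) \<le> \<bar>t\<bar> * trace_norm K U" if "U \<in> selfadjoint_trace_class K" for t U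
    using that by (intro trace_norm_le trace_class_scaleR diag_bound_scaleR diag_bound_trace_norm)
  show "trace_norm K (r *\<^sub>R T) \<le> \<bar>r\<bar> * trace_norm K T" by (rule le[OF T])
  show "\<bar>r\<bar> * trace_norm K T \<le> trace_norm K (r *\<^sub>R T)"
  proof (cases "r = 0")
    case True
    then show ?thesis
      using trace_norm_nonneg[OF trace_class_scaleR[OF T, of 0]] by simp
  next
    case False
    then have "trace_norm K T \<le> \<bar>inverse r\<bar> * trace_norm K (r *\<^sub>R T)"
      using le[OF trace_class_scaleR[OF T, of r], of "inverse r"] by simp
    then show ?thesis
      using False by (simp add: field_simps)
  qed
qed

lemma subspace_trace_class: "Real_Vector_Spaces.subspace (selfadjoint_trace_class K)"
proof (rule real_vector.subspaceI)
  have "selfadjoint_op K 0"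
    using subspace_K
    by (intro selfadjointI[of 0 0]) (auto simp: symmetric_on_def subspace_0)
  moreover have "compact_on K 0"
    unfolding compact_on_def by (intro exI[of _ "{0}"]) auto
  moreover have "diag_bound 0 0"
    by (simp add: diag_bound_def)
  ultimately show "0 \<in> selfadjoint_trace_class K"
    unfolding selfadjoint_trace_class_iff by blast
qed (fact trace_class_add trace_class_scaleR)+

lemma trace_class_diff:
  "S \<in> selfadjoint_trace_class K \<Longrightarrow> T \<in> selfadjoint_trace_class K \<Longrightarrow>
     S - T \<in> selfadjoint_trace_class K"
  using real_vector.subspace_diff[OF subspace_trace_class] .

section \<open>Operators of finite rank\<close>

lemma ket_bra_apply: "y \<in> K \<Longrightarrow> ket_bra K x y = scale (ip x y) x"
  and ket_bra_outside: "y \<notin> K \<Longrightarrow> ket_bra K x y = 0"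
  by (simp_all add: ket_bra_def)

lemma re_ip_ket_bra: "f \<in> K \<Longrightarrow> re (ip f (ket_bra K x f)) = (norm (ip f x))\<^sup>2"
  by (simp only: ket_bra_apply ip_scale_right ip_mult_ip re_of_real)

lemma diag_bound_ket_bra: "diag_bound (ket_bra K x) ((norm x)\<^sup>2)"
  unfolding diag_bound_def
proof (intro allI impI)
  fix F assume F: "finite F" "F \<subseteq> K" "orthonormal F"
  have "(\<Sum>f\<in>F. \<bar>re (ip f (ket_bra K x f))\<bar>) = (\<Sum>f\<in>F. (norm (ip f x))\<^sup>2)"
    using F(2) by (intro sum.cong) (auto simp: re_ip_ket_bra)
  then show "(\<Sum>f\<in>F. \<bar>re (ip f (ket_bra K x f))\<bar>) \<le> (norm x)\<^sup>2"
    using bessel[OF F(3,1)] by simp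
qed

lemma ket_bra_trace_class:
  assumes x: "x \<in> K"
  shows "ket_bra K x \<in> selfadjoint_trace_class K"
proof -
  have "symmetric_on K (ket_bra K x)"
    using x subspace_K unfolding symmetric_on_def
    by (simp add: ket_bra_apply subspace_add subspace_scale ip_add_right scale_left_distrib
        ip_scale_right ip_scale_left mult.commute flip: ip_conjg)
  then have "selfadjoint_op K (ket_bra K x)"
  proof (rule selfadjointI)
    show "norm (ket_bra K x y) \<le> (norm x)\<^sup>2 * norm y" if "y \<in> K" for y
      using mult_right_mono[OF norm_ip_le[of x y] norm_ge_zero[of x]] that
      by (simp add: ket_bra_apply norm_scale power2_eq_square mult_ac)
  qed (rule ket_bra_outside)
  moreover have "compact_on K (ket_bra K x)"
    unfolding compact_on_def
  proof (intro exI conjI)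
    show "compact ((\<lambda>c. scale c x) ` cball 0 (norm x))"
      by (intro compact_continuous_image compact_scalar_cball linear_continuous_on
          scale.bounded_linear_left)
    have "norm (ip x y) \<le> norm x" if "norm y \<le> 1" for y
      using norm_ip_le[of x y] mult_left_mono[OF that norm_ge_zero[of x]] by simp
    then show "ket_bra K x ` (K \<inter> cball 0 1) \<subseteq> (\<lambda>c. scale c x) ` cball 0 (norm x)"
      by (auto simp: ket_bra_apply)
  qed
  ultimately show ?thesis
    using diag_bound_ket_bra unfolding selfadjoint_trace_class_iff by blast
qed

lemma trace_norm_ket_bra: "x \<in> K \<Longrightarrow> trace_norm K (ket_bra K x) \<le> (norm x)\<^sup>2"
  by (intro trace_norm_le ket_bra_trace_class diag_bound_ket_bra)

text \<open>The spectral decomposition is cut off where the tail of the sum of |l e| is at most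
  \<epsilon>.\<close>

lemma finite_rank_approximation:
  assumes T: "T \<in> selfadjoint_trace_class K" and "\<epsilon> > 0"
  obtains F l where "finite F" "F \<subseteq> K" "trace_norm K (T - (\<Sum>e\<in>F. l e *\<^sub>R ket_bra K e)) \<le> \<epsilon>"
proof -
  note Tsc = trace_class_imp_compact[OF T]
  obtain E l where El: "eigenbasis T E l"
    using eigenbasis_exists[OF Tsc] .
  have E: "orthonormal E" "E \<subseteq> K" "orthonormal_basis K E" "\<And>e. e \<in> E \<Longrightarrow> T e = l e *\<^sub>R e"
    using El by (auto simp: eigenbasis_def orthonormal_basis_iff)
  have le: "(\<Sum>e\<in>G. \<bar>l e\<bar>) \<le> trace_norm K T" if "finite G" "G \<subseteq> E" for G
    using diag_bound_eigenvalues[OF Tsc(1) El diag_bound_trace_norm[OF T] that] .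
  then have summ: "(\<lambda>e. \<bar>l e\<bar>) summable_on E"
    by (intro nonneg_bdd_above_summable_on bdd_aboveI[of _ "trace_norm K T"]) auto
  let ?s = "\<Sum>\<^sub>\<infinity>e\<in>E. \<bar>l e\<bar>"
  obtain F where F: "finite F" "F \<subseteq> E" "dist (\<Sum>e\<in>F. \<bar>l e\<bar>) ?s \<le> \<epsilon>"
    using has_sum_finite_approximation[OF has_sum_infsum[OF summ] \<open>\<epsilon> > 0\<close>] by blast
  define R where "R = T - (\<Sum>e\<in>F. l e *\<^sub>R ket_bra K e)"
  have "(\<Sum>e\<in>F. l e *\<^sub>R ket_bra K e) \<in> selfadjoint_trace_class K"
    using F E by (intro real_vector.subspace_sum[OF subspace_trace_class] trace_class_scaleR
        ket_bra_trace_class) auto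
  then have R: "R \<in> selfadjoint_trace_class K"
    unfolding R_def by (intro trace_class_diff T)
  \<comment> \<open>The remainder keeps the eigenbasis E; subtraction only sets the eigenvalues on F
    to 0.\<close>
  define l' where "l' e = (if e \<in> F then 0 else l e)" for e
  have "R e = l' e *\<^sub>R e" if e: "e \<in> E" for e
  proof -
    have "(\<Sum>f\<in>F. l f *\<^sub>R ket_bra K f) e = (\<Sum>f\<in>F. l f *\<^sub>R scale (ip f e) f)"
      using e E(2) by (auto simp: sum_fun_apply scaleR_fun_def ket_bra_apply intro!: sum.cong)
    also have "\<dots> = (\<Sum>f\<in>F. if f = e then l f *\<^sub>R f else 0)"
      using e F(2) by (intro sum.cong) (auto simp: orthonormalD[OF E(1)])
    also have "\<dots> = (if e \<in> F then l e *\<^sub>R e else 0)"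
      using F(1) by simp
    finally show ?thesis
      using E(4)[OF e] by (simp add: R_def l'_def)
  qed
  then have R_eig: "eigenbasis R E l'"
    using E(3) by (simp add: eigenbasis_def)
  have "diag_bound R \<epsilon>"
  proof (rule diag_bound_if_eigenvalues[OF trace_class_imp_compact(1)[OF R] R_eig])
    fix G assume G: "finite G" "G \<subseteq> E"
    have "(\<Sum>e\<in>G. \<bar>l' e\<bar>) = (\<Sum>e\<in>G - F. \<bar>l e\<bar>)"
      using G(1) by (intro sum.mono_neutral_cong_right) (auto simp: l'_def)
    also have "\<dots> = (\<Sum>e\<in>F \<union> (G - F). \<bar>l e\<bar>) - (\<Sum>e\<in>F. \<bar>l e\<bar>)"
      using F(1) G(1) by (subst sum.union_disjoint) auto
    also have "(\<Sum>e\<in>F \<union> (G - F). \<bar>l e\<bar>) \<le> ?s"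
      using F G by (intro finite_sum_le_infsum[OF summ]) auto
    also have "?s - (\<Sum>e\<in>F. \<bar>l e\<bar>) \<le> dist (\<Sum>e\<in>F. \<bar>l e\<bar>) ?s"
      by (simp add: dist_real_def)
    finally show "(\<Sum>e\<in>G. \<bar>l' e\<bar>) \<le> \<epsilon>"
      using F(3) by linarith
  qed
  then have "trace_norm K R \<le> \<epsilon>"
    by (rule trace_norm_le[OF R])
  then show ?thesis
    using that F E by (auto simp: R_def)
qed

text \<open>The mixed part |y><x| + |x><y| of |x + y><x + y|; a single mixed term is in general not
  selfadjoint and would leave the space on which the functional is bounded.\<close>

definition ket_bra_sym :: "'h \<Rightarrow> 'h \<Rightarrow> 'h \<Rightarrow> 'h" where
  "ket_bra_sym x y = (\<lambda>z. if z \<in> K then scale (ip x z) y + scale (ip y z) x else 0)"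

lemma ket_bra_add: "ket_bra K (x + y) = ket_bra K x + ket_bra K y + ket_bra_sym x y"
  by (rule ext)
    (simp add: ket_bra_def ket_bra_sym_def ip_add_left scale_left_distrib scale_right_distrib)

lemma ket_bra_sym_trace_class:
  assumes "x \<in> K" "y \<in> K"
  shows "ket_bra_sym x y \<in> selfadjoint_trace_class K"
proof -
  have "ket_bra_sym x y = ket_bra K (x + y) - ket_bra K x - ket_bra K y"
    by (simp add: ket_bra_add)
  then show ?thesis
    using assms subspace_K by (auto intro!: trace_class_diff ket_bra_trace_class subspace_add)
qed

text \<open>Cauchy-Schwarz over F followed by Bessel for x and for y. It makes x \<mapsto> |x><x|
  continuous in the trace norm.\<close>

lemma trace_norm_ket_bra_sym:
  assumes "x \<in> K" "y \<in> K"
  shows "trace_norm K (ket_bra_sym x y) \<le> 2 * (norm x * norm y)"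
proof (rule trace_norm_le[OF ket_bra_sym_trace_class[OF assms]], unfold diag_bound_def, intro allI impI)
  fix F assume F: "finite F" "F \<subseteq> K" "orthonormal F"
  have "\<bar>re (ip f (ket_bra_sym x y f))\<bar> \<le> 2 * (\<bar>norm (ip f x)\<bar> * \<bar>norm (ip f y)\<bar>)" if "f \<in> F" for f
  proof -
    have "re (ip f (ket_bra_sym x y f)) = re (ip x f * ip f y) + re (ip y f * ip f x)"
      using that F(2) by (auto simp: ket_bra_sym_def ip_add_right ip_scale_right re_add)
    moreover have "\<bar>re (ip x f * ip f y)\<bar> \<le> norm (ip f x) * norm (ip f y)"
      using abs_re_le[of "ip x f * ip f y"] by (simp add: norm_mult norm_ip_commute[of x f])
    moreover have "\<bar>re (ip y f * ip f x)\<bar> \<le> norm (ip f x) * norm (ip f y)"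
      using abs_re_le[of "ip y f * ip f x"] by (simp add: norm_mult norm_ip_commute[of y f] mult.commute)
    ultimately show ?thesis by simp
  qed
  then have "(\<Sum>f\<in>F. \<bar>re (ip f (ket_bra_sym x y f))\<bar>)
      \<le> (\<Sum>f\<in>F. 2 * (\<bar>norm (ip f x)\<bar> * \<bar>norm (ip f y)\<bar>))"
    by (rule sum_mono)
  also have "\<dots> \<le> 2 * (L2_set (\<lambda>f. norm (ip f x)) F * L2_set (\<lambda>f. norm (ip f y)) F)"
    unfolding sum_distrib_left[symmetric] by (intro mult_left_mono L2_set_mult_ineq) simp
  also have "\<dots> \<le> 2 * (norm x * norm y)"
  proof -
    have "L2_set (\<lambda>f. norm (ip f z)) F \<le> norm z" for z
      unfolding L2_set_def by (intro real_le_lsqrt bessel F norm_ge_zero) 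
    then show ?thesis by (intro mult_left_mono mult_mono) (auto simp: L2_set_nonneg)
  qed
  finally show "(\<Sum>f\<in>F. \<bar>re (ip f (ket_bra_sym x y f))\<bar>) \<le> 2 * (norm x * norm y)" .
qed

end

section \<open>Hermitian forms\<close>

context hilbert_space
begin

text \<open>Relative to W because a form built from a matrix exists only on the algebraic span of
  the \<open>\<eta> n\<close>.\<close>

definition hermitian_form :: "'h set \<Rightarrow> ('h \<Rightarrow> 'h \<Rightarrow> 'f) \<Rightarrow> bool" where
  "hermitian_form W Q \<longleftrightarrow>
     (\<forall>x\<in>W. \<forall>y\<in>W. \<forall>z\<in>W. Q x (y + z) = Q x y + Q x z) \<and>
     (\<forall>a. \<forall>x\<in>W. \<forall>y\<in>W. Q x (scale a y) = a * Q x y) \<and>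
     (\<forall>x\<in>W. \<forall>y\<in>W. Q y x = conjg (Q x y))"

lemma hermitian_formD:
  assumes "hermitian_form W Q"
  shows "x \<in> W \<Longrightarrow> y \<in> W \<Longrightarrow> z \<in> W \<Longrightarrow> Q x (y + z) = Q x y + Q x z"
    "x \<in> W \<Longrightarrow> y \<in> W \<Longrightarrow> Q x (scale a y) = a * Q x y"
    "x \<in> W \<Longrightarrow> y \<in> W \<Longrightarrow> Q y x = conjg (Q x y)"
  using assms unfolding hermitian_form_def by blast+

lemma hermitian_form_ip: "hermitian_form W ip"
  unfolding hermitian_form_def by (intro conjI ballI allI ip_add_right ip_scale_right ip_conjg)

lemma hermitian_form_diff:
  "hermitian_form W P \<Longrightarrow> hermitian_form W Q \<Longrightarrow> hermitian_form W (\<lambda>x y. P x y - Q x y)"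
  unfolding hermitian_form_def by (metis (no_types) add_diff_add conjg_diff right_diff_distrib)

lemma hermitian_form_sum_right:
  assumes Q: "hermitian_form W Q" and W: "subspace W" and x: "x \<in> W"
    and v: "\<And>i. i \<in> I \<Longrightarrow> v i \<in> W"
  shows "Q x (\<Sum>i\<in>I. scale (c i) (v i)) = (\<Sum>i\<in>I. c i * Q x (v i))"
  using v
proof (induction I rule: infinite_finite_induct)
  case (insert i I)
  then show ?case
    using W x by (simp add: hermitian_formD(1,2)[OF Q] subspace_scale subspace_sum)
qed (use hermitian_formD(2)[OF Q x x, of 0] in auto)

lemma hermitian_form_sum:
  assumes Q: "hermitian_form W Q" and W: "subspace W" and v: "\<And>i. i \<in> I \<Longrightarrow> v i \<in> W"
  shows "Q (\<Sum>i\<in>I. scale (c i) (v i)) (\<Sum>i\<in>I. scale (c i) (v i))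
    = (\<Sum>i\<in>I. \<Sum>k\<in>I. conjg (c i) * Q (v i) (v k) * c k)"
proof -
  let ?x = "\<Sum>i\<in>I. scale (c i) (v i)"
  have x: "?x \<in> W" using W v by (intro subspace_sum subspace_scale)
  have "Q ?x (v k) = (\<Sum>i\<in>I. conjg (c i) * Q (v i) (v k))" if "k \<in> I" for k
  proof -
    have "Q ?x (v k) = conjg (Q (v k) ?x)"
      using hermitian_formD(3)[OF Q v[OF that] x] .
    also have "\<dots> = (\<Sum>i\<in>I. conjg (c i) * conjg (Q (v k) (v i)))"
      by (subst hermitian_form_sum_right[OF Q W v[OF that]]) (auto simp: v conjg_sum conjg_mult)
    also have "\<dots> = (\<Sum>i\<in>I. conjg (c i) * Q (v i) (v k))"
      by (intro sum.cong refl arg_cong2[where f=times] hermitian_formD(3)[OF Q v[OF that] v, symmetric])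
    finally show ?thesis .
  qed
  then have "Q ?x ?x = (\<Sum>k\<in>I. c k * (\<Sum>i\<in>I. conjg (c i) * Q (v i) (v k)))"
    by (subst hermitian_form_sum_right[OF Q W x]) (auto simp: v)
  also have "\<dots> = (\<Sum>k\<in>I. \<Sum>i\<in>I. conjg (c i) * Q (v i) (v k) * c k)"
    by (simp add: sum_distrib_left mult_ac)
  also have "\<dots> = (\<Sum>i\<in>I. \<Sum>k\<in>I. conjg (c i) * Q (v i) (v k) * c k)"
    by (rule sum.swap)
  finally show ?thesis .
qed

text \<open>After a phase rotation of y the value Q x y becomes its own modulus, so polarization of
  the real part is enough over either field.\<close>

lemma hermitian_form_polarization:
  assumes Q: "hermitian_form W Q" and W: "subspace W" and xy: "x \<in> W" "y \<in> W"
    and diag: "\<And>z. z \<in> W \<Longrightarrow> re (Q z z) = 0"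
  shows "Q x y = 0"
proof -
  obtain u where u: "norm u = 1" "u * Q x y = of_real (norm (Q x y))"
    by (rule conjg_phase)
  define z where "z = scale u y"
  have z: "z \<in> W" "x + z \<in> W" using W xy by (auto simp: z_def subspace_scale subspace_add)
  have "Q (x + z) (x + z) = Q (x + z) x + Q (x + z) z"
    using hermitian_formD(1)[OF Q z(2) xy(1) z(1)] .
  moreover have "re (Q (x + z) x) = re (Q x x) + re (Q x z)"
    using hermitian_formD(3)[OF Q xy(1) z(2)] hermitian_formD(1)[OF Q xy(1) xy(1) z(1)]
    by (simp add: re_add)
  moreover have "re (Q (x + z) z) = re (Q z x) + re (Q z z)"
    using hermitian_formD(3)[OF Q z] hermitian_formD(1)[OF Q z(1) xy(1) z(1)]
    by (simp add: re_add)
  moreover have "re (Q z x) = re (Q x z)"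
    using hermitian_formD(3)[OF Q xy(1) z(1)] by simp
  ultimately have "re (Q x z) = 0"
    using diag[OF z(2)] diag[OF xy(1)] diag[OF z(1)] by (simp add: re_add)
  moreover have "Q x z = of_real (norm (Q x y))"
    using hermitian_formD(2)[OF Q xy] u by (simp add: z_def)
  ultimately show ?thesis by simp
qed

text \<open>Gram-Schmidt inside L. Staying in L matters because the forms to be evaluated on V are
  defined only there.\<close>

lemma finite_orthonormal_expansion:
  assumes "finite Y" "Y \<subseteq> L" "subspace L"
  shows "\<exists>V. finite V \<and> V \<subseteq> L \<and> orthonormal V \<and> (\<forall>y\<in>Y. y = (\<Sum>v\<in>V. scale (ip v y) v))"
  using assms
proof (induction rule: finite_induct)
  case empty
  then show ?case by (intro exI[of _ "{}"]) (simp add: orthonormal_def)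
next
  case (insert y Y)
  then obtain V where V: "finite V" "V \<subseteq> L" "orthonormal V"
    "\<And>x. x \<in> Y \<Longrightarrow> x = (\<Sum>v\<in>V. scale (ip v x) v)" by auto
  define z where "z = y - (\<Sum>v\<in>V. scale (ip v y) v)"
  have z: "z \<in> L"
    unfolding z_def using insert.prems V(2)
    by (intro subspace_diff subspace_sum subspace_scale) auto
  have orth: "ip v z = 0" if "v \<in> V" for v
    using ip_orthonormal_sum[OF V(3,1) subset_refl that, of "\<lambda>v. ip v y"] that
    by (simp add: z_def ip.diff_right)
  show ?case
  proof (cases "z = 0")
    case True
    then show ?thesis using V by (intro exI[of _ V]) (auto simp: z_def)
  next
    case False
    define w where "w = inverse (norm z) *\<^sub>R z"
    have w: "w \<in> L" "norm w = 1"
      using unit_vector[OF insert.prems(2) z False] by (simp_all add: w_def)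
    have wV: "ip v w = 0" "ip w v = 0" if "v \<in> V" for v
      using orth[OF that] ip_eq_0_commute[of v z]
      by (simp_all add: w_def ip_scaleR_right ip_scaleR_left)
    have ww: "ip w w = 1" using w(2) by (simp add: ip_self)
    then have "w \<notin> V" using wV by auto
    have on: "orthonormal (insert w V)"
      using V(3) wV ww by (auto simp: orthonormal_def)
    have "x = (\<Sum>v\<in>insert w V. scale (ip v x) v)" if "x \<in> insert y Y" for x
    proof (cases "x = y")
      case True
      have "y = (\<Sum>v\<in>V. scale (ip v y) v) + norm z *\<^sub>R w"
        using False by (simp add: w_def) (simp add: z_def)
      then have y: "y = (\<Sum>v\<in>V. scale (ip v y) v) + scale (of_real (norm z)) w"
        by (simp add: scale_of_real)
      have "ip w y = ip w (\<Sum>v\<in>V. scale (ip v y) v) + ip w (scale (of_real (norm z)) w)"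
        by (subst y) (rule ip_add_right)
      also have "\<dots> = of_real (norm z)"
        using wV by (simp add: ip_sum_scale_right ip_scale_right ww)
      finally have "ip w y = of_real (norm z)" .
      then show ?thesis
        using True y V(1) \<open>w \<notin> V\<close> by (simp add: add.commute)
    next
      case False
      then have x: "x = (\<Sum>v\<in>V. scale (ip v x) v)" using that V(4) by auto
      have "ip w x = 0"
        by (subst x) (simp add: ip_sum_scale_right wV)
      then show ?thesis
        using x V(1) \<open>w \<notin> V\<close> by simp
    qed
    then show ?thesis
      using V w on by (intro exI[of _ "insert w V"]) auto
  qed
qed

end

section \<open>Correlation matrices\<close>

definition matrix_form :: "(nat \<Rightarrow> nat \<Rightarrow> 'f::real_or_complex) \<Rightarrow> nat set \<Rightarrow> (nat \<Rightarrow> 'f) \<Rightarrow> 'f" where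
  "matrix_form M I c = (\<Sum>n\<in>I. \<Sum>m\<in>I. conjg (c n) * M n m * c m)"

lemma conjg_matrix_form:
  assumes "\<And>n m. M m n = conjg (M n m)"
  shows "conjg (matrix_form M I c) = matrix_form M I c"
proof -
  have "conjg (matrix_form M I c) = (\<Sum>n\<in>I. \<Sum>m\<in>I. conjg (c m) * M m n * c n)"
    unfolding matrix_form_def conjg_sum conjg_mult conjg_conjg assms[symmetric] by (simp add: mult_ac)
  also have "\<dots> = matrix_form M I c"
    unfolding matrix_form_def by (rule sum.swap)
  finally show ?thesis .
qed

lemma matrix_form_cong:
  assumes "finite I" "J \<subseteq> I" "\<And>n. n \<in> J \<Longrightarrow> c n = d n" "\<And>n. n \<in> I - J \<Longrightarrow> c n = 0"
  shows "matrix_form M I c = matrix_form M J d"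
proof -
  have "matrix_form M I c = (\<Sum>n\<in>J. \<Sum>m\<in>I. conjg (c n) * M n m * c m)"
    unfolding matrix_form_def using assms by (intro sum.mono_neutral_right) auto
  also have "\<dots> = (\<Sum>n\<in>J. \<Sum>m\<in>J. conjg (c n) * M n m * c m)"
    using assms by (intro sum.cong sum.mono_neutral_right) auto
  also have "\<dots> = matrix_form M J d"
    unfolding matrix_form_def using assms by (intro sum.cong) auto
  finally show ?thesis .
qed

text \<open>Arbitrary finite index sets replace the supports of the coefficient sequences. The real
  part suffices because Hermitian symmetry makes the form real.\<close>

lemma correlation_matrices_iff:
  "M \<in> correlation_matrices \<longleftrightarrow> (\<forall>n m. M m n = conjg (M n m)) \<and> (\<forall>n. M n n = 1) \<and>
     (\<forall>I c. finite I \<longrightarrow> 0 \<le> re (matrix_form M I c))"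
proof (cases "\<forall>n m. M m n = conjg (M n m)")
  case True
  have "(\<forall>c. finite {n. c n \<noteq> 0} \<longrightarrow> matrix_form M {n. c n \<noteq> 0} c \<in> \<real>\<^sub>\<ge>\<^sub>0)
      \<longleftrightarrow> (\<forall>I c. finite I \<longrightarrow> 0 \<le> re (matrix_form M I c))" (is "?l \<longleftrightarrow> ?r")
  proof
    assume l: ?l
    show ?r
    proof (intro allI impI)
      fix I :: "nat set" and c :: "nat \<Rightarrow> 'a" assume I: "finite I"
      define d where "d n = (if n \<in> I then c n else 0)" for n
      have "{n. d n \<noteq> 0} \<subseteq> I" by (auto simp: d_def)
      then have "matrix_form M I c = matrix_form M {n. d n \<noteq> 0} d"
        using I by (intro matrix_form_cong) (auto simp: d_def split: if_splits)
      moreover have "finite {n. d n \<noteq> 0}"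
        using I \<open>{n. d n \<noteq> 0} \<subseteq> I\<close> by (rule finite_subset[rotated])
      ultimately show "0 \<le> re (matrix_form M I c)"
        using l by (simp add: nonneg_Reals_iff_re)
    qed
  next
    assume ?r
    moreover have "conjg (matrix_form M I c) = matrix_form M I c" for I c
      by (rule conjg_matrix_form) (use True in blast)
    ultimately show ?l
      by (simp add: nonneg_Reals_iff_re)
  qed
  then show ?thesis
    unfolding correlation_matrices_def matrix_form_def mem_Collect_eq by (rule conj_cong[OF refl conj_cong[OF refl]])
next
  case False
  then show ?thesis
    unfolding correlation_matrices_def mem_Collect_eq by blast
qed

lemma matrix_form_add: "matrix_form (\<lambda>n m. M n m + N n m) I c = matrix_form M I c + matrix_form N I c"
  by (simp add: matrix_form_def distrib_left distrib_right sum.distrib)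

lemma matrix_form_scaleR: "matrix_form (\<lambda>n m. r *\<^sub>R M n m) I c = r *\<^sub>R matrix_form M I c"
  by (simp add: matrix_form_def scaleR_sum_right)

text \<open>
  The perturbation of \<open>c\<close> by \<open>- z\<close> in direction \<open>n\<close>, with \<open>z\<close> the \<open>n\<close>-th entry of the product,
  changes the form by \<open>- (norm z)\<^sup>2\<close>.
\<close>

lemma correlation_form_eq_0:
  assumes M: "M \<in> correlation_matrices" and I: "finite I" and c: "matrix_form M I c = 0"
  shows "(\<Sum>m\<in>I. M n m * c m) = 0"
proof -
  have herm: "M m n = conjg (M n m)" and diag: "M n n = 1" for m n
    using M unfolding correlation_matrices_iff by blast+
  \<comment> \<open>The direction n of the perturbation may lie outside I, so c is extended by
    0.\<close>
  define J where "J = insert n I"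
  define d where "d m = (if m \<in> I then c m else 0)" for m
  have J: "finite J" "n \<in> J" using I by (auto simp: J_def)
  define z where "z = (\<Sum>m\<in>J. M n m * d m)"
  have z: "z = (\<Sum>m\<in>I. M n m * c m)"
    unfolding z_def using I by (intro sum.mono_neutral_cong_right) (auto simp: J_def d_def)
  have d: "matrix_form M J d = 0"
    using matrix_form_cong[of J I d c M] I c by (auto simp: J_def d_def)
  define \<delta> where "\<delta> m = (if m = n then z else 0)" for m
  have \<delta>: "(\<Sum>m\<in>J. f m * \<delta> m) = f n * z" "(\<Sum>m\<in>J. conjg (\<delta> m) * f m) = conjg z * f n" for f
    using J by (simp_all add: \<delta>_def if_distrib[where f=conjg] if_distrib[where f="\<lambda>x. _ * x"]
        if_distrib[where f="\<lambda>x. x * _"] cong: if_cong)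
  have "matrix_form M J (\<lambda>m. d m - \<delta> m) = matrix_form M J d
      - (\<Sum>k\<in>J. \<Sum>m\<in>J. conjg (d k) * M k m * \<delta> m) - (\<Sum>k\<in>J. \<Sum>m\<in>J. conjg (\<delta> k) * M k m * d m)
      + (\<Sum>k\<in>J. \<Sum>m\<in>J. conjg (\<delta> k) * M k m * \<delta> m)"
    by (simp add: matrix_form_def conjg_diff algebra_simps sum.distrib sum_subtractf)
  also have "(\<Sum>k\<in>J. \<Sum>m\<in>J. conjg (d k) * M k m * \<delta> m) = conjg z * z"
  proof -
    have "(\<Sum>k\<in>J. \<Sum>m\<in>J. conjg (d k) * M k m * \<delta> m) = (\<Sum>k\<in>J. conjg (d k) * M k n * z)"
      by (simp only: \<delta>(1))
    also have "\<dots> = (\<Sum>k\<in>J. conjg (d k) * M k n) * z"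
      by (simp only: sum_distrib_right)
    also have "(\<Sum>k\<in>J. conjg (d k) * M k n) = conjg z"
      by (simp add: z_def conjg_sum conjg_mult mult.commute flip: herm)
    finally show ?thesis .
  qed
  also have "(\<Sum>k\<in>J. \<Sum>m\<in>J. conjg (\<delta> k) * M k m * d m) = conjg z * z"
    by (simp only: mult.assoc sum_distrib_left[symmetric] \<delta>(2)) (simp only: z_def)
  \<comment> \<open>The quadratic term returns exactly one (norm z)^2, since M n n = 1, against the
    two lost in the mixed terms.\<close>
  also have "(\<Sum>k\<in>J. \<Sum>m\<in>J. conjg (\<delta> k) * M k m * \<delta> m) = conjg z * z"
    by (simp only: \<delta>(1)) (simp only: mult.assoc \<delta>(2) diag mult_1)
  finally have "re (matrix_form M J (\<lambda>m. d m - \<delta> m)) = - (norm z)\<^sup>2"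
    unfolding d by (simp only: conjg_mult_self re_add re_diff re_of_real) simp
  moreover have "re (matrix_form M J (\<lambda>m. d m - \<delta> m)) \<ge> 0"
    using M J(1) unfolding correlation_matrices_iff by blast
  ultimately show ?thesis using z by simp
qed

section \<open>Extremality and density\<close>

locale gram_matrix = closed_subspace scale ip K
  for scale :: "'f::real_or_complex \<Rightarrow> 'h::{real_inner,complete_space} \<Rightarrow> 'h"
    and ip :: "'h \<Rightarrow> 'h \<Rightarrow> 'f" and K :: "'h set" +
  fixes \<eta> :: "nat \<Rightarrow> 'h" and C :: "nat \<Rightarrow> nat \<Rightarrow> 'f"
  assumes K_eq: "K = closure (span (range \<eta>))"
    and C_eq: "C n m = ip (\<eta> n) (\<eta> m)"
    and C_correlation: "C \<in> correlation_matrices"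
begin

abbreviation L :: "'h set" where "L \<equiv> span (range \<eta>)"

lemma L_subset: "L \<subseteq> K"
  unfolding K_eq by (rule closure_subset)

lemma eta_L: "\<eta> n \<in> L"
  by (intro span_base rangeI)

lemma eta_K: "\<eta> n \<in> K"
  using L_subset eta_L by blast

lemma subspace_L: "subspace L"
  by (rule subspace_span)

lemma L_E:
  assumes "x \<in> L"
  obtains I c where "finite I" "x = (\<Sum>n\<in>I. scale (c n) (\<eta> n))"
proof -
  obtain F a where F: "finite F" "F \<subseteq> range \<eta>" "x = (\<Sum>v\<in>F. scale (a v) v)"
    using assms unfolding span_explicit by blast
  \<comment> \<open>\<open>\<eta>\<close> may repeat values; one index per vector is selected so
    that the sum over vectors can be reindexed.\<close>
  obtain I where I: "inj_on \<eta> I" "F = \<eta> ` I"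
    using F(2) by (auto simp: subset_image_inj)
  then have "finite I" using F(1) by (simp add: finite_image_iff)
  show ?thesis
    using that[of I "\<lambda>n. a (\<eta> n)"] \<open>finite I\<close> I F(3) by (simp add: sum.reindex)
qed

lemma matrix_form_C: "matrix_form C I c = ip (\<Sum>n\<in>I. scale (c n) (\<eta> n)) (\<Sum>n\<in>I. scale (c n) (\<eta> n))"
  unfolding matrix_form_def C_eq
  by (rule hermitian_form_sum[OF hermitian_form_ip[of UNIV], symmetric]) auto

lemma matrix_form_hermitian_form:
  assumes "hermitian_form L Q"
  shows "Q (\<Sum>n\<in>I. scale (c n) (\<eta> n)) (\<Sum>n\<in>I. scale (c n) (\<eta> n))
    = matrix_form (\<lambda>n m. Q (\<eta> n) (\<eta> m)) I c"
  unfolding matrix_form_def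
  by (rule hermitian_form_sum[OF assms subspace_L]) (rule eta_L)

subsection \<open>Extremality implies density\<close>

text \<open>
  A real functional on operators is evaluated on rank-one operators; its values there are a
  quadratic form on \<open>K\<close>, polarized in the real part by \<open>B\<close> and then complexified with \<open>j\<close>.
\<close>

lemma functional_hermitian_form:
  fixes \<phi> :: "('h \<Rightarrow> 'h) \<Rightarrow> real"
  assumes \<phi>: "linear \<phi>"
  obtains Q where "hermitian_form K Q" "\<And>x. x \<in> K \<Longrightarrow> Q x x = of_real (\<phi> (ket_bra K x))"
proof -
  obtain j :: 'f where j: "conjg j = - j" "j = 0 \<or> j * j = - 1"
    "\<And>a. \<exists>r s. a = of_real r + of_real s * j \<and> \<bar>r\<bar> \<le> norm a \<and> \<bar>s\<bar> \<le> norm a"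
    using imaginary_unit by metis
  define B where "B x y = \<phi> (ket_bra_sym x y) / 2" for x y
  \<comment> \<open>B is to be the real part of Q. Linearity demands Q x (j y) = j Q x y, which
    forces the imaginary part to be - B x (j y); for j = 0 only B remains.\<close>
  define Q where "Q x y = of_real (B x y) - j * of_real (B x (scale j y))" for x y
  note op = fun_eq_iff ket_bra_sym_def ip_add_left ip_scale_left scale_left_distrib
    scale_right_distrib scaleR_fun_def
  have B_add: "B x (y + z) = B x y + B x z" for x y z
  proof -
    have "ket_bra_sym x (y + z) = ket_bra_sym x y + ket_bra_sym x z"
      by (simp add: op)
    then show ?thesis by (simp add: B_def linear_add[OF \<phi>] add_divide_distrib)
  qed
  have B_scaleR: "B x (r *\<^sub>R y) = r * B x y" for x y r
  proof -
    have "ket_bra_sym x (r *\<^sub>R y) = r *\<^sub>R ket_bra_sym x y"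
      by (simp add: op scale_scaleR ip_scaleR_left scaleR_scale scaleR_add_right)
    then show ?thesis by (simp add: B_def linear_scale[OF \<phi>])
  qed
  have B_commute: "B x y = B y x" for x y
  proof -
    have "ket_bra_sym x y = ket_bra_sym y x"
      by (simp add: op add.commute)
    then show ?thesis by (simp add: B_def)
  qed
  \<comment> \<open>Reflects conjg j = - j. Together with the symmetry of B it gives B x (j x) = 0,
    so that Q x x is real.\<close>
  have B_j: "B x (scale j y) = - B (scale j x) y" for x y
  proof -
    have "ket_bra_sym x (scale j y) = - ket_bra_sym (scale j x) y"
      by (simp add: op j(1) mult.commute)
    then show ?thesis by (simp add: B_def linear_neg[OF \<phi>])
  qed
  have Q_add: "Q x (y + z) = Q x y + Q x z" for x y z
    by (simp add: Q_def scale_right_distrib B_add distrib_left)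
  have Q_scaleR: "Q x (r *\<^sub>R y) = of_real r * Q x y" for x y r
    by (simp add: Q_def scale_scaleR B_scaleR right_diff_distrib)
  have Q_j: "Q x (scale j y) = j * Q x y" for x y
    using j(2)
  proof
    assume "j = 0"
    then show ?thesis using B_scaleR[of x 0 0] by (simp add: Q_def)
  next
    assume jj: "j * j = - 1"
    have "B x (scale j (scale j y)) = - B x y"
      using B_scaleR[of x "-1" y] by (simp add: jj)
    then show ?thesis
      by (simp add: Q_def right_diff_distrib jj flip: mult.assoc)
  qed
  show ?thesis
  proof (rule that)
    show "hermitian_form K Q"
      unfolding hermitian_form_def
    proof (intro conjI ballI allI Q_add)
      fix a x y
      obtain r s where a: "a = of_real r + of_real s * j"
        using j(3) by blast
      have "scale a y = r *\<^sub>R y + s *\<^sub>R scale j y"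
        by (simp add: a scale_left_distrib scale_of_real flip: scale_scale)
      then show "Q x (scale a y) = a * Q x y"
        by (simp add: Q_add Q_scaleR Q_j a distrib_right mult.assoc)
      have "B y (scale j x) = - B x (scale j y)"
        using B_j[of y x] B_commute[of "scale j y" x] by simp
      then show "Q y x = conjg (Q x y)"
        using B_commute[of x y] by (simp add: Q_def conjg_diff conjg_mult j(1))
    qed
  next
    fix x
    have "ket_bra_sym x x = 2 *\<^sub>R ket_bra K x"
      by (simp add: op ket_bra_def scaleR_2)
    then have "B x x = \<phi> (ket_bra K x)"
      by (simp add: B_def linear_scale[OF \<phi>])
    moreover have "B x (scale j x) = 0"
      using B_j[of x x] B_commute[of "scale j x" x] by simp
    ultimately show "Q x x = of_real (\<phi> (ket_bra K x))"
      by (simp add: Q_def)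
  qed
qed

lemma extreme_point_symmetric_perturbation:
  assumes C: "C extreme_point_of correlation_matrices"
    and D: "\<And>r. r \<in> {- 1, 1} \<Longrightarrow> (\<lambda>n m. C n m + r *\<^sub>R D n m) \<in> correlation_matrices"
  shows "D n m = 0"
proof (rule ccontr)
  assume nz: "D n m \<noteq> 0"
  let ?A = "\<lambda>n m. C n m + (- 1) *\<^sub>R D n m" and ?B = "\<lambda>n m. C n m + 1 *\<^sub>R D n m"
  have "?A \<noteq> ?B"
  proof
    assume "?A = ?B"
    then have "C n m + (- 1) *\<^sub>R D n m = C n m + 1 *\<^sub>R D n m"
      by (rule fun_cong[OF fun_cong])
    then have "2 *\<^sub>R D n m = 0"
      by (simp add: scaleR_2 neg_eq_iff_add_eq_0)
    then show False using nz by simp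
  qed
  moreover have "c = (1 - 1/2) *\<^sub>R (c + (- 1) *\<^sub>R d) + (1/2) *\<^sub>R (c + 1 *\<^sub>R d)" for c d :: 'f
    by (simp add: scaleR_conv_of_real field_simps)
  then have "C = (1 - 1/2) *\<^sub>R ?A + (1/2) *\<^sub>R ?B"
    unfolding fun_eq_iff scaleR_fun_def plus_fun_apply by blast
  ultimately have "C \<in> open_segment ?A ?B"
    unfolding in_segment by (intro conjI exI[of _ "1/2"]) auto
  then show False
    using C D[of "-1"] D[of 1] unfolding extreme_point_of_def by blast
qed

lemma extreme_imp_functional_zero:
  assumes C: "C extreme_point_of correlation_matrices"
    and \<phi>: "linear \<phi>" "\<And>T. T \<in> selfadjoint_trace_class K \<Longrightarrow> \<bar>\<phi> T\<bar> \<le> trace_norm K T"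
    and zero: "\<And>n. \<phi> (ket_bra K (\<eta> n)) = 0"
    and x: "x \<in> K"
  shows "\<phi> (ket_bra K x) = 0"
proof -
  obtain Q where Q: "hermitian_form K Q" "\<And>x. x \<in> K \<Longrightarrow> Q x x = of_real (\<phi> (ket_bra K x))"
    using functional_hermitian_form[OF \<phi>(1)] by metis
  have QL: "hermitian_form L Q"
    using Q(1) L_subset unfolding hermitian_form_def by blast
  define D where "D n m = Q (\<eta> n) (\<eta> m)" for n m
  \<comment> \<open>The right-hand side is the form of C at any coefficients of y, so the forms of D
    and - D lie below that of C.\<close>
  have ket_le: "\<bar>\<phi> (ket_bra K y)\<bar> \<le> (norm y)\<^sup>2" if "y \<in> K" for y
    using \<phi>(2)[OF ket_bra_trace_class[OF that]] trace_norm_ket_bra[OF that] by linarith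
  have D_form: "matrix_form D I c = of_real (\<phi> (ket_bra K (\<Sum>n\<in>I. scale (c n) (\<eta> n))))" for I c
  proof -
    have "(\<Sum>n\<in>I. scale (c n) (\<eta> n)) \<in> K"
      using eta_K subspace_K by (intro subspace_sum subspace_scale)
    then show ?thesis
      using matrix_form_hermitian_form[OF QL, of c I] Q(2) by (simp add: D_def[abs_def])
  qed
  have "(\<lambda>n m. C n m + r *\<^sub>R D n m) \<in> correlation_matrices" if r: "r \<in> {- 1, 1}" for r
    unfolding correlation_matrices_iff
  proof (intro conjI allI impI)
    fix n m
    have "D m n = conjg (D n m)"
      unfolding D_def by (rule hermitian_formD(3)[OF Q(1) eta_K eta_K])
    moreover have "C m n = conjg (C n m)"
      using C_correlation unfolding correlation_matrices_iff by blast
    ultimately show "C m n + r *\<^sub>R D m n = conjg (C n m + r *\<^sub>R D n m)"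
      by (simp only: conjg_add scaleR_conv_of_real conjg_mult conjg_of_real)
    have "C n n = 1"
      using C_correlation unfolding correlation_matrices_iff by blast
    then show "C n n + r *\<^sub>R D n n = 1"
      using Q(2)[OF eta_K] zero by (simp add: D_def)
  next
    fix I :: "nat set" and c :: "nat \<Rightarrow> 'f"
    let ?x = "\<Sum>n\<in>I. scale (c n) (\<eta> n)"
    have "?x \<in> K"
      using eta_K subspace_K by (intro subspace_sum subspace_scale)
    then have "\<bar>r * \<phi> (ket_bra K ?x)\<bar> \<le> (norm ?x)\<^sup>2"
      using ket_le r by auto
    moreover have "re (matrix_form (\<lambda>n m. C n m + r *\<^sub>R D n m) I c)
        = (norm ?x)\<^sup>2 + r * \<phi> (ket_bra K ?x)"
      by (simp only: matrix_form_add matrix_form_scaleR matrix_form_C D_form ip_self re_add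
          re_scaleR re_of_real)
    ultimately show "0 \<le> re (matrix_form (\<lambda>n m. C n m + r *\<^sub>R D n m) I c)"
      by linarith
  qed
  then have D0: "D n m = 0" for n m
    by (rule extreme_point_symmetric_perturbation[OF C])
  have L0: "\<phi> (ket_bra K y) = 0" if yL: "y \<in> L" for y
  proof -
    obtain I c where "y = (\<Sum>n\<in>I. scale (c n) (\<eta> n))"
      using L_E[OF yL] by blast
    then have "of_real (\<phi> (ket_bra K y)) = (0 :: 'f)"
      using D_form[of I c] by (simp add: matrix_form_def D0)
    then show ?thesis by simp
  qed
  obtain y where y: "\<And>n. y n \<in> L" "y \<longlonglongrightarrow> x"
    using x unfolding K_eq closure_sequential by blast
  \<comment> \<open>Passage from \<open>L\<close> to its closure: |x><x| is expanded around y n,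
    where \<phi> vanishes, and both remaining terms tend to 0.\<close>
  have "\<bar>\<phi> (ket_bra K x)\<bar> \<le> (norm (x - y n))\<^sup>2 + 2 * (norm (y n) * norm (x - y n))" for n
  proof -
    have yK: "y n \<in> K" "x - y n \<in> K"
      using y(1) L_subset x subspace_K by (auto intro: subspace_diff)
    have "ket_bra K x = ket_bra K (y n) + ket_bra K (x - y n) + ket_bra_sym (y n) (x - y n)"
      using ket_bra_add[of "y n" "x - y n"] by simp
    then have "\<phi> (ket_bra K x) = \<phi> (ket_bra K (x - y n)) + \<phi> (ket_bra_sym (y n) (x - y n))"
      using L0[OF y(1)] by (simp add: linear_add[OF \<phi>(1)])
    moreover have "\<bar>\<phi> (ket_bra_sym (y n) (x - y n))\<bar> \<le> 2 * (norm (y n) * norm (x - y n))"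
      using \<phi>(2)[OF ket_bra_sym_trace_class[OF yK]] trace_norm_ket_bra_sym[OF yK] by linarith
    ultimately show ?thesis
      using ket_le[OF yK(2)] by linarith
  qed
  moreover have "(\<lambda>n. (norm (x - y n))\<^sup>2 + 2 * (norm (y n) * norm (x - y n)))
      \<longlonglongrightarrow> (norm (x - x))\<^sup>2 + 2 * (norm x * norm (x - x))"
    by (intro tendsto_intros y(2))
  ultimately have "\<bar>\<phi> (ket_bra K x)\<bar> \<le> (norm (x - x))\<^sup>2 + 2 * (norm x * norm (x - x))"
    by (intro LIMSEQ_le_const[where X="\<lambda>n. (norm (x - y n))\<^sup>2 + 2 * (norm (y n) * norm (x - y n))"])
      blast+
  then show ?thesis by simp
qed

abbreviation S :: "('h \<Rightarrow> 'h) set" where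
  "S \<equiv> Real_Vector_Spaces.span (range (\<lambda>n. ket_bra K (\<eta> n)))"

lemma S_subset: "S \<subseteq> selfadjoint_trace_class K"
  using eta_K by (intro real_vector.span_minimal subspace_trace_class) (auto intro: ket_bra_trace_class)

lemma extreme_imp_dense:
  assumes C: "C extreme_point_of correlation_matrices"
  shows "trace_norm_dense K S"
proof (rule ccontr)
  assume "\<not> trace_norm_dense K S"
  then obtain T \<epsilon> where T: "T \<in> selfadjoint_trace_class K" and \<epsilon>: "\<epsilon> > 0"
    and far: "\<And>A. A \<in> S \<Longrightarrow> \<epsilon> \<le> trace_norm K (T - A)"
    using S_subset unfolding trace_norm_dense_def by (meson not_le)
  obtain \<phi> where \<phi>: "linear \<phi>" "\<And>T. T \<in> selfadjoint_trace_class K \<Longrightarrow> \<bar>\<phi> T\<bar> \<le> trace_norm K T"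
    "\<And>A. A \<in> S \<Longrightarrow> \<phi> A = 0" "\<epsilon> \<le> \<phi> T"
    using hahn_banach_separation[where p = "trace_norm K", OF subspace_trace_class
        real_vector.subspace_span S_subset trace_norm_nonneg trace_norm_triangle trace_norm_scaleR
        T far] by blast
  have ket0: "\<phi> (ket_bra K x) = 0" if "x \<in> K" for x
    by (rule extreme_imp_functional_zero[OF C \<phi>(1,2) _ that])
      (assumption, intro \<phi>(3) real_vector.span_base rangeI)
  \<comment> \<open>\<phi> kills the approximant, so an error of at most half of \<epsilon>
    contradicts \<phi> T >= \<epsilon>.\<close>
  obtain F l where F: "finite F" "F \<subseteq> K"
    "trace_norm K (T - (\<Sum>e\<in>F. l e *\<^sub>R ket_bra K e)) \<le> \<epsilon> / 2"
    using finite_rank_approximation[OF T, of "\<epsilon> / 2"] \<epsilon> by auto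
  let ?F = "\<Sum>e\<in>F. l e *\<^sub>R ket_bra K e"
  have "?F \<in> selfadjoint_trace_class K"
    using F(2) by (intro real_vector.subspace_sum[OF subspace_trace_class] trace_class_scaleR
        ket_bra_trace_class) auto
  then have "\<bar>\<phi> (T - ?F)\<bar> \<le> \<epsilon> / 2"
    by (rule order.trans[OF \<phi>(2)[OF trace_class_diff[OF T]] F(3)])
  moreover have "\<phi> ?F = 0"
    using F(2) ket0 by (simp add: linear_sum[OF \<phi>(1)] linear_scale[OF \<phi>(1)] subset_iff)
  ultimately show False
    using \<phi>(4) \<epsilon> by (simp add: linear_diff[OF \<phi>(1)])
qed

subsection \<open>Density implies extremality\<close>

text \<open>
  A correlation matrix dominated by a multiple of \<open>C\<close> annihilates the null vectors of \<open>C\<close>, so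
  that its form factors through \<open>c \<mapsto> \<Sum>n\<in>I. scale (c n) (\<eta> n)\<close>.
\<close>

lemma dominated_matrix_hermitian_form:
  assumes M: "M \<in> correlation_matrices"
    and dom: "\<And>I c. finite I \<Longrightarrow> re (matrix_form M I c) \<le> R * re (matrix_form C I c)"
  obtains Q where "hermitian_form L Q" "\<And>n m. Q (\<eta> n) (\<eta> m) = M n m"
    "\<And>x. x \<in> L \<Longrightarrow> 0 \<le> re (Q x x) \<and> re (Q x x) \<le> R * (norm x)\<^sup>2"
proof -
  have M_herm: "M m n = conjg (M n m)" and M_pos: "finite I \<Longrightarrow> 0 \<le> re (matrix_form M I c)" for m n I c
    using M unfolding correlation_matrices_iff by blast+
  have null: "(\<Sum>m\<in>I. M n m * c m) = 0"
    if I: "finite I" and c: "(\<Sum>n\<in>I. scale (c n) (\<eta> n)) = 0" for n I c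
  proof -
    have "matrix_form C I c = 0"
      unfolding matrix_form_C c by simp
    then have "re (matrix_form M I c) = 0"
      using dom[OF I, of c] M_pos[OF I, of c] by simp
    moreover have "conjg (matrix_form M I c) = matrix_form M I c"
      by (rule conjg_matrix_form) (rule M_herm)
    ultimately have "matrix_form M I c = 0"
      using conjg_eq_self_imp_real[of "matrix_form M I c"] by simp
    then show ?thesis by (rule correlation_form_eq_0[OF M I])
  qed
  have "\<forall>x\<in>L. \<exists>p. finite (fst p) \<and> x = (\<Sum>n\<in>fst p. scale (snd p n) (\<eta> n))"
  proof
    fix x assume "x \<in> L"
    then obtain I c where "finite I" "x = (\<Sum>n\<in>I. scale (c n) (\<eta> n))" by (rule L_E)
    then show "\<exists>p. finite (fst p) \<and> x = (\<Sum>n\<in>fst p. scale (snd p n) (\<eta> n))"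
      by (intro exI[of _ "(I, c)"]) simp
  qed
  then obtain p where p: "\<And>x. x \<in> L \<Longrightarrow> finite (fst (p x))"
    "\<And>x. x \<in> L \<Longrightarrow> x = (\<Sum>n\<in>fst (p x). scale (snd (p x) n) (\<eta> n))"
    by metis
  define g where "g n y = (\<Sum>m\<in>fst (p y). M n m * snd (p y) m)" for n y
  \<comment> \<open>The result does not depend on the representation of y: the difference of two
    representations, on the union of their index sets, represents 0 and is annihilated by M.\<close>
  have g_eq: "g n y = (\<Sum>m\<in>J. M n m * d m)"
    if J: "finite J" and y: "y \<in> L" "y = (\<Sum>m\<in>J. scale (d m) (\<eta> m))" for n y J d
  proof -
    let ?I = "fst (p y)" and ?c = "snd (p y)"
    define e where "e m = (if m \<in> ?I then ?c m else 0) - (if m \<in> J then d m else 0)" for m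
    have ext: "(\<Sum>m\<in>?I \<union> J. f m (if m \<in> A then b m else 0)) = (\<Sum>m\<in>A. f m (b m))"
      if "A = ?I \<or> A = J" "\<And>m. f m 0 = 0" for A b and f :: "nat \<Rightarrow> 'f \<Rightarrow> 'b::comm_monoid_add"
      using that p(1)[OF y(1)] J by (intro sum.mono_neutral_cong_right) auto
    have "(\<Sum>m\<in>?I \<union> J. scale (e m) (\<eta> m)) = y - y"
      using ext[of ?I "\<lambda>m a. scale a (\<eta> m)" ?c] ext[of J "\<lambda>m a. scale a (\<eta> m)" d]
        p(2)[OF y(1)] y(2)
      by (simp add: e_def scale_left_diff_distrib sum_subtractf)
    then have "(\<Sum>m\<in>?I \<union> J. M n m * e m) = 0"
      using p(1)[OF y(1)] J by (intro null) auto
    then show ?thesis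
      using ext[of ?I "\<lambda>m a. M n m * a" ?c] ext[of J "\<lambda>m a. M n m * a" d]
      by (simp add: e_def right_diff_distrib sum_subtractf g_def)
  qed
  have g_eta: "g n (\<eta> m) = M n m" for n m
    by (subst g_eq[OF _ eta_L, of "{m}" m "\<lambda>_. 1"]) simp_all
  have g_add: "g n (x + y) = g n x + g n y" if xy: "x \<in> L" "y \<in> L" for n x y
  proof -
    let ?J = "fst (p x) \<union> fst (p y)"
    define c where "c z m = (if m \<in> fst (p z) then snd (p z) m else 0)" for z m
    have J: "finite ?J" using p(1) xy by simp
    have z: "z = (\<Sum>m\<in>?J. scale (c z m) (\<eta> m))" if "z \<in> {x, y}" for z
    proof -
      have "(\<Sum>m\<in>?J. scale (c z m) (\<eta> m)) = (\<Sum>m\<in>fst (p z). scale (snd (p z) m) (\<eta> m))"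
        using that J by (intro sum.mono_neutral_cong_right) (auto simp: c_def)
      then show ?thesis using p(2)[of z] that xy by auto
    qed
    have "x + y = (\<Sum>m\<in>?J. scale (c x m + c y m) (\<eta> m))"
      using z[of x] z[of y] by (simp add: scale_left_distrib sum.distrib)
    then have "g n (x + y) = (\<Sum>m\<in>?J. M n m * (c x m + c y m))"
      by (rule g_eq[OF J span_add[OF xy]])
    also have "\<dots> = g n x + g n y"
      using g_eq[OF J xy(1) z[of x]] g_eq[OF J xy(2) z[of y]]
      by (simp add: distrib_left sum.distrib)
    finally show ?thesis .
  qed
  have g_scale: "g n (scale a x) = a * g n x" if x: "x \<in> L" for n a x
  proof -
    have "scale a x = (\<Sum>m\<in>fst (p x). scale (a * snd (p x) m) (\<eta> m))"
      by (subst p(2)[OF x]) (simp add: scale_sum_right)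
    then have "g n (scale a x) = (\<Sum>m\<in>fst (p x). M n m * (a * snd (p x) m))"
      by (rule g_eq[OF p(1)[OF x] span_scale[OF x]])
    then show ?thesis
      by (simp add: g_def sum_distrib_left mult.left_commute)
  qed
  \<comment> \<open>A fixed representation of x is used. Linearity is required in y only, where
    \<open>g_eq\<close> provides it, and exchanging the double sum makes Q Hermitian.\<close>
  define Q where "Q x y = (\<Sum>n\<in>fst (p x). conjg (snd (p x) n) * g n y)" for x y
  have Q_conjg: "Q y x = conjg (Q x y)" for x y
  proof -
    have "conjg (Q x y) = (\<Sum>n\<in>fst (p x). \<Sum>m\<in>fst (p y). conjg (snd (p y) m) * (M m n * snd (p x) n))"
      unfolding Q_def g_def sum_distrib_left conjg_sum conjg_mult conjg_conjg M_herm[symmetric]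
      by (simp add: mult_ac)
    also have "\<dots> = Q y x"
      unfolding Q_def g_def sum_distrib_left by (rule sum.swap)
    finally show ?thesis by simp
  qed
  have Q_eta: "Q x (\<eta> m) = conjg (g m x)" for x m
    unfolding Q_def g_eta unfolding g_def conjg_sum conjg_mult M_herm[symmetric] by (simp add: mult.commute)
  show ?thesis
  proof (rule that)
    show herm: "hermitian_form L Q"
      unfolding hermitian_form_def
    proof (intro conjI ballI allI Q_conjg)
      fix x y z assume "x \<in> L" "y \<in> L" "z \<in> L"
      then show "Q x (y + z) = Q x y + Q x z"
        by (simp add: Q_def g_add distrib_left sum.distrib)
    next
      fix a x y assume "x \<in> L" "y \<in> L"
      then show "Q x (scale a y) = a * Q x y"
        by (simp add: Q_def g_scale sum_distrib_left mult.left_commute)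
    qed
    show Q_M: "Q (\<eta> n) (\<eta> m) = M n m" for n m
      unfolding Q_eta g_eta by (rule M_herm[symmetric])
    fix x assume "x \<in> L"
    then obtain I c where I: "finite I" and x: "x = (\<Sum>n\<in>I. scale (c n) (\<eta> n))"
      by (rule L_E)
    have "Q x x = matrix_form M I c"
      unfolding x using matrix_form_hermitian_form[OF herm] by (simp add: Q_M)
    moreover have "re (matrix_form C I c) = (norm x)\<^sup>2"
      unfolding matrix_form_C x[symmetric] by (simp only: ip_self re_of_real)
    ultimately show "0 \<le> re (Q x x) \<and> re (Q x x) \<le> R * (norm x)\<^sup>2"
      using dom[OF I, of c] M_pos[OF I, of c] by simp
  qed
qed

text \<open>
  The left-hand side is the trace of the finite rank operator against the form \<open>Q\<close>; it is computed in
  an orthonormal eigenbasis of the operator on the finite-dimensional space spanned by its vectors.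
\<close>

lemma hermitian_form_trace_bound:
  assumes Q: "hermitian_form L Q" and Qb: "\<And>x. x \<in> L \<Longrightarrow> \<bar>re (Q x x)\<bar> \<le> R * (norm x)\<^sup>2"
    and R: "R \<ge> 0" and I: "finite I" and v: "\<And>i. i \<in> I \<Longrightarrow> v i \<in> L"
  shows "\<bar>\<Sum>i\<in>I. d i * re (Q (v i) (v i))\<bar> \<le> R * trace_norm K (\<Sum>i\<in>I. d i *\<^sub>R ket_bra K (v i))"
proof -
  let ?F = "\<Sum>i\<in>I. d i *\<^sub>R ket_bra K (v i)"
  have vK: "v i \<in> K" if "i \<in> I" for i using v[OF that] L_subset by auto
  have F: "?F \<in> selfadjoint_trace_class K"
    using vK by (intro real_vector.subspace_sum[OF subspace_trace_class] trace_class_scaleR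
        ket_bra_trace_class)
  note Fsc = trace_class_imp_compact[OF F]
  have F_apply: "?F x = (\<Sum>i\<in>I. d i *\<^sub>R scale (ip (v i) x) (v i))" if "x \<in> K" for x
    using that by (simp add: sum_fun_apply scaleR_fun_def ket_bra_apply)
  obtain V where V: "finite V" "V \<subseteq> L" "orthonormal V"
    "\<And>i. i \<in> I \<Longrightarrow> v i = (\<Sum>w\<in>V. scale (ip w (v i)) w)"
  proof -
    have "v ` I \<subseteq> L" using v by blast
    from finite_orthonormal_expansion[OF finite_imageI[OF I] this subspace_L]
    obtain V where "finite V \<and> V \<subseteq> L \<and> orthonormal V \<and> (\<forall>y\<in>v ` I. y = (\<Sum>w\<in>V. scale (ip w y) w))"
      ..
    then show thesis
      by (intro that[of V]) (simp_all only: ball_simps simp_thms)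
  qed
  \<comment> \<open>The span of V, written as the fixed points of its orthogonal projection;
    closedness is then immediate by continuity.\<close>
  define W where "W = {x. x = (\<Sum>w\<in>V. scale (ip w x) w)}"
  have "W \<subseteq> L"
  proof
    fix x assume "x \<in> W"
    then have "x = (\<Sum>w\<in>V. scale (ip w x) w)" by (simp add: W_def)
    also have "\<dots> \<in> L" using V(2) subspace_L by (intro subspace_sum subspace_scale) auto
    finally show "x \<in> L" .
  qed
  then have "W \<subseteq> K" using L_subset by auto
  have W: "subspace W" "closed W"
  proof -
    show "subspace W"
      by (auto simp: W_def subspace_def ip_add_right ip_scale_right scale_left_distrib sum.distrib
          simp flip: scale_scale scale_sum_right)
    show "closed W"
      unfolding W_def
      by (intro closed_Collect_eq continuous_intros ip.continuous_on scale.continuous_on)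
  qed
  have vW: "v i \<in> W" if "i \<in> I" for i using V(4)[OF that] by (simp add: W_def)
  have F_W: "?F x \<in> W" if "x \<in> W" for x
    unfolding F_apply[OF subsetD[OF \<open>W \<subseteq> K\<close> that]]
    by (intro subspace_sum subspace_scaleR subspace_scale W vW)
  have sym: "symmetric_on W ?F"
    by (rule symmetric_on_subset[OF selfadjoint_imp_symmetric[OF Fsc(1)] \<open>W \<subseteq> K\<close> F_W])
  obtain E l where E: "orthonormal_basis W E" and eig: "\<And>e. e \<in> E \<Longrightarrow> ?F e = l e *\<^sub>R e"
    using compact_symmetric_eigenbasis[OF W sym compact_on_subset[OF Fsc(2) \<open>W \<subseteq> K\<close>]] by metis
  have on: "orthonormal E" and EW: "E \<subseteq> W" and dense: "closure (span E) = W"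
    using E by (auto simp: orthonormal_basis_iff)
  have EL: "E \<subseteq> L" and EK: "E \<subseteq> K" using EW \<open>W \<subseteq> L\<close> \<open>W \<subseteq> K\<close> by auto
  \<comment> \<open>Dimension count by norms: Parseval in V for each vector of G, exchange of sums,
    then Bessel for G at each vector of V.\<close>
  have "finite E"
  proof (rule finite_if_finite_subsets_card_bdd[THEN conjunct1])
    fix G assume G: "G \<subseteq> E" "finite G"
    have onG: "orthonormal G" using on G(1) by (rule orthonormal_subset)
    have "real (card G) = (\<Sum>e\<in>G. (norm e)\<^sup>2)"
      using orthonormal_norm[OF onG] by simp
    also have "\<dots> = (\<Sum>e\<in>G. \<Sum>w\<in>V. (norm (ip w e))\<^sup>2)"
    proof (rule sum.cong)
      fix e assume "e \<in> G"
      then have "e = (\<Sum>w\<in>V. scale (ip w e) w)" using G EW by (auto simp: W_def)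
      then show "(norm e)\<^sup>2 = (\<Sum>w\<in>V. (norm (ip w e))\<^sup>2)"
        using norm_orthonormal_sum[OF V(3,1), of "\<lambda>w. ip w e"] by simp
    qed simp
    also have "\<dots> = (\<Sum>w\<in>V. \<Sum>e\<in>G. (norm (ip e w))\<^sup>2)"
      by (subst sum.swap) (simp add: norm_ip_commute)
    also have "\<dots> \<le> (\<Sum>w\<in>V. (norm w)\<^sup>2)"
      by (intro sum_mono bessel onG G)
    also have "\<dots> = real (card V)"
      using orthonormal_norm[OF V(3)] by simp
    finally show "card G \<le> card V" by simp
  qed
  have v_exp: "v i = (\<Sum>e\<in>E. scale (ip e (v i)) e)" if "i \<in> I" for i
    using has_sum_unique[OF has_sum_orthonormal_expansion[OF on] has_sum_finite[OF \<open>finite E\<close>]]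
      vW[OF that] dense by blast
  \<comment> \<open>These are the matrix entries of \<open>?F\<close> in its eigenbasis, so only the
    diagonal values Q e e survive below.\<close>
  have ip_F: "(\<Sum>i\<in>I. d i *\<^sub>R (ip (v i) e * ip f (v i))) = (if e = f then of_real (l e) else 0)"
    if "e \<in> E" "f \<in> E" for e f
  proof -
    have "(\<Sum>i\<in>I. d i *\<^sub>R (ip (v i) e * ip f (v i))) = ip f (?F e)"
      using F_apply[of e] that EK by (auto simp: ip.sum_right ip_scaleR_right ip_scale_right)
    also have "\<dots> = (if e = f then of_real (l e) else 0)"
      using eig[OF that(1)] orthonormalD[OF on that(2,1)]
      by (auto simp: ip_scaleR_right scaleR_conv_of_real)
    finally show ?thesis .
  qed
  have "(\<Sum>i\<in>I. d i *\<^sub>R Q (v i) (v i))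
      = (\<Sum>i\<in>I. \<Sum>e\<in>E. \<Sum>f\<in>E. Q e f * (d i *\<^sub>R (ip (v i) e * ip f (v i))))"
  proof (rule sum.cong)
    fix i assume i: "i \<in> I"
    have "Q (v i) (v i) = (\<Sum>e\<in>E. \<Sum>f\<in>E. conjg (ip e (v i)) * Q e f * ip f (v i))"
      using hermitian_form_sum[OF Q subspace_L, of E "\<lambda>e. e" "\<lambda>e. ip e (v i)"] EL v_exp[OF i]
      by auto
    then show "d i *\<^sub>R Q (v i) (v i) = (\<Sum>e\<in>E. \<Sum>f\<in>E. Q e f * (d i *\<^sub>R (ip (v i) e * ip f (v i))))"
      by (simp add: scaleR_sum_right mult_ac flip: ip_conjg)
  qed simp
  also have "\<dots> = (\<Sum>e\<in>E. \<Sum>i\<in>I. \<Sum>f\<in>E. Q e f * (d i *\<^sub>R (ip (v i) e * ip f (v i))))"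
    by (rule sum.swap)
  also have "\<dots> = (\<Sum>e\<in>E. \<Sum>f\<in>E. \<Sum>i\<in>I. Q e f * (d i *\<^sub>R (ip (v i) e * ip f (v i))))"
    by (intro sum.cong refl sum.swap)
  also have "\<dots> = (\<Sum>e\<in>E. \<Sum>f\<in>E. Q e f * (if e = f then of_real (l e) else 0))"
    by (intro sum.cong refl) (simp only: sum_distrib_left[symmetric] ip_F)
  also have "\<dots> = (\<Sum>e\<in>E. of_real (l e) * Q e e)"
    using \<open>finite E\<close> by (simp add: if_distrib mult.commute cong: if_cong)
  finally have "re (\<Sum>i\<in>I. d i *\<^sub>R Q (v i) (v i)) = re (\<Sum>e\<in>E. of_real (l e) * Q e e)"
    by simp
  then have "(\<Sum>i\<in>I. d i * re (Q (v i) (v i))) = (\<Sum>e\<in>E. l e * re (Q e e))"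
    by (simp add: re_sum re_scaleR)
  then have "\<bar>\<Sum>i\<in>I. d i * re (Q (v i) (v i))\<bar> \<le> (\<Sum>e\<in>E. \<bar>l e * re (Q e e)\<bar>)"
    by (simp add: sum_abs)
  also have "\<dots> \<le> (\<Sum>e\<in>E. R * \<bar>l e\<bar>)"
  proof (rule sum_mono)
    fix e assume e: "e \<in> E"
    then have "\<bar>re (Q e e)\<bar> \<le> R"
      using Qb[of e] EL orthonormal_norm[OF on e] by auto
    then show "\<bar>l e * re (Q e e)\<bar> \<le> R * \<bar>l e\<bar>"
      unfolding abs_mult mult.commute[of R] by (rule mult_left_mono) simp
  qed
  \<comment> \<open>The sum of |l e| is a diagonal sum of \<open>?F\<close> over a finite
    orthonormal set, which the trace norm dominates.\<close>
  also have "\<dots> = R * (\<Sum>e\<in>E. \<bar>re (ip e (?F e))\<bar>)"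
  proof -
    have "re (ip e (?F e)) = l e" if "e \<in> E" for e
      using eig[OF that] orthonormal_norm[OF on that]
      by (simp only: ip_scaleR_right re_scaleR ip_self re_of_real) simp
    then show ?thesis by (simp add: sum_distrib_left)
  qed
  also have "\<dots> \<le> R * trace_norm K ?F"
    using diag_boundD[OF diag_bound_trace_norm[OF F] \<open>finite E\<close> EK on] R by (rule mult_left_mono)
  finally show ?thesis .
qed

lemma dense_imp_hermitian_form_zero:
  assumes dense: "trace_norm_dense K S"
    and Q: "hermitian_form L Q" and Qb: "\<And>x. x \<in> L \<Longrightarrow> \<bar>re (Q x x)\<bar> \<le> R * (norm x)\<^sup>2"
    and R: "R \<ge> 0" and diag: "\<And>n. Q (\<eta> n) (\<eta> n) = 0" and xy: "x \<in> L" "y \<in> L"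
  shows "Q x y = 0"
proof (rule hermitian_form_polarization[OF Q subspace_L xy])
  fix z assume z: "z \<in> L"
  have "\<bar>re (Q z z)\<bar> \<le> R * \<epsilon>" if "\<epsilon> > 0" for \<epsilon>
  proof -
    have "ket_bra K z \<in> selfadjoint_trace_class K"
      using z L_subset by (intro ket_bra_trace_class) auto
    then obtain A where A: "A \<in> S" "trace_norm K (ket_bra K z - A) < \<epsilon>"
      using dense \<open>\<epsilon> > 0\<close> unfolding trace_norm_dense_def by blast
    obtain G r where G: "finite G" "G \<subseteq> range (\<lambda>n. ket_bra K (\<eta> n))" "A = (\<Sum>T\<in>G. r T *\<^sub>R T)"
      using A(1) unfolding real_vector.span_explicit by blast
    \<comment> \<open>Distinct indices may give the same operator, for instance when the vectors
      differ by a phase.\<close>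
    obtain I where I': "inj_on (\<lambda>n. ket_bra K (\<eta> n)) I" "G = (\<lambda>n. ket_bra K (\<eta> n)) ` I"
      using G(2) by (auto simp: subset_image_inj)
    then have I: "finite I" using G(1) by (simp add: finite_image_iff)
    define a where "a n = r (ket_bra K (\<eta> n))" for n
    have A_eq: "A = (\<Sum>n\<in>I. a n *\<^sub>R ket_bra K (\<eta> n))"
      unfolding G(3) I'(2) a_def by (simp add: sum.reindex[OF I'(1)])
    \<comment> \<open>\<open>None\<close> carries z and \<open>Some n\<close> carries
      \<open>\<eta> n\<close>, so that |z><z| - A is a single finite combination of rank-one
      operators; on the form side only the term of z survives.\<close>
    define v where "v i = (case i of None \<Rightarrow> z | Some n \<Rightarrow> \<eta> n)" for i
    define d where "d i = (case i of None \<Rightarrow> 1 | Some n \<Rightarrow> - a n)" for i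
    let ?I = "insert None (Some ` I)"
    have sum_I: "(\<Sum>i\<in>?I. f i) = f None + (\<Sum>n\<in>I. f (Some n))" for f :: "nat option \<Rightarrow> 'c::comm_monoid_add"
      using I by (simp add: sum.reindex)
    have "\<bar>\<Sum>i\<in>?I. d i * re (Q (v i) (v i))\<bar> \<le> R * trace_norm K (\<Sum>i\<in>?I. d i *\<^sub>R ket_bra K (v i))"
      using I z eta_L
      by (intro hermitian_form_trace_bound[OF Q Qb R]) (auto simp: v_def)
    moreover have "(\<Sum>i\<in>?I. d i * re (Q (v i) (v i))) = re (Q z z)"
      by (simp add: sum_I v_def d_def diag)
    moreover have "(\<Sum>i\<in>?I. d i *\<^sub>R ket_bra K (v i)) = ket_bra K z - A"
      by (simp add: sum_I v_def d_def A_eq sum_negf)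
    ultimately have "\<bar>re (Q z z)\<bar> \<le> R * trace_norm K (ket_bra K z - A)" by simp
    also have "\<dots> \<le> R * \<epsilon>" using A(2) R by (intro mult_left_mono) auto
    finally show ?thesis .
  qed
  note le = this
  have "\<bar>re (Q z z)\<bar> \<le> \<epsilon>" if "\<epsilon> > 0" for \<epsilon>
  proof -
    \<comment> \<open>R + 1 instead of R, because R may be 0.\<close>
    have "R * (\<epsilon> / (R + 1)) \<le> \<epsilon>"
      using R that by (simp add: field_simps)
    then show ?thesis
      using le[of "\<epsilon> / (R + 1)"] R that by simp
  qed
  then have "\<bar>re (Q z z)\<bar> \<le> 0"
    by (rule field_le_epsilon[of _ 0, simplified])
  then show "re (Q z z) = 0" by simp
qed

lemma dense_imp_extreme:
  assumes dense: "trace_norm_dense K S"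
  shows "C extreme_point_of correlation_matrices"
  unfolding extreme_point_of_def
proof (intro conjI ballI notI)
  show "C \<in> correlation_matrices" by (rule C_correlation)
  fix A B :: "nat \<Rightarrow> nat \<Rightarrow> 'f"
  assume AB: "A \<in> correlation_matrices" "B \<in> correlation_matrices"
  assume "C \<in> open_segment A B"
  then obtain u where "A \<noteq> B" and u: "0 < u" "u < 1" and C: "C = (1 - u) *\<^sub>R A + u *\<^sub>R B"
    unfolding in_segment by blast
  have C_form: "re (matrix_form C I c) = (1 - u) * re (matrix_form A I c) + u * re (matrix_form B I c)" for I c
  proof -
    have "C = (\<lambda>n m. (1 - u) *\<^sub>R A n m + u *\<^sub>R B n m)"
      by (simp add: C fun_eq_iff scaleR_fun_def)
    then show ?thesis
      by (simp only: matrix_form_add matrix_form_scaleR re_add re_scaleR)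
  qed
  have pos: "0 \<le> re (matrix_form A I c)" "0 \<le> re (matrix_form B I c)" if "finite I" for I c
    using AB that unfolding correlation_matrices_iff by blast+
  \<comment> \<open>Positivity of the other summand gives A <= C / (1 - u) and B <= C / u as forms;
    R serves both.\<close>
  define R where "R = max (1 / (1 - u)) (1 / u)"
  have "R \<ge> 0" unfolding R_def using u by (simp add: le_max_iff_disj)
  have Ru: "1 \<le> R * (1 - u)" "1 \<le> R * u"
    using u by (simp_all add: R_def max_mult_distrib_right)
  have domA: "re (matrix_form A I c) \<le> R * re (matrix_form C I c)"
    and domB: "re (matrix_form B I c) \<le> R * re (matrix_form C I c)" if I: "finite I" for I c
  proof -
    have "R * re (matrix_form C I c)
        = (R * (1 - u)) * re (matrix_form A I c) + (R * u) * re (matrix_form B I c)"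
      by (simp add: C_form algebra_simps)
    moreover have "(R * (1 - u)) * re (matrix_form A I c) \<ge> 1 * re (matrix_form A I c)"
      "(R * u) * re (matrix_form B I c) \<ge> 1 * re (matrix_form B I c)"
      using Ru pos[OF I] by (intro mult_right_mono; blast)+
    ultimately show "re (matrix_form A I c) \<le> R * re (matrix_form C I c)"
      "re (matrix_form B I c) \<le> R * re (matrix_form C I c)"
      using pos[OF I, of c] by linarith+
  qed
  obtain P where P: "hermitian_form L P" "\<And>n m. P (\<eta> n) (\<eta> m) = A n m"
    "\<And>x. x \<in> L \<Longrightarrow> 0 \<le> re (P x x) \<and> re (P x x) \<le> R * (norm x)\<^sup>2"
    using dominated_matrix_hermitian_form[OF AB(1) domA] by metis
  obtain Q where Q: "hermitian_form L Q" "\<And>n m. Q (\<eta> n) (\<eta> m) = B n m"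
    "\<And>x. x \<in> L \<Longrightarrow> 0 \<le> re (Q x x) \<and> re (Q x x) \<le> R * (norm x)\<^sup>2"
    using dominated_matrix_hermitian_form[OF AB(2) domB] by metis
  have "A n n = 1" "B n n = 1" for n
    using AB unfolding correlation_matrices_iff by blast+
  then have diag: "P (\<eta> n) (\<eta> n) - Q (\<eta> n) (\<eta> n) = 0" for n
    by (simp add: P(2) Q(2))
  \<comment> \<open>Both real parts lie between 0 and R (norm x)^2, hence so does the modulus of
    their difference.\<close>
  have bound: "\<bar>re (P x x - Q x x)\<bar> \<le> R * (norm x)\<^sup>2" if "x \<in> L" for x
    unfolding re_diff using P(3)[OF that] Q(3)[OF that] by linarith
  have "P (\<eta> n) (\<eta> m) - Q (\<eta> n) (\<eta> m) = 0" for n m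
    by (rule dense_imp_hermitian_form_zero[OF dense hermitian_form_diff[OF P(1) Q(1)] bound
          \<open>R \<ge> 0\<close> diag eta_L eta_L])
  then have "A = B"
    by (simp add: P(2) Q(2) fun_eq_iff)
  then show False using \<open>A \<noteq> B\<close> by simp
qed

end

theorem theorem1:
  fixes scale :: "'f::real_or_complex \<Rightarrow> 'h::{real_inner,complete_space} \<Rightarrow> 'h"
    and ip :: "'h \<Rightarrow> 'h \<Rightarrow> 'f"
    and C :: "nat \<Rightarrow> nat \<Rightarrow> 'f"
    and \<eta> :: "nat \<Rightarrow> 'h"
    and K :: "'h set"
    and S :: "('h \<Rightarrow> 'h) set"
  assumes "hilbert_space scale ip"
    and "C \<in> correlation_matrices"
    and "\<And>n. norm (\<eta> n) = 1"
    and "\<And>n m. C n m = ip (\<eta> n) (\<eta> m)"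
    and "K = closure (module.span scale (range \<eta>))"
    and "S = span (range (\<lambda>n. hilbert_space.ket_bra scale ip K (\<eta> n)))"
  shows "C extreme_point_of correlation_matrices \<longleftrightarrow>
    hilbert_space.trace_norm_dense scale ip K S"
proof -
  interpret hilbert_space scale ip by fact
  have "subspace K"
    unfolding assms(5)
  proof (rule subspaceI)
    show "0 \<in> closure (span (range \<eta>))"
      using closure_subset span_zero by blast
    fix x y assume "x \<in> closure (span (range \<eta>))" "y \<in> closure (span (range \<eta>))"
    then obtain f g where f: "\<And>n. f n \<in> span (range \<eta>)" "f \<longlonglongrightarrow> x"
      and g: "\<And>n. g n \<in> span (range \<eta>)" "g \<longlonglongrightarrow> y"
      unfolding closure_sequential by blast
    have "(\<lambda>n. f n + g n) \<longlonglongrightarrow> x + y" by (intro tendsto_intros f g)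
    moreover have "f n + g n \<in> span (range \<eta>)" for n by (intro span_add f g)
    ultimately show "x + y \<in> closure (span (range \<eta>))"
      unfolding closure_sequential by (intro exI[of _ "\<lambda>n. f n + g n"] conjI allI)
    have "(\<lambda>n. scale a (f n)) \<longlonglongrightarrow> scale a x" for a
      by (intro scale.tendsto tendsto_const f)
    moreover have "scale a (f n) \<in> span (range \<eta>)" for a n by (intro span_scale f)
    ultimately show "scale a x \<in> closure (span (range \<eta>))" for a
      unfolding closure_sequential by (intro exI[of _ "\<lambda>n. scale a (f n)"] conjI allI)
  qed
  then interpret gram_matrix scale ip K \<eta> C
    using assms by unfold_locales auto
  show ?thesis
    unfolding assms(6) using extreme_imp_dense dense_imp_extreme by blast
qed

end
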